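(* Let $S$ be a set of $N$ elements (integers), each assigned a color. In the external memory model with block size $B$, there exists a data structure using linear space (i.e. $O(N/B)$ blocks) that, for any query range $[a,b]$, reports the distinct colors of the elements of $S\cap[a,b]$ using $O(k/B+1)$ I/Os, where $k$ is the number of distinct colors of elements in $S\cap[a,b]$.
   Context: External memory model: data is stored on disk in blocks of $B$ words; the cost measure is the number of block transfers (I/Os) between disk and internal memory. The one-dimensional color range reporting problem: preprocess a set $S$ of colored elements so that for any query interval $[a,b]$ the set of distinct colors of elements of $S\cap[a,b]$ can be reported. The data structure is static. *)

theory Defs
  imports Complex_Main
begin

text \<open>
  External memory model. A machine word holds a signed integer of \<open>w\<close> bits, a disk block consists
  of \<open>B\<close> words, and the internal memory consists of \<open>M\<close> words. Internal computation is free; only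
  block transfers are counted.
\<close>

definition words :: "nat \<Rightarrow> int set" where
  "words w = {- (2 ^ (w - 1))..<2 ^ (w - 1)}"

definition is_memory :: "nat \<Rightarrow> nat \<Rightarrow> int list \<Rightarrow> bool" where
  "is_memory w M mem \<longleftrightarrow> length mem = M \<and> set mem \<subseteq> words w"

definition is_disk :: "nat \<Rightarrow> nat \<Rightarrow> int list list \<Rightarrow> bool" where
  "is_disk w B D \<longleftrightarrow> (\<forall>blk \<in> set D. length blk = B \<and> set blk \<subseteq> words w)"

text \<open>
  \<open>Read j p\<close> transfers disk block \<open>j\<close> into the internal memory cells \<open>p, \<dots>, p + B - 1\<close>;
  \<open>Report p\<close> outputs the contents of memory cell \<open>p\<close>.
\<close>

datatype command = Halt | Report nat | Read nat nat

text \<open>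
  A program looks at the whole internal memory, overwrites it with new contents and issues a
  command. It has no state besides the internal memory, so all that it knows about the
  disk is what it has read and kept in the \<open>M\<close> words.
\<close>

type_synonym program = "int list \<Rightarrow> int list \<times> command"

definition load :: "nat \<Rightarrow> int list \<Rightarrow> int list \<Rightarrow> int list" where
  "load p blk mem = take p mem @ blk @ drop (p + length blk) mem"

text \<open>
  \<open>exec w B M P D mem out t\<close>: started with internal memory \<open>mem\<close>, program \<open>P\<close> halts on the disk \<open>D\<close>
  after outputting \<open>out\<close> and performing exactly \<open>t\<close> block transfers. There is no rule for a step
  that leaves the \<open>M\<close> words of memory, produces a non-word, or addresses a block outside \<open>D\<close>:
  such a run is stuck.
\<close>

inductive exec ::
  "nat \<Rightarrow> nat \<Rightarrow> nat \<Rightarrow> program \<Rightarrow> int list list \<Rightarrow> int list \<Rightarrow> int list \<Rightarrow> nat \<Rightarrow> bool"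
  for w B M P D where
  exec_Halt: "P mem = (mem', Halt) \<Longrightarrow> is_memory w M mem' \<Longrightarrow> exec w B M P D mem [] 0"
| exec_Report: "P mem = (mem', Report p) \<Longrightarrow> is_memory w M mem' \<Longrightarrow> p < M \<Longrightarrow>
    exec w B M P D mem' out t \<Longrightarrow> exec w B M P D mem (mem' ! p # out) t"
| exec_Read: "P mem = (mem', Read j p) \<Longrightarrow> is_memory w M mem' \<Longrightarrow> p + B \<le> M \<Longrightarrow> j < length D \<Longrightarrow>
    exec w B M P D (load p (D ! j) mem') out t \<Longrightarrow> exec w B M P D mem out (Suc t)"

lemma exec_deterministic:
  "exec w B M P D mem out t \<Longrightarrow> exec w B M P D mem out' t' \<Longrightarrow> out = out' \<and> t = t'"
proof (induction arbitrary: out' t' rule: exec.induct)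
  case (exec_Halt mem mem')
  from exec_Halt.prems show ?case
    by (cases rule: exec.cases) (simp_all add: exec_Halt.hyps)
next
  case (exec_Report mem mem' p out t)
  from exec_Report.prems show ?case
    by (cases rule: exec.cases) (use exec_Report.hyps(1) exec_Report.IH in fastforce)+
next
  case (exec_Read mem mem' j p out t)
  from exec_Read.prems show ?case
    by (cases rule: exec.cases) (use exec_Read.hyps(1) exec_Read.IH in fastforce)+
qed

definition query_memory :: "nat \<Rightarrow> int \<Rightarrow> int \<Rightarrow> int list" where
  "query_memory M a b = a # b # replicate (M - 2) 0"

definition range_colors :: "int set \<Rightarrow> (int \<Rightarrow> int) \<Rightarrow> int \<Rightarrow> int \<Rightarrow> int set" where
  "range_colors S col a b = col ` (S \<inter> {a..b})"

text \<open>
  \<open>D\<close> is a data structure for the coloured set \<open>S\<close>, and \<open>P\<close> a query program, with space and query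
  bounds that have the constant \<open>c\<close>. The summand \<open>1\<close> in the space bound accounts for
  \<open>card S < B\<close>, since space is allocated in whole blocks.
\<close>

definition color_reporting_structure ::
  "real \<Rightarrow> nat \<Rightarrow> nat \<Rightarrow> nat \<Rightarrow> program \<Rightarrow> int set \<Rightarrow> (int \<Rightarrow> int) \<Rightarrow> int list list \<Rightarrow> bool" where
  "color_reporting_structure c w B M P S col D \<longleftrightarrow>
     is_disk w B D \<and>
     real (length D) \<le> c * (real (card S) / real B + 1) \<and>
     (\<forall>a \<in> words w. \<forall>b \<in> words w. \<exists>out t.
        exec w B M P D (query_memory M a b) out t \<and>
        distinct out \<and> set out = range_colors S col a b \<and>
        real t \<le> c * (real (card (range_colors S col a b)) / real B + 1))"

end

theory Submission
  imports Defs "HOL-Library.FuncSet"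
begin

text \<open>
  Let the elements be sorted and numbered by rank, and store with each element the value of its
  predecessor of the same colour. An element of the range \<open>[a, b]\<close> is the first of its colour there iff
  that predecessor is below \<open>a\<close>, so every scanned block can be filtered internally without producing a
  colour twice. The data structure has to supply \<open>O(k / B + 1)\<close> blocks that contain all first occurrences.

  The ranks are cut into windows of \<open>2 n\<close> blocks, where \<open>n = \<Theta>(w)\<close>, consecutive windows overlapping by
  half. A query first finds in \<open>O(1)\<close> I/Os a window that meets the range. The binary trie node at which
  \<open>a\<close> and \<open>b\<close> separate determines such a window if it is heavy, that is, if it has at least half a window
  of elements below it; otherwise its topmost light ancestor does, whose height is found from the node
  itself or from an ancestor at a height divisible by \<open>\<Theta>(\<surd>w)\<close>. These tables are static
  functions on few keys; a counting argument gives a family of hash functions with seeds of \<open>O(w)\<close> bits that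
  stores them in linear space, even though the keys are not stored. A two-level fusion node finds the
  position of \<open>a\<close> in the window.

  Inside the window, consecutive blocks are merged, for each possible position \<open>i\<close> of \<open>a\<close>, into segments
  with at most \<open>B\<close> elements whose predecessor lies before block \<open>i\<close>. Since only such elements pass the
  filter, a segment costs one I/O, and two adjacent segments together contain more than \<open>B\<close> of them.
  The segmentations for different \<open>i\<close> form a chain, and one snapshot per block boundary serves all of them.

  Left of the window the last occurrences of the colours, and right of it the first ones, are scanned from
  lists truncated to half a window. If such a list overflows, then \<open>k\<close> is at least half a window,
  and a dyadic tree over the half-windows, with truncated lists of the smallest predecessors at its
  nodes, is affordable.

  Since internal computation is free, the query algorithm is described as a machine with \<open>O(w)\<close>-bit states
  that performs \<open>O(1)\<close> reads per round; its control state fits into \<open>O(B)\<close> words of internal memory.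
\<close>

section \<open>Hash families and static functions\<close>

text \<open>Known lower bounds keep \<open>a\<close> from being ranked among all elements in O(1)
  I/Os and linear space. A nonempty range only has to be located up to some element of it, and the
  lowest common ancestor of \<open>a\<close> and \<open>b\<close> makes this possible with static
  tables. Three sizes have to balance. Windows of order w blocks make heavy nodes rare, O(N) over
  all levels, yet a bit vector over the blocks of a window still has O(w) bits, and two fusion nodes
  of O(sqrt w) keys suffice to search it. Heights for all light nodes would need O(w) keys per
  element; jumping to heights divisible by f leaves O(w / f + f), least for f of order sqrt w, and
  O(sqrt w) values of O(log w) bits are O(1) words. Finally, an overflowing list guarantees k >= n *
  B, so that O(n) I/Os, enough for every level of the dyadic tree, are affordable. The program may
  be any function of w, B and M. It can therefore contain hash families whose existence is only
  known by counting; just the seeds depend on the data.\<close>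

lemma covering_sequence_aux:
  fixes X :: "'a set" and Y :: "'b set" and good :: "'a \<Rightarrow> 'b \<Rightarrow> bool" and q :: nat
  assumes fin: "finite X" "finite Y" and ne: "Y \<noteq> {}" and q: "q > 0"
    and frac: "\<And>x. x \<in> X \<Longrightarrow> card Y \<le> q * card {y \<in> Y. good x y}"
  shows "\<exists>h. (\<forall>i<T. h i \<in> Y) \<and>
    real (card {x \<in> X. \<forall>i<T. \<not> good x (h i)}) \<le> (1 - 1 / q) ^ T * card X"
proof (induction T)
  case 0
  then show ?case by simp
next
  case (Suc T)
  then obtain h where h: "\<forall>i<T. h i \<in> Y"
    and le: "real (card {x \<in> X. \<forall>i<T. \<not> good x (h i)}) \<le> (1 - 1 / q) ^ T * card X" by blast
  define R where "R = {x \<in> X. \<forall>i<T. \<not> good x (h i)}"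
  have finR: "finite R" and RX: "R \<subseteq> X" using fin by (auto simp: R_def)
  \<comment> \<open>Averaging: counting the pairs \<open>good x y\<close> with x in R by rows and by
    columns gives a y that is good for at least a fraction 1/q of what is still uncovered.\<close>
  have "\<exists>y\<in>Y. card R \<le> q * card {x \<in> R. good x y}"
  proof (rule ccontr)
    assume "\<not> ?thesis"
    then have lt: "q * card {x \<in> R. good x y} < card R" if "y \<in> Y" for y
      using that by force
    have "(\<Sum>y\<in>Y. q * card {x \<in> R. good x y}) < (\<Sum>y\<in>Y. card R)"
      by (rule sum_strict_mono) (use fin ne lt in auto)
    also have "(\<Sum>y\<in>Y. card R) = card R * card Y" by simp
    also have "\<dots> \<le> (\<Sum>x\<in>R. q * card {y \<in> Y. good x y})"
      using sum_bounded_below[of R "card Y" "\<lambda>x. q * card {y \<in> Y. good x y}"] frac RX by auto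
    also have "\<dots> = q * (\<Sum>x\<in>R. card {y \<in> Y. good x y})" by (simp add: sum_distrib_left)
    also have "(\<Sum>x\<in>R. card {y \<in> Y. good x y}) = (\<Sum>y\<in>Y. card {x \<in> R. good x y})"
      by (rule sum_multicount_gen) (use fin finR in auto)
    finally show False by (simp add: sum_distrib_left)
  qed
  then obtain y where y: "y \<in> Y" and cy: "card R \<le> q * card {x \<in> R. good x y}" by blast
  define h' where "h' = h(T := y)"
  have eq: "{x \<in> X. \<forall>i<Suc T. \<not> good x (h' i)} = R - {x \<in> R. good x y}"
    by (auto simp: R_def h'_def less_Suc_eq)
  have "real (card (R - {x \<in> R. good x y})) = real (card R) - real (card {x \<in> R. good x y})"
    using finR by (subst card_Diff_subset) (auto simp: of_nat_diff card_mono)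
  also have "\<dots> \<le> real (card R) - real (card R) / q"
  proof -
    have "real (card R) \<le> q * real (card {x \<in> R. good x y})"
      using cy by (metis of_nat_le_iff of_nat_mult)
    then show ?thesis using q by (simp add: field_simps)
  qed
  also have "\<dots> = (1 - 1 / q) * card R" by (simp add: field_simps)
  also have "\<dots> \<le> (1 - 1 / q) * ((1 - 1 / q) ^ T * card X)"
    using le q by (intro mult_left_mono) (auto simp: R_def)
  finally have "real (card {x \<in> X. \<forall>i<Suc T. \<not> good x (h' i)}) \<le> (1 - 1 / q) ^ Suc T * card X"
    by (simp add: eq)
  moreover have "\<forall>i<Suc T. h' i \<in> Y" using h y by (auto simp: h'_def less_Suc_eq)
  ultimately show ?case by blast
qed

text \<open>Greedy covering: q further choices at least halve the uncovered set, because (1 - 1/q)^q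
  <= 1/e <= 1/2, so q * (m + 1) choices leave fewer than one of the at most 2^m points. The index of
  a choice is what gets stored as a seed.\<close>

lemma covering_sequence:
  fixes X :: "'a set" and Y :: "'b set" and good :: "'a \<Rightarrow> 'b \<Rightarrow> bool" and q m :: nat
  assumes fin: "finite X" "finite Y" and ne: "Y \<noteq> {}" and q: "q > 0"
    and frac: "\<And>x. x \<in> X \<Longrightarrow> card Y \<le> q * card {y \<in> Y. good x y}"
    and X: "card X \<le> 2 ^ m"
  shows "\<exists>h. \<forall>x\<in>X. \<exists>i<q * (m + 1). h i \<in> Y \<and> good x (h i)"
proof -
  define T where "T = q * (m + 1)"
  obtain h where h: "\<forall>i<T. h i \<in> Y"
    and le: "real (card {x \<in> X. \<forall>i<T. \<not> good x (h i)}) \<le> (1 - 1 / q) ^ T * card X"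
    using covering_sequence_aux[OF fin ne q, of good T] frac by blast
  have pos: "0 \<le> 1 - 1 / real q" using q by simp
  have "(1 - 1 / real q) ^ T = ((1 - 1 / real q) ^ q) ^ (m + 1)" by (simp only: T_def power_mult)
  also have "\<dots> \<le> (1/2) ^ (m + 1)"
  proof (rule power_mono)
    have "(1 - 1 / real q) ^ q \<le> exp (- 1 / real q) ^ q"
      using exp_ge_add_one_self[of "- 1 / real q"] pos by (intro power_mono) auto
    also have "\<dots> = exp (-1)" using q by (simp flip: exp_of_nat_mult)
    also have "\<dots> \<le> 1 / 2"
      using exp_ge_add_one_self[of 1] by (simp add: exp_minus field_simps)
    finally show "(1 - 1 / real q) ^ q \<le> 1 / 2" .
    show "0 \<le> (1 - 1 / real q) ^ q" using pos by simp
  qed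
  finally have "(1 - 1 / real q) ^ T * card X \<le> (1/2) ^ (m + 1) * 2 ^ m"
    using X by (intro mult_mono) (auto simp flip: of_nat_le_iff)
  also have "\<dots> < 1" by (simp add: power_divide)
  finally have "card {x \<in> X. \<forall>i<T. \<not> good x (h i)} = 0" using le by simp
  then have "{x \<in> X. \<forall>i<T. \<not> good x (h i)} = {}" using fin by simp
  then show ?thesis using h unfolding T_def by blast
qed

lemma card_PiE_prescribed:
  assumes "finite U" "T \<subseteq> U" "\<And>k. k \<in> T \<Longrightarrow> \<phi> k \<in> A"
  shows "card {h \<in> U \<rightarrow>\<^sub>E A. \<forall>k\<in>T. h k = \<phi> k} = card A ^ (card U - card T)"
proof -
  have "{h \<in> U \<rightarrow>\<^sub>E A. \<forall>k\<in>T. h k = \<phi> k} = (\<Pi>\<^sub>E k\<in>U. if k \<in> T then {\<phi> k} else A)"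
    using assms(2,3) by (fastforce simp: PiE_iff split: if_splits)
  also have "card \<dots> = (\<Prod>k\<in>U. card (if k \<in> T then {\<phi> k} else A))"
    using assms(1) by (rule card_PiE)
  also have "\<dots> = (\<Prod>k\<in>U - T. card A)"
    using assms by (intro prod.mono_neutral_cong_right) auto
  also have "\<dots> = card A ^ (card U - card T)"
    using assms by (simp add: card_Diff_subset finite_subset)
  finally show ?thesis .
qed

text \<open>Union bound over the L-subsets T of K and the buckets: a random function sends all of T
  to a given bucket with probability N^-L, and (card K choose L) <= (N s)^L / L!.\<close>

lemma card_overloaded_hash:
  fixes N s L :: nat
  assumes U: "finite U" and K: "K \<subseteq> U" "card K \<le> N * s" and N: "N \<ge> 1"
    and L: "2 * N * s ^ L \<le> fact L"
  shows "2 * card {h \<in> U \<rightarrow>\<^sub>E {..<N}. \<exists>\<beta><N. L \<le> card {k \<in> K. h k = \<beta>}} \<le> N ^ card U"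
proof -
  let ?bad = "{h \<in> U \<rightarrow>\<^sub>E {..<N}. \<exists>\<beta><N. L \<le> card {k \<in> K. h k = \<beta>}}"
  let ?I = "{T. T \<subseteq> K \<and> card T = L} \<times> {..<N}"
  let ?A = "\<lambda>(T, \<beta>). {h \<in> U \<rightarrow>\<^sub>E {..<N}. \<forall>k\<in>T. h k = \<beta>}"
  have finK: "finite K" using U K finite_subset by blast
  have finI: "finite ?I" using finK by simp
  have finP: "finite (U \<rightarrow>\<^sub>E {..<N})" using U by (simp add: finite_PiE)
  have "?bad \<subseteq> (\<Union>i\<in>?I. ?A i)"
  proof
    fix h assume "h \<in> ?bad"
    then obtain \<beta> where h: "h \<in> U \<rightarrow>\<^sub>E {..<N}" and \<beta>: "\<beta> < N" "L \<le> card {k \<in> K. h k = \<beta>}" by blast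
    obtain T where T: "T \<subseteq> {k \<in> K. h k = \<beta>}" "card T = L"
      using obtain_subset_with_card_n[OF \<beta>(2)] by blast
    show "h \<in> (\<Union>i\<in>?I. ?A i)"
      by (rule UN_I[of "(T, \<beta>)"]) (use h \<beta> T in auto)
  qed
  then have "card ?bad \<le> card (\<Union>i\<in>?I. ?A i)"
    using finI finP by (intro card_mono) auto
  also have "\<dots> \<le> (\<Sum>i\<in>?I. card (?A i))" by (rule card_UN_le[OF finI])
  also have "\<dots> = (\<Sum>i\<in>?I. N ^ (card U - L))"
  proof (rule sum.cong[OF refl])
    fix i assume "i \<in> ?I"
    then obtain T \<beta> where "i = (T, \<beta>)" "T \<subseteq> K" "card T = L" "\<beta> < N" by auto
    then show "card (?A i) = N ^ (card U - L)"
      using card_PiE_prescribed[of U T "\<lambda>_. \<beta>" "{..<N}"] U K by auto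
  qed
  also have "\<dots> = (card K choose L) * N * N ^ (card U - L)"
    using n_subsets[OF finK, of L] by (simp add: card_cartesian_product)
  finally have le: "card ?bad \<le> (card K choose L) * N * N ^ (card U - L)" .
  show ?thesis
  proof (cases "L \<le> card K")
    case False
    then show ?thesis using le by (simp add: binomial_eq_0)
  next
    case True
    then have LU: "L \<le> card U" using K U card_mono le_trans by blast
    have "2 * card ?bad * fact L \<le> 2 * ((card K choose L) * N * N ^ (card U - L)) * fact L"
      using le by simp
    also have "\<dots> = 2 * N * N ^ (card U - L) * ((card K choose L) * fact L)" by (simp add: ac_simps)
    also have "\<dots> \<le> 2 * N * N ^ (card U - L) * (N * s) ^ L"
    proof -
      have "(card K choose L) * fact L \<le> card K ^ L" by (rule binomial_fact_pow)
      also have "\<dots> \<le> (N * s) ^ L" using K by (simp add: power_mono)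
      finally show ?thesis by simp
    qed
    also have "\<dots> = (2 * N * s ^ L) * (N ^ (card U - L) * N ^ L)"
      by (simp add: power_mult_distrib ac_simps)
    also have "N ^ (card U - L) * N ^ L = N ^ card U" using LU by (simp flip: power_add)
    also have "(2 * N * s ^ L) * N ^ card U \<le> fact L * N ^ card U" using L by simp
    finally show ?thesis by (simp add: mult.commute)
  qed
qed

text \<open>Covering with the sets K as points, of which there are at most 2^(card U). By
  \<open>card_overloaded_hash\<close> at least half of all functions are good for K, hence q =
  2.\<close>

lemma balanced_hash_family:
  fixes N s L :: nat
  assumes U: "finite U" and N: "N \<ge> 1" and L: "2 * N * s ^ L \<le> fact L"
  shows "\<exists>H :: nat \<Rightarrow> 'a \<Rightarrow> nat. \<forall>K\<subseteq>U. card K \<le> N * s \<longrightarrow>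
    (\<exists>i<2 * (card U + 1). (\<forall>k\<in>U. H i k < N) \<and> (\<forall>\<beta>. card {k \<in> K. H i k = \<beta>} < L))"
proof -
  let ?Y = "U \<rightarrow>\<^sub>E {..<N}"
  let ?X = "{K. K \<subseteq> U \<and> card K \<le> N * s}"
  let ?good = "\<lambda>K h. \<forall>\<beta><N. card {k \<in> K. h k = \<beta>} < L"
  have finY: "finite ?Y" using U by (simp add: finite_PiE)
  have Lpos: "0 < L"
    by (rule ccontr) (use L N in auto)
  have "\<exists>h. \<forall>x\<in>?X. \<exists>i<2 * (card U + 1). h i \<in> ?Y \<and> ?good x (h i)"
  proof (rule covering_sequence)
    show "finite ?X" using U by simp
    show "?Y \<noteq> {}" using N by (auto simp: PiE_eq_empty_iff lessThan_empty_iff)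
    show "card ?X \<le> 2 ^ card U"
      using card_mono[of "Pow U" ?X] U by (auto simp: card_Pow)
    fix K assume "K \<in> ?X"
    then have "2 * card {h \<in> ?Y. \<exists>\<beta><N. L \<le> card {k \<in> K. h k = \<beta>}} \<le> card ?Y"
      using card_overloaded_hash[OF U _ _ N L] U by (simp add: card_PiE)
    moreover have "{h \<in> ?Y. ?good K h} = ?Y - {h \<in> ?Y. \<exists>\<beta><N. L \<le> card {k \<in> K. h k = \<beta>}}"
      by (auto simp: not_le)
    ultimately show "card ?Y \<le> 2 * card {h \<in> ?Y. ?good K h}"
      using finY by (simp add: card_Diff_subset)
  qed (use finY in auto)
  then obtain h where h: "\<forall>x\<in>?X. \<exists>i<2 * (card U + 1). h i \<in> ?Y \<and> ?good x (h i)" by blast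
  show ?thesis
  proof (rule exI[of _ h], intro allI impI)
    fix K assume K: "K \<subseteq> U" "card K \<le> N * s"
    then obtain i where i: "i < 2 * (card U + 1)" "h i \<in> ?Y" "?good K (h i)" using h by blast
    have "card {k \<in> K. h i k = \<beta>} < L" for \<beta>
    proof (cases "\<beta> < N")
      case False
      then have "{k \<in> K. h i k = \<beta>} = {}" using i(2) K(1) by auto
      then show ?thesis using Lpos by (metis card.empty)
    qed (use i in auto)
    then show "\<exists>i<2 * (card U + 1). (\<forall>k\<in>U. h i k < N) \<and> (\<forall>\<beta>. card {k \<in> K. h i k = \<beta>} < L)"
      using i(1,2) by auto
  qed
qed

text \<open>A random function agrees with \<phi> on K with probability at least V^-L, hence q = V^L.
  The points are the pairs (K, \<phi>); their number enters the range of the seeds only through its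
  logarithm.\<close>

lemma small_retrieval_family:
  fixes V L :: nat
  assumes U: "finite U" and V: "V \<ge> 1"
  shows "\<exists>H :: nat \<Rightarrow> 'a \<Rightarrow> nat. \<forall>K\<subseteq>U. \<forall>\<phi>. card K \<le> L \<longrightarrow> (\<forall>k\<in>K. \<phi> k < V) \<longrightarrow>
    (\<exists>i<V ^ L * ((V + 1) * card U + 1). \<forall>k\<in>K. H i k = \<phi> k)"
proof -
  let ?Y = "U \<rightarrow>\<^sub>E {..<V}"
  let ?X = "{K. K \<subseteq> U \<and> card K \<le> L} \<times> ?Y"
  let ?good = "\<lambda>(K, \<phi>) h. \<forall>k\<in>K. h k = \<phi> k"
  have finY: "finite ?Y" using U by (simp add: finite_PiE)
  have "\<exists>h. \<forall>x\<in>?X. \<exists>i<V ^ L * ((V + 1) * card U + 1). h i \<in> ?Y \<and> ?good x (h i)"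
  proof (rule covering_sequence)
    show "finite ?X" using U finY by simp
    show "?Y \<noteq> {}" using V by (auto simp: PiE_eq_empty_iff lessThan_empty_iff)
    have "card ?X \<le> card (Pow U \<times> ?Y)" using U finY by (intro card_mono) auto
    also have "\<dots> = 2 ^ card U * V ^ card U" using U by (simp add: card_Pow card_cartesian_product card_PiE)
    also have "\<dots> \<le> 2 ^ card U * (2 ^ V) ^ card U"
      by (intro mult_left_mono power_mono) (auto simp: less_imp_le)
    also have "\<dots> = 2 ^ ((V + 1) * card U)" by (simp flip: power_mult add: power_add)
    finally show "card ?X \<le> 2 ^ ((V + 1) * card U)" .
    fix x assume "x \<in> ?X"
    then obtain K \<phi> where x: "x = (K, \<phi>)" "K \<subseteq> U" "card K \<le> L" "\<phi> \<in> ?Y" by auto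
    have "card {y \<in> ?Y. ?good x y} = V ^ (card U - card K)"
      using card_PiE_prescribed[of U K \<phi> "{..<V}"] U x by auto
    then have "V ^ L * card {y \<in> ?Y. ?good x y} = V ^ (L + (card U - card K))" by (simp add: power_add)
    moreover have "V ^ card U \<le> V ^ (L + (card U - card K))"
      using V x by (intro power_increasing) auto
    ultimately show "card ?Y \<le> V ^ L * card {y \<in> ?Y. ?good x y}" using U by (simp add: card_PiE)
  qed (use finY V in auto)
  then obtain h where h: "\<forall>x\<in>?X. \<exists>i<V ^ L * ((V + 1) * card U + 1). h i \<in> ?Y \<and> ?good x (h i)" by blast
  show ?thesis
  proof (rule exI[of _ h], intro allI impI)
    fix K \<phi> assume K: "K \<subseteq> U" "card K \<le> L" "\<forall>k\<in>K. \<phi> k < V"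
    \<comment> \<open>Extension by 0 outside K turns \<phi> into one of finitely many
      points.\<close>
    define \<phi>' where "\<phi>' = restrict (\<lambda>k. if k \<in> K then \<phi> k else 0) U"
    have "(K, \<phi>') \<in> ?X" using K V by (auto simp: \<phi>'_def)
    then obtain i where "i < V ^ L * ((V + 1) * card U + 1)" "\<forall>k\<in>K. h i k = \<phi>' k"
      using bspec[OF h, of "(K, \<phi>')"] by auto
    then show "\<exists>i<V ^ L * ((V + 1) * card U + 1). \<forall>k\<in>K. h i k = \<phi> k"
      using K by (intro exI[of _ i]) (auto simp: \<phi>'_def)
  qed
qed

text \<open>For positive w this is the logarithm of w to base 4, rounded down, so that
  \<open>2 ^ lev w\<close> is of order sqrt w.\<close>

definition lev :: "nat \<Rightarrow> nat" where
  "lev w = (GREATEST u. 4 ^ u \<le> w)"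

lemma lev_bounds:
  assumes "w \<ge> 1"
  shows "4 ^ lev w \<le> w" "w < 4 ^ Suc (lev w)"
proof -
  have bound: "u \<le> w" if "4 ^ u \<le> w" for u :: nat
    using that less_exp[of u] power_mono[of "2::nat" 4 u] by linarith
  show "4 ^ lev w \<le> w" unfolding lev_def
    by (rule GreatestI_nat[of "\<lambda>u. 4 ^ u \<le> w" 0 w]) (use assms in simp, rule bound)
  show "w < 4 ^ Suc (lev w)"
  proof (rule ccontr)
    assume "\<not> ?thesis"
    then have "4 ^ Suc (lev w) \<le> w" by simp
    then have "Suc (lev w) \<le> lev w" unfolding lev_def using bound by (rule Greatest_le_nat)
    then show False by simp
  qed
qed

text \<open>The weak Stirling bound n! >= (n/3)^n; the induction step rests on (1 + 1/n)^n <= e <=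
  3.\<close>

lemma power_self_le_fact: "real n ^ n \<le> 3 ^ n * fact n"
proof (induction n)
  case (Suc n)
  show ?case
  proof (cases "n = 0")
    case False
    then have "(1 + 1 / real n) ^ n \<le> exp (1 / real n) ^ n"
      by (intro power_mono exp_ge_add_one_self) auto
    also have "\<dots> = exp 1" using False by (simp flip: exp_of_nat_mult)
    also have "\<dots> \<le> 3" by (rule exp_le)
    finally have le3: "(1 + 1 / real n) ^ n \<le> 3" .
    have "real (Suc n) = (1 + 1 / real n) * n" using False by (simp add: field_simps)
    then have "real (Suc n) ^ Suc n = real (Suc n) * ((1 + 1 / real n) ^ n * real n ^ n)"
      by (simp add: power_mult_distrib)
    also have "\<dots> \<le> real (Suc n) * (3 * (3 ^ n * fact n))"
      using le3 Suc by (intro mult_left_mono mult_mono) auto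
    finally show ?thesis by simp
  qed simp
qed simp

text \<open>
  The load \<open>maxload w = \<Theta>(w / log w)\<close> is exceeded by some bucket of a random hash function with
  probability at most \<open>1 / 2\<close>, and \<open>maxload w\<close> values below \<open>nval w\<close> still take only \<open>O(w)\<close> bits.
\<close>

definition quarter :: "nat \<Rightarrow> nat" where
  "quarter w = (4 ^ lev w + lev w) div (lev w + 1)"

definition maxload :: "nat \<Rightarrow> nat" where
  "maxload w = 117 * quarter w"

definition nval :: "nat \<Rightarrow> nat" where
  "nval w = 2 ^ (8 * (lev w + 1))"

lemma Suc_le_four_power: "u + 1 \<le> (4::nat) ^ u"
  by (induction u) auto

text \<open>\<open>quarter w\<close> is 4^u / (u + 1) rounded up, where u = \<open>lev w\<close>,
  hence of order w / log w. Rounding at most doubles it because u + 1 <= 4^u.\<close>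

lemma quarter_bounds:
  "4 ^ lev w \<le> quarter w * (lev w + 1)" "quarter w * (lev w + 1) \<le> 2 * 4 ^ lev w"
proof -
  let ?u = "lev w"
  let ?m = "4 ^ ?u + ?u"
  have "?m = quarter w * (?u + 1) + ?m mod (?u + 1)" by (simp only: quarter_def div_mult_mod_eq)
  moreover have "?m mod (?u + 1) < ?u + 1" by simp
  ultimately show "4 ^ ?u \<le> quarter w * (?u + 1)" by linarith
  show "quarter w * (?u + 1) \<le> 2 * 4 ^ ?u"
    using Suc_le_four_power[of ?u] div_mult_mod_eq[of ?m "?u + 1"] unfolding quarter_def by linarith
qed

lemma square_Suc_le: "(u + 1)\<^sup>2 \<le> 4 * (2::nat) ^ u"
proof (induction u)
  case (Suc u)
  show ?case
  proof (cases "u \<le> 2")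
    case True
    then have "u = 0 \<or> u = 1 \<or> u = 2" by auto
    then show ?thesis by (auto simp: power2_eq_square)
  next
    case False
    then have "3 * u \<le> u * u" by simp
    moreover from this have "2 \<le> u * u" using False by linarith
    ultimately have "(Suc u + 1)\<^sup>2 \<le> 2 * (u + 1)\<^sup>2"
      using False by (simp add: power2_eq_square)
    with Suc show ?thesis by simp
  qed
qed simp

text \<open>For the mean load s = 13 * 2^u and L = \<open>maxload w\<close> it suffices, by L! >=
  (L/3)^L, that X = L / (3 s) satisfies X^L >= 2 N. As 117 = 9 * 13, X is 3 *
  \<open>quarter w\<close> / 2^u. Its square is at least 2^(u+1), so that 8 *
  \<open>quarter w\<close> factors X already reach 2^(w+1).\<close>

lemma maxload_fact:
  fixes N :: nat
  assumes w: "w \<ge> 1" and N: "N \<le> 2 ^ w"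
  shows "2 * N * (13 * 2 ^ lev w) ^ maxload w \<le> fact (maxload w)"
proof -
  let ?u = "lev w" and ?L = "maxload w" and ?D = "quarter w"
  let ?X = "3 * real ?D / 2 ^ ?u"
  have D: "(4::real) ^ ?u \<le> real ?D * (?u + 1)"
    using quarter_bounds(1)[of w, folded of_nat_le_iff[where ?'a=real]] by (simp add: algebra_simps)
  have Dpos: "?D > 0" by (rule ccontr) (use quarter_bounds(1)[of w] in simp)
  have sq: "2 ^ (?u + 1) \<le> ?X\<^sup>2"
  proof -
    have "(real (?u + 1))\<^sup>2 \<le> 4 * 2 ^ ?u"
      using square_Suc_le[of ?u, folded of_nat_le_iff[where ?'a=real]] by simp
    then have "2 ^ (?u + 1) * (real (?u + 1))\<^sup>2 \<le> 2 ^ (?u + 1) * (4 * 2 ^ ?u)"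
      by (intro mult_left_mono) auto
    also have "\<dots> = 8 * 4 ^ ?u" by (simp flip: power_mult_distrib)
    also have "\<dots> \<le> 9 * 4 ^ ?u" by simp
    also have "\<dots> = (3 * 4 ^ ?u / 2 ^ ?u)\<^sup>2"
    proof -
      define p where "p = (2::real) ^ ?u"
      have "p > 0" "(4::real) ^ ?u = p * p" by (simp_all add: p_def flip: power_mult_distrib)
      then show ?thesis unfolding p_def[symmetric] by (simp add: power2_eq_square)
    qed
    also have "\<dots> \<le> (?X * real (?u + 1))\<^sup>2"
      using D by (intro power_mono) (auto simp: field_simps)
    also have "\<dots> = ?X\<^sup>2 * (real (?u + 1))\<^sup>2" by (rule power_mult_distrib)
    finally show ?thesis by (simp add: mult_le_cancel_right)
  qed
  have "1 \<le> (2::real) ^ (?u + 1)" by (rule one_le_power) simp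
  then have "1\<^sup>2 \<le> ?X\<^sup>2" using sq by simp
  then have X1: "1 \<le> ?X" by (rule power2_le_imp_le) simp
  have w1: "w + 1 \<le> 4 * 4 ^ ?u" using lev_bounds[OF w] by simp
  have "w + 1 \<le> (?u + 1) * (4 * ?D)"
    using w1 quarter_bounds(1)[of w] by (simp add: algebra_simps)
  then have "(2::real) ^ (w + 1) \<le> 2 ^ ((?u + 1) * (4 * ?D))" by (intro power_increasing) auto
  also have "\<dots> = (2 ^ (?u + 1)) ^ (4 * ?D)" by (simp only: power_mult)
  also have "\<dots> \<le> (?X\<^sup>2) ^ (4 * ?D)" using sq by (intro power_mono) auto
  also have "\<dots> = ?X ^ (8 * ?D)" by (simp flip: power_mult)
  also have "\<dots> \<le> ?X ^ ?L" using X1 by (intro power_increasing) (auto simp: maxload_def)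
  finally have X: "2 ^ (w + 1) \<le> ?X ^ ?L" .
  have "2 * real N * (13 * 2 ^ ?u) ^ ?L \<le> 2 ^ (w + 1) * (13 * 2 ^ ?u) ^ ?L"
    using N by (intro mult_right_mono) (auto simp flip: of_nat_le_iff)
  also have "\<dots> \<le> ?X ^ ?L * (13 * 2 ^ ?u) ^ ?L" using X by (intro mult_right_mono) auto
  also have "\<dots> = (?X * (13 * 2 ^ ?u)) ^ ?L" by (simp only: power_mult_distrib)
  also have "?X * (13 * 2 ^ ?u) = real ?L / 3" by (simp add: maxload_def)
  also have "(real ?L / 3) ^ ?L \<le> fact ?L"
    using power_self_le_fact[of ?L] by (simp add: power_divide field_simps)
  finally have "real (2 * N * (13 * 2 ^ ?u) ^ ?L) \<le> real (fact ?L)" by simp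
  then show ?thesis by (simp only: of_nat_le_iff)
qed

text \<open>The two kinds of retrieved values: heights up to w, and positions within a
  bucket.\<close>

lemma nval_gt: assumes "w \<ge> 1" shows "w < nval w" "maxload w < nval w"
proof -
  let ?u = "lev w"
  have "(4::nat) ^ ?u = 2 ^ (2 * ?u)" by (simp add: power_mult)
  then have "(4 ^ ?u) ^ 4 = (2::nat) ^ (8 * ?u)" by (simp flip: power_mult)
  then have nv: "nval w = 256 * (4 ^ ?u) ^ 4" by (simp add: nval_def power_add)
  have "(4::nat) ^ ?u \<le> (4 ^ ?u) ^ 4" by (rule self_le_power) auto
  then show "w < nval w" using lev_bounds[OF assms] nv by simp
  have "quarter w \<le> quarter w * (lev w + 1)" by simp
  also have "\<dots> \<le> 2 * 4 ^ ?u" by (rule quarter_bounds)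
  finally show "maxload w < nval w"
    using \<open>(4::nat) ^ ?u \<le> (4 ^ ?u) ^ 4\<close> nv unfolding maxload_def
    using zero_less_power[of "4::nat" ?u] by linarith
qed

text \<open>
  The pair \<open>(h, y)\<close> stands for the node at height \<open>h\<close> of the binary trie whose keys \<open>x\<close> are
  those with \<open>x div 2 ^ h = y\<close>.
\<close>

definition nodes :: "nat \<Rightarrow> (nat \<times> nat) set" where
  "nodes w = {..w} \<times> {..<2 ^ w}"

lemma finite_nodes: "finite (nodes w)" by (simp add: nodes_def)

lemma card_nodes: assumes "w \<ge> 1" shows "card (nodes w) \<le> 2 ^ (2 * w)"
proof -
  have "w + 1 \<le> 2 ^ w" by (metis Suc_eq_plus1 Suc_leI less_exp)
  then have "(w + 1) * 2 ^ w \<le> 2 ^ w * 2 ^ w" by (rule mult_right_mono) simp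
  then show ?thesis by (simp add: nodes_def card_cartesian_product power_mult power2_eq_square mult_2 power_add)
qed

text \<open>A fixed choice that depends on w and N only, so the program can contain the whole
  family. The mean load is dictated by the sizes of the key sets \<open>K0\<close> and
  \<open>K1\<close>.\<close>

definition hsh :: "nat \<Rightarrow> nat \<Rightarrow> nat \<Rightarrow> nat \<times> nat \<Rightarrow> nat" where
  "hsh w N = (SOME H. \<forall>K\<subseteq>nodes w. card K \<le> N * (13 * 2 ^ lev w) \<longrightarrow>
    (\<exists>i<2 * (card (nodes w) + 1). (\<forall>k\<in>nodes w. H i k < N) \<and> (\<forall>\<beta>. card {k \<in> K. H i k = \<beta>} < maxload w)))"

definition rtv :: "nat \<Rightarrow> nat \<Rightarrow> nat \<times> nat \<Rightarrow> nat" where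
  "rtv w = (SOME H. \<forall>K\<subseteq>nodes w. \<forall>\<phi>. card K \<le> maxload w \<longrightarrow> (\<forall>k\<in>K. \<phi> k < nval w) \<longrightarrow>
    (\<exists>i<nval w ^ maxload w * ((nval w + 1) * card (nodes w) + 1). \<forall>k\<in>K. H i k = \<phi> k))"

lemma hsh:
  assumes w: "w \<ge> 1" and N: "1 \<le> N" "N \<le> 2 ^ w" and K: "K \<subseteq> nodes w" "card K \<le> N * (13 * 2 ^ lev w)"
  shows "\<exists>i<2 ^ (2000 * w). (\<forall>k\<in>nodes w. hsh w N i k < N) \<and> (\<forall>\<beta>. card {k \<in> K. hsh w N i k = \<beta>} < maxload w)"
proof -
  have "\<forall>K\<subseteq>nodes w. card K \<le> N * (13 * 2 ^ lev w) \<longrightarrow>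
    (\<exists>i<2 * (card (nodes w) + 1). (\<forall>k\<in>nodes w. hsh w N i k < N) \<and> (\<forall>\<beta>. card {k \<in> K. hsh w N i k = \<beta>} < maxload w))"
    unfolding hsh_def
    by (rule someI_ex[OF balanced_hash_family[OF finite_nodes N(1) maxload_fact[OF w N(2)]]])
  then obtain i where i: "i < 2 * (card (nodes w) + 1)"
    "(\<forall>k\<in>nodes w. hsh w N i k < N) \<and> (\<forall>\<beta>. card {k \<in> K. hsh w N i k = \<beta>} < maxload w)"
    using K by blast
  define X where "X = (2::nat) ^ (2 * w)"
  have "X \<ge> 1" "card (nodes w) \<le> X" using card_nodes[OF w] by (simp_all add: X_def)
  then have "2 * (card (nodes w) + 1) \<le> 4 * X" by presburger
  also have "\<dots> = 2 ^ (2 * w + 2)" by (simp add: power_add X_def)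
  also have "\<dots> \<le> 2 ^ (2000 * w)" using w by (intro power_increasing) auto
  finally show ?thesis using i by (meson order_less_le_trans)
qed

lemma rtv:
  assumes w: "w \<ge> 1" and K: "K \<subseteq> nodes w" "card K \<le> maxload w" "\<And>k. k \<in> K \<Longrightarrow> \<phi> k < nval w"
  shows "\<exists>i<2 ^ (2000 * w). \<forall>k\<in>K. rtv w i k = \<phi> k"
proof -
  let ?u = "lev w"
  have "\<forall>K\<subseteq>nodes w. \<forall>\<phi>. card K \<le> maxload w \<longrightarrow> (\<forall>k\<in>K. \<phi> k < nval w) \<longrightarrow>
    (\<exists>i<nval w ^ maxload w * ((nval w + 1) * card (nodes w) + 1). \<forall>k\<in>K. rtv w i k = \<phi> k)"
    unfolding rtv_def
    by (rule someI_ex[OF small_retrieval_family[OF finite_nodes]]) (simp add: nval_def)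
  then obtain i where i: "i < nval w ^ maxload w * ((nval w + 1) * card (nodes w) + 1)"
    "\<forall>k\<in>K. rtv w i k = \<phi> k" using K by blast
  have u: "?u + 1 \<le> w" using Suc_le_four_power[of ?u] lev_bounds(1)[OF w] by linarith
  \<comment> \<open>A seed costs O(log w) bits for each of O(w / log w) values: 936 = 8 * 117, and
    \<open>quarter w * (lev w + 1)\<close> is at most 2 w.\<close>
  have "nval w ^ maxload w = 2 ^ (936 * (quarter w * (?u + 1)))"
    by (simp add: nval_def maxload_def algebra_simps flip: power_mult)
  also have "\<dots> \<le> 2 ^ (1872 * w)"
    using quarter_bounds(2)[of w] lev_bounds(1)[OF w] by (intro power_increasing) linarith+
  finally have 1: "nval w ^ maxload w \<le> 2 ^ (1872 * w)" .
  have nv: "nval w \<le> 2 ^ (8 * w)" using u by (auto simp: nval_def intro!: power_increasing)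
  have ge1: "1 \<le> (2::nat) ^ (8 * w)" "1 \<le> (2::nat) ^ (10 * w)" by simp_all
  have "(nval w + 1) * card (nodes w) \<le> (2 * 2 ^ (8 * w)) * 2 ^ (2 * w)"
    using card_nodes[OF w] nv ge1 by (intro mult_mono) linarith+
  also have "\<dots> = 2 * 2 ^ (10 * w)" by (simp flip: power_add)
  finally have "(nval w + 1) * card (nodes w) + 1 \<le> 4 * 2 ^ (10 * w)" using ge1 by linarith
  also have "\<dots> = 2 ^ (10 * w + 2)" by (simp add: power_add)
  also have "\<dots> \<le> 2 ^ (12 * w)" using w by (intro power_increasing) auto
  finally have "nval w ^ maxload w * ((nval w + 1) * card (nodes w) + 1) \<le> 2 ^ (1872 * w) * 2 ^ (12 * w)"
    using 1 by (intro mult_mono) auto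
  also have "\<dots> = 2 ^ (1884 * w)" by (simp flip: power_add)
  also have "\<dots> \<le> 2 ^ (2000 * w)" by (intro power_increasing) auto
  finally show ?thesis using i by (meson order_less_le_trans)
qed

text \<open>Two levels: the seed i spreads K over N buckets of bounded load, and one seed per bucket
  encodes the values of all its keys. Since keys are not stored, nodes outside K yield arbitrary
  values.\<close>

lemma small_retrieval:
  assumes w: "w \<ge> 1" and N: "1 \<le> N" "N \<le> 2 ^ w" and K: "K \<subseteq> nodes w" "card K \<le> N * (13 * 2 ^ lev w)"
    and \<phi>: "\<And>k. k \<in> K \<Longrightarrow> \<phi> k < nval w"
  shows "\<exists>i tab. i < 2 ^ (2000 * w) \<and> (\<forall>\<beta>. tab \<beta> < 2 ^ (2000 * w)) \<and>
    (\<forall>k\<in>K. hsh w N i k < N \<and> rtv w (tab (hsh w N i k)) k = \<phi> k)"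
proof -
  obtain i where i: "i < 2 ^ (2000 * w)" "\<forall>k\<in>nodes w. hsh w N i k < N"
    "\<forall>\<beta>. card {k \<in> K. hsh w N i k = \<beta>} < maxload w" using hsh[OF w N K] by blast
  have "\<exists>t<2 ^ (2000 * w). \<forall>k\<in>{k \<in> K. hsh w N i k = \<beta>}. rtv w t k = \<phi> k" for \<beta>
    by (rule rtv[OF w]) (use K i \<phi> in \<open>auto simp: less_imp_le\<close>)
  then obtain tab where "\<And>\<beta>. tab \<beta> < 2 ^ (2000 * w)"
    "\<And>\<beta>. \<forall>k\<in>{k \<in> K. hsh w N i k = \<beta>}. rtv w (tab \<beta>) k = \<phi> k" by metis
  then show ?thesis using i K by (intro exI[of _ i] exI[of _ tab]) auto
qed

text \<open>Values of w bits are too long for \<open>rtv\<close>. Retrieved instead is the position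
  of a key within its bucket. Added to the number of keys in earlier buckets it becomes a minimal
  perfect hash, which indexes an array of the values.\<close>

lemma word_retrieval:
  fixes \<psi> :: "nat \<times> nat \<Rightarrow> nat"
  assumes w: "w \<ge> 1" and N: "1 \<le> N" "N \<le> 2 ^ w" and K: "K \<subseteq> nodes w" "card K \<le> N * (13 * 2 ^ lev w)"
  shows "\<exists>i tab off slot. i < 2 ^ (2000 * w) \<and> (\<forall>\<beta>. tab \<beta> < 2 ^ (2000 * w)) \<and> (\<forall>\<beta>. off \<beta> \<le> card K) \<and>
    (\<forall>j. slot j \<in> insert 0 (\<psi> ` K)) \<and>
    (\<forall>k\<in>K. hsh w N i k < N \<and> off (hsh w N i k) + rtv w (tab (hsh w N i k)) k < card K \<and>
       slot (off (hsh w N i k) + rtv w (tab (hsh w N i k)) k) = \<psi> k)"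
proof -
  have finK: "finite K" using K(1) finite_nodes finite_subset by blast
  obtain i where i: "i < 2 ^ (2000 * w)" "\<forall>k\<in>nodes w. hsh w N i k < N"
    "\<forall>\<beta>. card {k \<in> K. hsh w N i k = \<beta>} < maxload w" using hsh[OF w N K] by blast
  define bkt where "bkt \<beta> = {k \<in> K. hsh w N i k = \<beta>}" for \<beta>
  have finb: "finite (bkt \<beta>)" for \<beta> using finK by (simp add: bkt_def)
  have "\<exists>ix. bij_betw ix (bkt \<beta>) {0..<card (bkt \<beta>)}" for \<beta>
    by (rule ex_bij_betw_finite_nat[OF finb])
  then obtain ix where ix: "\<And>\<beta>. bij_betw (ix \<beta>) (bkt \<beta>) {0..<card (bkt \<beta>)}" by metis
  have ixlt: "ix \<beta> k < card (bkt \<beta>)" if "k \<in> bkt \<beta>" for \<beta> k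
    using ix[of \<beta>] that by (auto simp: bij_betw_def)
  have "\<exists>t<2 ^ (2000 * w). \<forall>k\<in>bkt \<beta>. rtv w t k = ix \<beta> k" for \<beta>
  proof (rule rtv[OF w])
    show "bkt \<beta> \<subseteq> nodes w" using K by (auto simp: bkt_def)
    show "card (bkt \<beta>) \<le> maxload w" using i by (simp add: bkt_def less_imp_le)
    show "ix \<beta> k < nval w" if "k \<in> bkt \<beta>" for k
      using ixlt[OF that] i(3) nval_gt(2)[OF w] unfolding bkt_def by (meson order.strict_trans)
  qed
  then obtain tab where tab: "\<And>\<beta>. tab \<beta> < 2 ^ (2000 * w)" "\<And>\<beta>. \<forall>k\<in>bkt \<beta>. rtv w (tab \<beta>) k = ix \<beta> k" by metis
  define off where "off \<beta> = card {k \<in> K. hsh w N i k < \<beta>}" for \<beta>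
  have off_Suc: "off \<beta> + card (bkt \<beta>) = off (Suc \<beta>)" for \<beta>
    unfolding off_def bkt_def using finK
    by (subst card_Un_disjoint[symmetric]) (auto intro!: arg_cong[of _ _ card])
  have off_mono: "off \<beta> \<le> off \<gamma>" if "\<beta> \<le> \<gamma>" for \<beta> \<gamma>
    unfolding off_def using finK that by (intro card_mono) auto
  have off_le: "off \<beta> \<le> card K" for \<beta>
    unfolding off_def using finK by (intro card_mono) auto
  define pos where "pos k = off (hsh w N i k) + ix (hsh w N i k) k" for k
  have pos_lt: "pos k < off (Suc (hsh w N i k))" if "k \<in> K" for k
    using ixlt[of k "hsh w N i k"] that off_Suc[of "hsh w N i k"] by (simp add: pos_def bkt_def)
  have "inj_on pos K"
  proof (rule inj_onI)
    fix k k' assume k: "k \<in> K" "k' \<in> K" "pos k = pos k'"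
    have False if "hsh w N i x < hsh w N i y" "x \<in> K" "y \<in> K" "pos x = pos y" for x y
      using pos_lt[OF that(2)] off_mono[of "Suc (hsh w N i x)" "hsh w N i y"] that by (simp add: pos_def)
    then have eq: "hsh w N i k = hsh w N i k'" using k by (metis linorder_neqE_nat)
    then have "ix (hsh w N i k) k = ix (hsh w N i k) k'" using k by (simp add: pos_def)
    then show "k = k'" 
      using inj_onD[OF bij_betw_imp_inj_on[OF ix[of "hsh w N i k"]], of k k'] k eq by (simp add: bkt_def)
  qed
  define slot where "slot j = (if j \<in> pos ` K then \<psi> (inv_into K pos j) else 0)" for j
  have rt: "off (hsh w N i k) + rtv w (tab (hsh w N i k)) k = pos k" if "k \<in> K" for k
    using bspec[OF tab(2)[of "hsh w N i k"], of k] that by (simp add: pos_def bkt_def)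
  show ?thesis
  proof (rule exI[of _ i], rule exI[of _ tab], rule exI[of _ off], rule exI[of _ slot], intro conjI allI ballI)
    show "slot j \<in> insert 0 (\<psi> ` K)" for j
    proof (cases "j \<in> pos ` K")
      case True
      then have "inv_into K pos j \<in> K" by (rule inv_into_into)
      then show ?thesis using True by (simp add: slot_def)
    qed (simp add: slot_def)
    fix k assume k: "k \<in> K"
    show "off (hsh w N i k) + rtv w (tab (hsh w N i k)) k < card K"
      using pos_lt[OF k] off_le rt[OF k] by (metis order_less_le_trans)
    show "slot (off (hsh w N i k) + rtv w (tab (hsh w N i k)) k) = \<psi> k"
      using k rt[OF k] \<open>inj_on pos K\<close> by (simp add: slot_def)
  qed (use i tab off_le K in auto)
qed

section \<open>Fusion nodes\<close>

text \<open>The height of the lowest common ancestor of two leaves of the binary trie, that is, the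
  bit length of x XOR y. It is an ultrametric.\<close>

definition hgt :: "nat \<Rightarrow> nat \<Rightarrow> nat" where
  "hgt x y = (LEAST h. x div 2 ^ h = y div 2 ^ h)"

lemma agree_mono:
  assumes "x div 2 ^ h = y div 2 ^ h" "h \<le> h'" shows "x div 2 ^ h' = y div (2::nat) ^ h'"
proof -
  obtain d where "h' = h + d" using assms(2) le_Suc_ex by blast
  then show ?thesis using assms(1) by (simp add: power_add div_mult2_eq)
qed

lemma hgt_agree: "x div 2 ^ hgt x y = y div 2 ^ hgt x y"
proof -
  have "x div 2 ^ (x + y) = y div 2 ^ (x + y)"
    using less_exp[of "x + y"] by (metis add_lessD1 add.commute div_less)
  then show ?thesis unfolding hgt_def by (rule LeastI)
qed

lemma hgt_le_iff: "hgt x y \<le> h \<longleftrightarrow> x div 2 ^ h = y div 2 ^ h"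
proof
  show "x div 2 ^ h = y div 2 ^ h" if "hgt x y \<le> h" using agree_mono[OF hgt_agree that] .
  show "hgt x y \<le> h" if "x div 2 ^ h = y div 2 ^ h" unfolding hgt_def using that by (rule Least_le)
qed

lemma hgt_commute: "hgt x y = hgt y x"
  unfolding hgt_def by (simp only: eq_commute)

lemma hgt_eq_0_iff: "hgt x y = 0 \<longleftrightarrow> x = y"
  using hgt_le_iff[of x y 0] by simp

lemma hgt_le_width: "x < 2 ^ w \<Longrightarrow> y < 2 ^ w \<Longrightarrow> hgt x y \<le> w"
  by (simp add: hgt_le_iff)

lemma hgt_ultra: "hgt x z \<le> max (hgt x y) (hgt y z)"
proof -
  let ?h = "max (hgt x y) (hgt y z)"
  have "x div 2 ^ ?h = y div 2 ^ ?h" "y div 2 ^ ?h = z div 2 ^ ?h" by (simp_all flip: hgt_le_iff)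
  then show ?thesis by (simp add: hgt_le_iff)
qed

text \<open>Leaves below a node form an interval. Hence the heights for neighbouring keys determine
  those for all pairs, which is why a sketch lists only neighbours.\<close>

lemma hgt_between: "x \<le> y \<Longrightarrow> y \<le> z \<Longrightarrow> hgt x z = max (hgt x y) (hgt y z)"
proof (rule antisym[OF hgt_ultra])
  assume xyz: "x \<le> y" "y \<le> z"
  let ?h = "hgt x z"
  have "x div 2 ^ ?h \<le> y div 2 ^ ?h" "y div 2 ^ ?h \<le> z div 2 ^ ?h" using xyz by (auto intro: div_le_mono)
  then show "max (hgt x y) (hgt y z) \<le> ?h" using hgt_agree[of x z] by (simp add: hgt_le_iff)
qed

lemma sibling_eq_Suc: "x div 2 = y div 2 \<Longrightarrow> x \<noteq> y \<Longrightarrow> x \<le> y \<Longrightarrow> y = Suc x \<and> even x" for x y :: nat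
  by presburger

text \<open>Just below the lowest common ancestor, the smaller key goes to the left (even) child and
  the larger one to its right sibling.\<close>

lemma hgt_branch:
  assumes "x < y"
  shows "y div 2 ^ (hgt x y - 1) = Suc (x div 2 ^ (hgt x y - 1))" "even (x div 2 ^ (hgt x y - 1))"
proof -
  have pos: "hgt x y > 0" using assms hgt_eq_0_iff[of x y] by simp
  let ?t = "hgt x y - 1"
  let ?X = "x div 2 ^ ?t" and ?Y = "y div 2 ^ ?t"
  have ne: "?X \<noteq> ?Y" using pos hgt_le_iff[of x y ?t] by linarith
  have le: "?X \<le> ?Y" using assms by (simp add: div_le_mono)
  have "hgt x y = Suc ?t" using pos by simp
  then have "?X div 2 = ?Y div 2" using hgt_agree[of x y]
    by (metis div_mult2_eq power_Suc2)
  from sibling_eq_Suc[OF this ne le] have "?Y = Suc ?X \<and> even ?X" .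
  then show "?Y = Suc ?X" "even ?X" by blast+
qed

text \<open>c is the leaf reached by a blind search in the compressed trie: wherever its path
  branches off from another key, the bit of q points away from that key. Keys are inserted from left
  to right; the old candidate survives unless the bit of q at its branching with the new key points
  right.\<close>

lemma blind_candidate_exists:
  assumes "m \<ge> 1" "\<And>i j. i < j \<Longrightarrow> j < m \<Longrightarrow> k i < (k j :: nat)"
  shows "\<exists>c<m::nat. \<forall>i<m. i \<noteq> c \<longrightarrow> (odd (q div 2 ^ (hgt (k i) (k c) - 1)) \<longleftrightarrow> i < c)"
  using assms
proof (induction m rule: nat_induct_at_least)
  case base
  then show ?case by (intro exI[of _ 0]) auto
next
  case (Suc m)
  then obtain c where c: "c < m"
    and IH: "\<And>i. i < m \<Longrightarrow> i \<noteq> c \<Longrightarrow> odd (q div 2 ^ (hgt (k i) (k c) - 1)) \<longleftrightarrow> i < c" by force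
  let ?H = "hgt (k c) (k m)"
  have km: "k i < k m" if "i < m" for i using that Suc.prems by simp
  show ?case
  proof (cases "odd (q div 2 ^ (?H - 1))")
    case False
    then show ?thesis using c IH hgt_commute
      by (intro exI[of _ c]) (auto simp: less_Suc_eq)
  next
    case True
    have "odd (q div 2 ^ (hgt (k i) (k m) - 1))" if i: "i < m" for i
    proof (cases "i = c")
      case False
      show ?thesis
      proof (cases "i < c")
        case True
        then have "hgt (k i) (k m) = max (hgt (k i) (k c)) ?H"
          by (intro hgt_between less_imp_le km[OF c] Suc.prems) (use c in auto)
        then show ?thesis using IH[OF i False] True \<open>odd (q div 2 ^ (?H - 1))\<close> by (metis max_def)
      next
        case f: False
        with False have ci: "c < i" by simp
        then have "?H = max (hgt (k c) (k i)) (hgt (k i) (k m))"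
          by (intro hgt_between less_imp_le km[OF i] Suc.prems) (use i in auto)
        \<comment> \<open>The bit of q below height \<open>hgt (k c) (k i)\<close> is 0 and the one
          below \<open>?H\<close> is 1, so the maximum is attained by the other height.\<close>
        moreover have "?H \<noteq> hgt (k c) (k i)"
          using IH[OF i False] ci True hgt_commute[of "k i" "k c"] by auto
        ultimately have "?H = hgt (k i) (k m)" by linarith
        then show ?thesis using True by simp
      qed
    next
      case eq: True
      show ?thesis unfolding eq by (rule True)
    qed
    then show ?thesis by (intro exI[of _ m]) (auto simp: less_Suc_eq)
  qed
qed

text \<open>
  \<open>ds\<close> lists the heights at which consecutive keys separate. \<open>cand\<close> is the result of the blind
  search for \<open>q\<close> in the compressed trie; comparing \<open>q\<close> with this one key determines its rank.
\<close>

definition hts :: "nat list \<Rightarrow> nat \<Rightarrow> nat \<Rightarrow> nat" where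
  "hts ds i j = Max (insert 0 ((!) ds ` {min i j..<max i j}))"

definition cand :: "nat list \<Rightarrow> nat \<Rightarrow> nat" where
  "cand ds q = (SOME c. c < Suc (length ds) \<and>
     (\<forall>i<Suc (length ds). i \<noteq> c \<longrightarrow> (odd (q div 2 ^ (hts ds i c - 1)) \<longleftrightarrow> i < c)))"

text \<open>x is the value of the candidate key. Keys that separate from x strictly below the height
  \<open>hgt q x\<close> lie on the same side of q as x; the side of all other keys is decided by
  their position relative to the candidate.\<close>

definition rank_from :: "nat list \<Rightarrow> nat \<Rightarrow> nat \<Rightarrow> nat" where
  "rank_from ds q x = card {i. i < Suc (length ds) \<and>
     (if x \<le> q then i \<le> cand ds q \<or> hts ds (cand ds q) i < hgt q x
      else i < cand ds q \<and> hgt q x \<le> hts ds (cand ds q) i)}"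

definition sketch :: "nat \<Rightarrow> (nat \<Rightarrow> nat) \<Rightarrow> nat list" where
  "sketch m k = map (\<lambda>i. hgt (k i) (k (Suc i))) [0..<m - 1]"

lemma sketch_bounds:
  assumes "\<And>i. i < m \<Longrightarrow> k i < 2 ^ w"
  shows "length (sketch m k) = m - 1" "set (sketch m k) \<subseteq> {..w}"
proof -
  show "set (sketch m k) \<subseteq> {..w}"
    unfolding sketch_def using assms hgt_le_width by auto
qed (simp add: sketch_def)

lemma hts_sketch:
  assumes k: "\<And>i j. i < j \<Longrightarrow> j < m \<Longrightarrow> k i < (k j :: nat)" and ij: "i < m" "j < m"
  shows "hts (sketch m k) i j = hgt (k i) (k j)"
proof -
  have *: "hts (sketch m k) i j = hgt (k i) (k j)" if "i \<le> j" "j < m" for i j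
    using that
  proof (induction j rule: dec_induct)
    case base
    have "hgt (k i) (k i) = 0" by (simp only: hgt_eq_0_iff)
    then show ?case by (simp add: hts_def)
  next
    case (step j)
    have "{i..<Suc j} = insert j {i..<j}" using step by auto
    then have "insert 0 ((!) (sketch m k) ` {i..<Suc j}) =
        insert (sketch m k ! j) (insert 0 ((!) (sketch m k) ` {i..<j}))" by auto
    then have "hts (sketch m k) i (Suc j) = max (sketch m k ! j) (hts (sketch m k) i j)"
      using step by (simp add: hts_def)
    also have "\<dots> = max (hts (sketch m k) i j) (sketch m k ! j)" by (rule max.commute)
    also have "\<dots> = max (hgt (k i) (k j)) (hgt (k j) (k (Suc j)))"
    proof -
      have "j < m - 1" using step by simp
      then show ?thesis using step by (simp add: sketch_def)
    qed
    also have "\<dots> = hgt (k i) (k (Suc j))"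
      by (rule hgt_between[symmetric]) (use step k[of i j] k[of j "Suc j"] in \<open>auto simp: le_less\<close>)
    finally show ?case .
  qed
  show ?thesis
  proof (cases "i \<le> j")
    case False
    then show ?thesis using *[of j i] ij unfolding hts_def by (metis hgt_commute max.commute min.commute nat_le_linear)
  qed (use * ij in simp)
qed

text \<open>A trie node has only two children, so two of the three keys share one of them.\<close>

lemma hgt_between_cases:
  assumes "x < y" "y < z" shows "hgt x y < hgt x z \<or> hgt y z < hgt x z"
proof -
  let ?t = "hgt x z - 1"
  have xz: "x < z" using assms by simp
  then have pos: "hgt x z > 0" using hgt_eq_0_iff[of x z] by simp
  have "x div 2 ^ ?t \<le> y div 2 ^ ?t" "y div 2 ^ ?t \<le> z div 2 ^ ?t" using assms by (auto intro: div_le_mono)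
  then have "x div 2 ^ ?t = y div 2 ^ ?t \<or> y div 2 ^ ?t = z div 2 ^ ?t" using hgt_branch(1)[OF xz] by linarith
  then have "hgt x y \<le> ?t \<or> hgt y z \<le> ?t" by (simp add: hgt_le_iff)
  then show ?thesis using pos by linarith
qed

lemma hgt_less_imp_less:
  assumes "x < q" "hgt x y < hgt x q" shows "y < q"
proof (rule ccontr)
  assume "\<not> y < q"
  then have "hgt x y = max (hgt x q) (hgt q y)" using hgt_between[of x q y] assms by simp
  then show False using assms by simp
qed

lemma hgt_less_imp_greater:
  assumes "q < x" "hgt x y < hgt q x" shows "q < y"
proof (rule ccontr)
  assume "\<not> q < y"
  then have "y \<le> q" by simp
  then have "hgt y x = max (hgt y q) (hgt q x)" using hgt_between[of y q x] assms by simp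
  then show False using assms hgt_commute[of x y] by simp
qed

lemma rank_from_sketch:
  assumes m: "m \<ge> 1" and k: "\<And>i j. i < j \<Longrightarrow> j < m \<Longrightarrow> k i < (k j :: nat)"
  shows "cand (sketch m k) q < m"
    and "rank_from (sketch m k) q (k (cand (sketch m k) q)) = card {i. i < m \<and> k i \<le> q}"
proof -
  let ?ds = "sketch m k"
  have len: "Suc (length ?ds) = m" using m by (simp add: sketch_def)
  define c where "c = cand ?ds q"
  have ex: "\<exists>c. c < Suc (length ?ds) \<and>
     (\<forall>i<Suc (length ?ds). i \<noteq> c \<longrightarrow> (odd (q div 2 ^ (hts ?ds i c - 1)) \<longleftrightarrow> i < c))"
  proof -
    obtain c where "c < m" "\<forall>i<m. i \<noteq> c \<longrightarrow> (odd (q div 2 ^ (hgt (k i) (k c) - 1)) \<longleftrightarrow> i < c)"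
      using blind_candidate_exists[of m k q, OF m k] by blast
    then show ?thesis unfolding len using hts_sketch[of m k, OF k] by metis
  qed
  have sel: "c < m \<and> (\<forall>i<m. i \<noteq> c \<longrightarrow> (odd (q div 2 ^ (hts ?ds i c - 1)) \<longleftrightarrow> i < c))"
    using someI_ex[OF ex] unfolding c_def cand_def len .
  then have c: "c < m" by blast
  have side: "odd (q div 2 ^ (hgt (k i) (k c) - 1)) \<longleftrightarrow> i < c" if "i < m" "i \<noteq> c" for i
    using sel that hts_sketch[of m k, OF k that(1) c] by metis
  show "cand ?ds q < m" using c by (simp add: c_def)
  \<comment> \<open>No key shares a longer prefix with q than the candidate does: such a key would
    separate from the candidate at a height where the bit of q points towards it, against the
    outcome of the blind search.\<close>
  have maxi: "hgt q (k c) \<le> hgt q (k i)" if i: "i < m" for i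
  proof (rule ccontr)
    assume "\<not> ?thesis"
    then have lt: "hgt q (k i) < hgt q (k c)" by simp
    then have ne: "i \<noteq> c" by auto
    let ?t = "hgt (k i) (k c) - 1"
    have "hgt q (k c) \<le> max (hgt q (k i)) (hgt (k i) (k c))" by (rule hgt_ultra)
    then have "hgt q (k i) \<le> ?t" using lt by linarith
    then have eq: "q div 2 ^ ?t = k i div 2 ^ ?t" by (simp add: hgt_le_iff)
    show False
    proof (cases "i < c")
      case True
      then show ?thesis using side[OF i ne] hgt_branch(2)[OF k[OF True c]] eq by simp
    next
      case False
      then have ci: "c < i" using ne by simp
      then show ?thesis
        using side[OF i ne] hgt_branch[OF k[OF ci i]] eq hgt_commute[of "k c" "k i"] by simp
    qed
  qed
  have hc: "hts ?ds c i = hgt (k c) (k i)" if "i < m" for i using hts_sketch[of m k, OF k c that] .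
  have kle: "k i \<le> k j" if "i \<le> j" "j < m" for i j using k[of i j] that by (auto simp: le_less)
  have "{i. i < Suc (length ?ds) \<and> (if k c \<le> q then i \<le> c \<or> hts ?ds c i < hgt q (k c)
      else i < c \<and> hgt q (k c) \<le> hts ?ds c i)} = {i. i < m \<and> k i \<le> q}"
  proof (cases "k c \<le> q")
    case True
    have "k i \<le> q \<longleftrightarrow> i \<le> c \<or> hgt (k c) (k i) < hgt q (k c)" if i: "i < m" for i
    proof (cases "i \<le> c")
      case True
      then show ?thesis using kle[OF _ c] \<open>k c \<le> q\<close> le_trans by blast
    next
      case False
      then have ci: "k c < k i" using k i by simp
      show ?thesis
      proof
        assume le: "k i \<le> q"
        have "hgt (k c) (k i) < hgt (k c) q"
        proof (cases "k i = q")
          case True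
          then show ?thesis using maxi[OF i] ci hgt_eq_0_iff[of q q] hgt_eq_0_iff[of q "k c"] by simp
        next
          case f: False
          then have "k i < q" using le by simp
          from hgt_between_cases[OF ci this] show ?thesis
            using maxi[OF i] hgt_commute[of q "k c"] hgt_commute[of q "k i"] by linarith
        qed
        then show "i \<le> c \<or> hgt (k c) (k i) < hgt q (k c)" by (simp add: hgt_commute)
      next
        assume "i \<le> c \<or> hgt (k c) (k i) < hgt q (k c)"
        then have lt: "hgt (k c) (k i) < hgt (k c) q" using False by (simp add: hgt_commute)
        then have "k c \<noteq> q" using hgt_eq_0_iff[of q q] by auto
        then show "k i \<le> q" using hgt_less_imp_less[OF _ lt] \<open>k c \<le> q\<close> by simp
      qed
    qed
    then show ?thesis using True hc by (auto simp: len)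
  next
    case False
    have "k i \<le> q \<longleftrightarrow> i < c \<and> hgt q (k c) \<le> hgt (k c) (k i)" if i: "i < m" for i
    proof (cases "i < c")
      case ic: False
      then show ?thesis using kle[of c i] i False by simp
    next
      case True
      then have ic: "k i < k c" using k c by simp
      show ?thesis
      proof
        assume "k i \<le> q"
        then have "\<not> hgt (k c) (k i) < hgt q (k c)"
          using hgt_less_imp_greater[of q "k c" "k i"] False by auto
        then show "i < c \<and> hgt q (k c) \<le> hgt (k c) (k i)" using True by simp
      next
        assume asm: "i < c \<and> hgt q (k c) \<le> hgt (k c) (k i)"
        show "k i \<le> q"
        proof (rule ccontr)
          assume "\<not> k i \<le> q"
          then have "q < k i" by simp
          from hgt_between_cases[OF this ic] show False
            using maxi[OF i] asm hgt_commute[of "k c" "k i"] by linarith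
        qed
      qed
    qed
    then show ?thesis using False hc by (auto simp: len)
  qed
  then show "rank_from ?ds q (k (cand ?ds q)) = card {i. i < m \<and> k i \<le> q}"
    unfolding rank_from_def c_def[symmetric] by simp
qed

section \<open>Coloured ranks\<close>

locale ranked =
  fixes N :: nat and e \<kappa> :: "nat \<Rightarrow> nat"
  assumes e_less: "i < j \<Longrightarrow> j < N \<Longrightarrow> e i < e j"
begin

lemma e_le: "i \<le> j \<Longrightarrow> j < N \<Longrightarrow> e i \<le> e j"
  using e_less[of i j] by (auto simp: le_less)

lemma e_less_iff: "i < N \<Longrightarrow> j < N \<Longrightarrow> e i < e j \<longleftrightarrow> i < j"
  using e_less[of i j] e_le[of j i] by (cases "i < j") auto

text \<open>Predecessor ranks and values are shifted by one, with \<open>0\<close> for the first element of a colour.\<close>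

definition pv :: "nat \<Rightarrow> nat" where
  "pv r = (if \<exists>s<r. \<kappa> s = \<kappa> r then Suc (Max {s. s < r \<and> \<kappa> s = \<kappa> r}) else 0)"

lemma pv_gt: assumes "s < r" "\<kappa> s = \<kappa> r" shows "s < pv r"
proof -
  have "s \<le> Max {s. s < r \<and> \<kappa> s = \<kappa> r}" by (rule Max_ge) (use assms in auto)
  then show ?thesis using assms by (auto simp: pv_def less_Suc_eq_le)
qed

lemma pv_pos: assumes "0 < pv r" shows "pv r - 1 < r" "\<kappa> (pv r - 1) = \<kappa> r"
proof -
  have ex: "\<exists>s<r. \<kappa> s = \<kappa> r" using assms by (auto simp: pv_def split: if_splits)
  have "Max {s. s < r \<and> \<kappa> s = \<kappa> r} \<in> {s. s < r \<and> \<kappa> s = \<kappa> r}" by (rule Max_in) (use ex in auto)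
  then show "pv r - 1 < r" "\<kappa> (pv r - 1) = \<kappa> r" using ex by (auto simp: pv_def)
qed

definition pf :: "nat \<Rightarrow> nat" where
  "pf r = (if pv r = 0 then 0 else Suc (e (pv r - 1)))"

lemma pf_le_iff: assumes "r < N" shows "pf r \<le> a \<longleftrightarrow> (\<forall>s<r. \<kappa> s = \<kappa> r \<longrightarrow> e s < a)"
proof
  assume le: "pf r \<le> a"
  show "\<forall>s<r. \<kappa> s = \<kappa> r \<longrightarrow> e s < a"
  proof (intro allI impI)
    fix s assume s: "s < r" "\<kappa> s = \<kappa> r"
    have lt: "s < pv r" by (rule pv_gt[OF s])
    then have "e s \<le> e (pv r - 1)" using pv_pos(1)[of r] assms by (intro e_le) auto
    then show "e s < a" using le lt by (simp add: pf_def split: if_splits)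
  qed
next
  assume all: "\<forall>s<r. \<kappa> s = \<kappa> r \<longrightarrow> e s < a"
  show "pf r \<le> a"
  proof (cases "pv r = 0")
    case False
    then have "e (pv r - 1) < a" using all pv_pos[of r] by simp
    then show ?thesis using False by (simp add: pf_def)
  qed (simp add: pf_def)
qed

definition inrange :: "nat \<Rightarrow> nat \<Rightarrow> nat set" where
  "inrange a b = {r. r < N \<and> a \<le> e r \<and> e r \<le> b}"

definition Rep :: "nat \<Rightarrow> nat \<Rightarrow> nat set" where
  "Rep a b = {r \<in> inrange a b. pf r \<le> a}"

lemma finite_inrange: "finite (inrange a b)" by (simp add: inrange_def)

lemma Rep_subset: "Rep a b \<subseteq> inrange a b" by (auto simp: Rep_def)

lemma inj_on_Rep: "inj_on \<kappa> (Rep a b)"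
proof (rule inj_onI, rule ccontr)
  fix x y assume x: "x \<in> Rep a b" and y: "y \<in> Rep a b" and eq: "\<kappa> x = \<kappa> y" and ne: "x \<noteq> y"
  have False if "s < r" "s \<in> Rep a b" "r \<in> Rep a b" "\<kappa> s = \<kappa> r" for s r
    using that pf_le_iff[of r a] by (auto simp: Rep_def inrange_def)
  then show False using x y eq ne by (metis linorder_neqE_nat)
qed

lemma Rep_image: "\<kappa> ` Rep a b = \<kappa> ` inrange a b"
proof (rule equalityI[OF image_mono[OF Rep_subset] subsetI])
  fix c assume "c \<in> \<kappa> ` inrange a b"
  then obtain r where r: "r \<in> inrange a b" "\<kappa> r = c" by blast
  define m where "m = (LEAST r. r \<in> inrange a b \<and> \<kappa> r = c)"
  have m: "m \<in> inrange a b \<and> \<kappa> m = c" unfolding m_def by (rule LeastI) (use r in blast)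
  have min: "m \<le> s" if "s \<in> inrange a b" "\<kappa> s = c" for s unfolding m_def by (rule Least_le) (use that in blast)
  have "e s < a" if s: "s < m" "\<kappa> s = \<kappa> m" for s
  proof (rule ccontr)
    assume "\<not> e s < a"
    then have "s \<in> inrange a b" using s m e_le[of s m] by (auto simp: inrange_def)
    then show False using min[of s] s m by simp
  qed
  then have "m \<in> Rep a b" using m pf_le_iff[of m a] by (auto simp: Rep_def inrange_def)
  then show "c \<in> \<kappa> ` Rep a b" using m by blast
qed

lemma card_Rep: "card (Rep a b) = card (\<kappa> ` inrange a b)"
  using card_image[OF inj_on_Rep, of a b] Rep_image by simp

definition LB :: "nat \<Rightarrow> nat set" where
  "LB \<beta> = {s. s < \<beta> \<and> (\<forall>s'. s < s' \<and> s' < \<beta> \<longrightarrow> \<kappa> s' \<noteq> \<kappa> s)}"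

text \<open>By the shift of \<open>pv\<close>, the condition says that the predecessor has a rank
  below \<beta>: these are the first occurrences from \<beta> on.\<close>

definition RB :: "nat \<Rightarrow> nat set" where
  "RB \<beta> = {s. \<beta> \<le> s \<and> s < N \<and> pv s \<le> \<beta>}"

lemma finite_LB: "finite (LB \<beta>)" by (simp add: LB_def)
lemma finite_RB: "finite (RB \<beta>)" by (simp add: RB_def)

lemma inj_on_LB: "inj_on \<kappa> (LB \<beta>)"
proof (rule inj_onI, rule ccontr)
  fix x y assume x: "x \<in> LB \<beta>" and y: "y \<in> LB \<beta>" and eq: "\<kappa> x = \<kappa> y" and ne: "x \<noteq> y"
  have False if "s < r" "s \<in> LB \<beta>" "r \<in> LB \<beta>" "\<kappa> s = \<kappa> r" for s r
    using that by (auto simp: LB_def)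
  then show False using x y eq ne by (metis linorder_neqE_nat)
qed

lemma inj_on_RB: "inj_on \<kappa> (RB \<beta>)"
proof (rule inj_onI, rule ccontr)
  fix x y assume x: "x \<in> RB \<beta>" and y: "y \<in> RB \<beta>" and eq: "\<kappa> x = \<kappa> y" and ne: "x \<noteq> y"
  have False if "s < r" "s \<in> RB \<beta>" "r \<in> RB \<beta>" "\<kappa> s = \<kappa> r" for s r
    using that pv_gt[of s r] by (auto simp: RB_def)
  then show False using x y eq ne by (metis linorder_neqE_nat)
qed

text \<open>These last occurrences have distinct colours and lie in the range, so the output pays
  for scanning them.\<close>

lemma card_LB_le: "\<beta> \<le> N \<Longrightarrow> (\<And>s. s < \<beta> \<Longrightarrow> e s \<le> b) \<Longrightarrow> card {s \<in> LB \<beta>. a \<le> e s} \<le> card (Rep a b)"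
proof -
  assume \<beta>: "\<beta> \<le> N" "\<And>s. s < \<beta> \<Longrightarrow> e s \<le> b"
  have "card {s \<in> LB \<beta>. a \<le> e s} = card (\<kappa> ` {s \<in> LB \<beta>. a \<le> e s})"
    by (rule card_image[symmetric], rule inj_on_subset[OF inj_on_LB]) auto
  also have "\<dots> \<le> card (\<kappa> ` inrange a b)"
    using \<beta> by (intro card_mono finite_imageI finite_inrange image_mono) (auto simp: LB_def inrange_def)
  finally show ?thesis by (simp add: card_Rep)
qed

lemma card_RB_le: "(\<And>s. \<beta> \<le> s \<Longrightarrow> s < N \<Longrightarrow> a \<le> e s) \<Longrightarrow> card {s \<in> RB \<beta>. e s \<le> b} \<le> card (Rep a b)"
proof -
  assume \<beta>: "\<And>s. \<beta> \<le> s \<Longrightarrow> s < N \<Longrightarrow> a \<le> e s"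
  have "card {s \<in> RB \<beta>. e s \<le> b} = card (\<kappa> ` {s \<in> RB \<beta>. e s \<le> b})"
    by (rule card_image[symmetric], rule inj_on_subset[OF inj_on_RB]) auto
  also have "\<dots> \<le> card (\<kappa> ` inrange a b)"
    using \<beta> by (intro card_mono finite_imageI finite_inrange image_mono) (auto simp: RB_def inrange_def)
  finally show ?thesis by (simp add: card_Rep)
qed

text \<open>What a query reports when no list overflows, with \<beta> the left end of the window. A
  colour that occurs in the range before \<beta> is represented by its last occurrence there; the
  filter of \<open>Rep\<close> then rejects all its later ones.\<close>

definition cover :: "nat \<Rightarrow> nat \<Rightarrow> nat \<Rightarrow> nat set" where
  "cover \<beta> a b = {s \<in> LB \<beta>. a \<le> e s} \<union> {r \<in> Rep a b. \<beta> \<le> r}"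

lemma inj_on_cover: "inj_on \<kappa> (cover \<beta> a b)"
proof -
  have cross: False if "s \<in> LB \<beta>" "a \<le> e s" "r \<in> Rep a b" "\<beta> \<le> r" "\<kappa> s = \<kappa> r" for s r
  proof -
    have "s < r" "r < N" "pf r \<le> a" using that by (auto simp: LB_def Rep_def inrange_def)
    then show False using pf_le_iff[of r a] that by auto
  qed
  show ?thesis unfolding cover_def
    unfolding inj_on_Un
  proof (intro conjI)
    show "inj_on \<kappa> {s \<in> LB \<beta>. a \<le> e s}" by (rule inj_on_subset[OF inj_on_LB]) auto
    show "inj_on \<kappa> {r \<in> Rep a b. \<beta> \<le> r}" by (rule inj_on_subset[OF inj_on_Rep]) auto
    show "\<kappa> ` ({s \<in> LB \<beta>. a \<le> e s} - {r \<in> Rep a b. \<beta> \<le> r}) \<inter> \<kappa> ` ({r \<in> Rep a b. \<beta> \<le> r} - {s \<in> LB \<beta>. a \<le> e s}) = {}"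
    proof (rule ccontr)
      assume "\<not> ?thesis"
      then obtain s r where "s \<in> LB \<beta>" "a \<le> e s" "r \<in> Rep a b" "\<beta> \<le> r" "\<kappa> s = \<kappa> r" by blast
      then show False by (rule cross)
    qed
  qed
qed

lemma cover_image:
  assumes "\<beta> \<le> N" "\<And>s. s < \<beta> \<Longrightarrow> e s \<le> b"
  shows "\<kappa> ` cover \<beta> a b = \<kappa> ` inrange a b"
proof
  show "\<kappa> ` cover \<beta> a b \<subseteq> \<kappa> ` inrange a b"
    using assms by (intro image_mono) (auto simp: cover_def LB_def Rep_def inrange_def)
  show "\<kappa> ` inrange a b \<subseteq> \<kappa> ` cover \<beta> a b"
  proof
    fix c assume "c \<in> \<kappa> ` inrange a b"
    then have "c \<in> \<kappa> ` Rep a b" by (simp add: Rep_image)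
    then obtain r where r: "r \<in> Rep a b" "\<kappa> r = c" by blast
    show "c \<in> \<kappa> ` cover \<beta> a b"
    proof (cases "\<beta> \<le> r")
      case True
      then show ?thesis using r by (auto simp: cover_def)
    next
      case False
      define s where "s = Max {s. s < \<beta> \<and> \<kappa> s = c}"
      have s: "s \<in> {s. s < \<beta> \<and> \<kappa> s = c}" unfolding s_def
      proof (rule Max_in)
        have "r \<in> {s. s < \<beta> \<and> \<kappa> s = c}" using r False by simp
        then show "{s. s < \<beta> \<and> \<kappa> s = c} \<noteq> {}" by blast
      qed simp
      have max: "s' \<le> s" if "s' < \<beta>" "\<kappa> s' = c" for s' unfolding s_def by (rule Max_ge) (use that in auto)
      have "s \<in> LB \<beta>" using s max by (fastforce simp: LB_def)
      moreover have "e r \<le> e s" using max[of r] r False s assms(1) by (intro e_le) auto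
      then have "a \<le> e s" using r by (auto simp: Rep_def inrange_def)
      ultimately show ?thesis using s by (auto simp: cover_def)
    qed
  qed
qed

end

lemma div_pow_div: "(h::nat) \<le> h' \<Longrightarrow> x div 2 ^ h div 2 ^ (h' - h) = x div (2::nat) ^ h'"
  by (simp add: div_mult2_eq[symmetric] power_add[symmetric])

section \<open>Locating a window\<close>

locale trie = ranked +
  fixes w g f :: nat
  assumes w1: "w \<ge> 1" and f: "f = 2 ^ lev w" and g: "g \<ge> f * f" and N1: "1 \<le> N"
    and e_w: "\<And>r. r < N \<Longrightarrow> e r < 2 ^ w"
begin

definition cnt :: "nat \<Rightarrow> nat \<Rightarrow> nat set" where
  "cnt h y = {r. r < N \<and> e r div 2 ^ h = y}"

lemma finite_cnt: "finite (cnt h y)" by (simp add: cnt_def)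

definition heavy :: "nat \<Rightarrow> nat \<Rightarrow> bool" where
  "heavy h y \<longleftrightarrow> g \<le> card (cnt h y)"

text \<open>\<open>TL h y\<close> is the height of the topmost light ancestor of the light node \<open>(h, y)\<close>.\<close>

definition TL :: "nat \<Rightarrow> nat \<Rightarrow> nat" where
  "TL h y = Max {h'. h \<le> h' \<and> h' \<le> w \<and> \<not> heavy h' (y div 2 ^ (h' - h))}"

text \<open>The keys whose value is a window: heavy nodes, and light nodes without a light
  parent.\<close>

definition K0 :: "(nat \<times> nat) set" where
  "K0 = {(h, y) \<in> nodes w. cnt h y \<noteq> {} \<and> (heavy h y \<or> h = w \<or> heavy (Suc h) (y div 2))}"

text \<open>The keys whose value is \<open>TL\<close>. Going up from a light node to the next height
  divisible by f either stays among light nodes or passes the topmost one within f levels. An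
  element has only O(w / f + f) ancestors of these two kinds.\<close>

definition K1 :: "(nat \<times> nat) set" where
  "K1 = {(h, y) \<in> nodes w. cnt h y \<noteq> {} \<and> \<not> heavy h y \<and> (h mod f = 0 \<or> TL h y < h + f)}"

definition window :: "nat \<Rightarrow> nat set" where
  "window c = {r. c * g \<le> r \<and> r < c * g + 2 * g \<and> r < N}"

lemma f_pos: "f \<ge> 1" by (simp add: f)

lemma ff: "f * f \<le> w" "w < 4 * (f * f)"
proof -
  have "f * f = 4 ^ lev w" unfolding f by (simp flip: power_mult_distrib)
  then show "f * f \<le> w" "w < 4 * (f * f)" using lev_bounds[OF w1] by simp_all
qed

lemma g_pos: "g \<ge> 1" using g f_pos by (metis le_trans mult_le_mono nat_mult_1)

lemma cnt_mono: "h \<le> h' \<Longrightarrow> cnt h y \<subseteq> cnt h' (y div 2 ^ (h' - h))"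
  by (auto simp: cnt_def div_pow_div)

lemma heavy_up: "h \<le> h' \<Longrightarrow> heavy h y \<Longrightarrow> heavy h' (y div 2 ^ (h' - h))"
  unfolding heavy_def using card_mono[OF finite_cnt cnt_mono] le_trans by blast

lemma node_cnt: "r \<in> cnt h y \<Longrightarrow> r < N \<and> y = e r div 2 ^ h"
  by (auto simp: cnt_def)

lemma node_in: "r < N \<Longrightarrow> h \<le> w \<Longrightarrow> (h, e r div 2 ^ h) \<in> nodes w"
  using e_w[of r] by (simp add: nodes_def) (meson div_le_dividend order_le_less_trans)

lemma TL:
  assumes "\<not> heavy h y" "h \<le> w"
  shows "h \<le> TL h y" "TL h y \<le> w" "\<not> heavy (TL h y) (y div 2 ^ (TL h y - h))"
    and "TL h y = w \<or> heavy (Suc (TL h y)) (y div 2 ^ (TL h y - h) div 2)"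
    and "h \<le> h' \<Longrightarrow> h' \<le> w \<Longrightarrow> \<not> heavy h' (y div 2 ^ (h' - h)) \<Longrightarrow> h' \<le> TL h y \<and> TL h' (y div 2 ^ (h' - h)) = TL h y"
proof -
  let ?S = "{h'. h \<le> h' \<and> h' \<le> w \<and> \<not> heavy h' (y div 2 ^ (h' - h))}"
  have fin: "finite ?S" by simp
  have "TL h y \<in> ?S" unfolding TL_def by (rule Max_in) (use assms in auto)
  then show 1: "h \<le> TL h y" "TL h y \<le> w" "\<not> heavy (TL h y) (y div 2 ^ (TL h y - h))" by auto
  have max: "x \<le> TL h y" if "x \<in> ?S" for x unfolding TL_def using that by (rule Max_ge[OF fin])
  show "TL h y = w \<or> heavy (Suc (TL h y)) (y div 2 ^ (TL h y - h) div 2)"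
  proof (rule ccontr)
    assume "\<not> ?thesis"
    moreover have "y div 2 ^ (Suc (TL h y) - h) = y div 2 ^ (TL h y - h) div 2"
      using 1 by (simp only: Suc_diff_le power_Suc2 div_mult2_eq)
    ultimately have "Suc (TL h y) \<in> ?S" using 1 by auto
    then show False using max by fastforce
  qed
  assume h': "h \<le> h'" "h' \<le> w" "\<not> heavy h' (y div 2 ^ (h' - h))"
  then have le: "h' \<le> TL h y" using max by blast
  have eq: "y div 2 ^ (h' - h) div 2 ^ (x - h') = y div 2 ^ (x - h)" if "h' \<le> x" for x
    using that h' by (simp add: div_mult2_eq[symmetric] power_add[symmetric])
  have "TL h' (y div 2 ^ (h' - h)) = TL h y" unfolding TL_def[of h']
  proof (rule Max_eqI)
    show "TL h y \<in> {x. h' \<le> x \<and> x \<le> w \<and> \<not> heavy x (y div 2 ^ (h' - h) div 2 ^ (x - h'))}"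
      using le 1 eq[OF le] by simp
    fix x assume "x \<in> {x. h' \<le> x \<and> x \<le> w \<and> \<not> heavy x (y div 2 ^ (h' - h) div 2 ^ (x - h'))}"
    then show "x \<le> TL h y" using max[of x] eq[of x] h' by auto
  qed simp
  then show "h' \<le> TL h y \<and> TL h' (y div 2 ^ (h' - h)) = TL h y" using le by simp
qed

text \<open>On each of the w + 1 levels at most N / g nodes are heavy, and w + 1 <= 4 g.\<close>

lemma card_heavy: "card {(h, y) \<in> nodes w. heavy h y} \<le> 4 * N"
proof -
  let ?H = "\<lambda>h. {y. y < 2 ^ w \<and> heavy h y}"
  have one: "card (?H h) * g \<le> N" for h
  proof -
    have "card (?H h) * g \<le> (\<Sum>y\<in>?H h. card (cnt h y))"
      using sum_bounded_below[of "?H h" g "\<lambda>y. card (cnt h y)"] by (simp add: heavy_def)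
    also have "\<dots> = card (\<Union>y\<in>?H h. cnt h y)"
      by (rule card_UN_disjoint[symmetric]) (auto simp: finite_cnt, auto simp: cnt_def)
    also have "\<dots> \<le> card {..<N}" by (rule card_mono) (auto simp: cnt_def)
    finally show ?thesis by simp
  qed
  have "{(h, y) \<in> nodes w. heavy h y} = (SIGMA h:{..w}. ?H h)" by (auto simp: nodes_def)
  then have "card {(h, y) \<in> nodes w. heavy h y} * g = (\<Sum>h\<le>w. card (?H h) * g)"
    by (simp add: card_SigmaI sum_distrib_right)
  also have "\<dots> \<le> (\<Sum>h\<le>w. N)" by (rule sum_mono) (rule one)
  also have "\<dots> = (w + 1) * N" by simp
  also have "\<dots> \<le> (4 * g) * N" using ff g by (intro mult_right_mono) linarith+
  finally have "card {(h, y) \<in> nodes w. heavy h y} * g \<le> (4 * N) * g" by (simp add: ac_simps)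
  then show ?thesis using g_pos by simp
qed

text \<open>At most 4 N heavy nodes, their 8 N children and the root make 12 N + 1 keys. This is the
  origin of the factor 13 in the mean load of the hash functions.\<close>

lemma card_K0: "card K0 \<le> 13 * N"
proof -
  let ?H = "{(h, y) \<in> nodes w. heavy h y}"
  have finH: "finite ?H" by (rule finite_subset[OF _ finite_nodes[of w]]) auto
  let ?ch = "\<lambda>d. (\<lambda>(h, y). (h - 1, 2 * y + d)) ` ?H"
  have "K0 \<subseteq> ?H \<union> {(w, 0)} \<union> ?ch 0 \<union> ?ch 1"
  proof
    fix k assume k0: "k \<in> K0"
    obtain h y where hy: "k = (h, y)" by (cases k)
    have k: "(h, y) \<in> K0" using k0 hy by simp
    then obtain r where r: "r < N" "y = e r div 2 ^ h" by (auto simp: K0_def cnt_def)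
    have hw: "h \<le> w" "y < 2 ^ w" using k by (auto simp: K0_def nodes_def)
    show "k \<in> ?H \<union> {(w, 0)} \<union> ?ch 0 \<union> ?ch 1"
    proof (cases "heavy h y \<or> h = w")
      case True
      then have "heavy h y \<or> (h = w \<and> y = 0)" using r e_w[OF r(1)] by auto
      then show ?thesis using hy hw by (auto simp: nodes_def)
    next
      case False
      then have hv: "heavy (Suc h) (y div 2)" using k by (auto simp: K0_def)
      have mem: "(Suc h, y div 2) \<in> ?H" using hv hw False by (auto simp: nodes_def)
      have "k \<in> ?ch (y mod 2)" unfolding hy by (rule image_eqI[OF _ mem]) simp
      moreover have "y mod 2 = 0 \<or> y mod 2 = 1" by auto
      ultimately have "k \<in> ?ch 0 \<or> k \<in> ?ch 1" by (elim disjE) (simp_all only: disj_absorb simp_thms)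
      then show ?thesis by blast
    qed
  qed
  then have "card K0 \<le> card (?H \<union> {(w, 0)} \<union> ?ch 0 \<union> ?ch 1)"
    by (rule card_mono[rotated]) (use finH in simp)
  also have "\<dots> \<le> card ?H + 1 + card (?ch 0) + card (?ch 1)"
    using card_Un_le[of "?H \<union> {(w, 0)} \<union> ?ch 0" "?ch 1"] card_Un_le[of "?H \<union> {(w, 0)}" "?ch 0"] card_Un_le[of ?H "{(w, 0)}"]
    by simp
  also have "\<dots> \<le> card ?H + 1 + card ?H + card ?H"
    using card_image_le[OF finH] by (intro add_mono) auto
  also have "\<dots> \<le> 13 * N" using card_heavy N1 by simp
  finally show ?thesis .
qed

lemma card_K1: "card K1 \<le> N * (13 * f)"
proof -
  define T where "T r = Max {h'. h' \<le> w \<and> \<not> heavy h' (e r div 2 ^ h')}" for r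
  \<comment> \<open>Heights of the keys above r: at most 4 f multiples of f, and the f heights
    ending at \<open>T r\<close>, the value of \<open>TL\<close> at every light ancestor of r. The
    set \<open>{..<f}\<close> makes up for the truncation of \<open>T r - f\<close> at 0.\<close>
  let ?H = "\<lambda>r. (\<lambda>q. q * f) ` {..<4 * f} \<union> {T r - f<..T r} \<union> {..<f}"
  have "K1 \<subseteq> (\<lambda>(r, h). (h, e r div 2 ^ h)) ` (SIGMA r:{..<N}. ?H r)"
  proof (clarify)
    fix h y assume k: "(h, y) \<in> K1"
    then obtain r where r: "r < N" "y = e r div 2 ^ h" by (auto simp: K1_def cnt_def)
    have hw: "h \<le> w" "\<not> heavy h y" using k by (auto simp: K1_def nodes_def)
    have "h \<in> ?H r"
    proof (cases "h mod f = 0")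
      case True
      then obtain q where q: "h = q * f" by (metis mod_eq_0_iff_dvd dvd_div_mult_self)
      have "q * f < (4 * f) * f" using le_less_trans[OF hw(1) ff(2)] unfolding q mult.assoc .
      then have "q < 4 * f" by simp
      then show ?thesis using q by blast
    next
      case False
      then have lt: "TL h y < h + f" using k by (auto simp: K1_def)
      have "T r = TL h y"
        unfolding T_def
      proof (rule Max_eqI)
        note tl = TL[OF hw(2,1)]
        show "TL h y \<in> {h'. h' \<le> w \<and> \<not> heavy h' (e r div 2 ^ h')}"
          using tl(1-3) r div_pow_div[OF tl(1), of "e r"] by simp
        fix x assume x: "x \<in> {h'. h' \<le> w \<and> \<not> heavy h' (e r div 2 ^ h')}"
        show "x \<le> TL h y"
        proof (cases "h \<le> x")
          case True
          then show ?thesis using tl(5)[OF True] x r div_pow_div[OF True, of "e r"] by simp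
        qed (use tl(1) in simp)
      qed simp
      then show ?thesis using lt TL(1)[OF hw(2,1)] by auto
    qed
    then show "(h, y) \<in> (\<lambda>(r, h). (h, e r div 2 ^ h)) ` (SIGMA r:{..<N}. ?H r)"
      using r by (intro image_eqI[of _ _ "(r, h)"]) auto
  qed
  then have "card K1 \<le> card ((\<lambda>(r, h). (h, e r div 2 ^ h)) ` (SIGMA r:{..<N}. ?H r))"
    by (rule card_mono[rotated]) auto
  also have "\<dots> \<le> card (SIGMA r:{..<N}. ?H r)" by (rule card_image_le) auto
  also have "\<dots> = (\<Sum>r<N. card (?H r))" by simp
  also have "\<dots> \<le> (\<Sum>r<N. 6 * f)"
  proof (rule sum_mono)
    fix r
    have "card (?H r) \<le> card ((\<lambda>q. q * f) ` {..<4 * f}) + card {T r - f<..T r} + card {..<f}"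
      using card_Un_le[of "(\<lambda>q. q * f) ` {..<4 * f} \<union> {T r - f<..T r}" "{..<f}"]
        card_Un_le[of "(\<lambda>q. q * f) ` {..<4 * f}" "{T r - f<..T r}"] by simp
    also have "\<dots> \<le> 4 * f + f + f"
      using card_image_le[of "{..<4 * f}" "\<lambda>q. q * f"] by (intro add_mono) auto
    finally show "card (?H r) \<le> 6 * f" by simp
  qed
  also have "\<dots> \<le> N * (13 * f)" by simp
  finally show ?thesis .
qed

text \<open>The fewer than g elements below a light node have consecutive ranks. A window is 2 g
  long, so the one that starts at the last multiple of g up to the first of them contains them
  all.\<close>

lemma light_window:
  assumes "cnt h y \<noteq> {}" "\<not> heavy h y" shows "\<exists>c. c * g < N \<and> cnt h y \<subseteq> window c"
proof -
  define r0 where "r0 = Min (cnt h y)"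
  have r0: "r0 \<in> cnt h y" unfolding r0_def by (rule Min_in[OF finite_cnt assms(1)])
  have min: "r0 \<le> r" if "r \<in> cnt h y" for r unfolding r0_def using that by (rule Min_le[OF finite_cnt])
  have "r < r0 + g" if r: "r \<in> cnt h y" for r
  proof (rule ccontr)
    assume "\<not> r < r0 + g"
    have "{r0..r} \<subseteq> cnt h y"
    proof
      fix s assume s: "s \<in> {r0..r}"
      have rN: "r < N" "r0 < N" using r r0 by (auto simp: cnt_def)
      have "e r0 div 2 ^ h \<le> e s div 2 ^ h" "e s div 2 ^ h \<le> e r div 2 ^ h"
        using s rN by (auto intro!: div_le_mono e_le)
      then show "s \<in> cnt h y" using r r0 s by (auto simp: cnt_def)
    qed
    then have "card {r0..r} \<le> card (cnt h y)" by (rule card_mono[OF finite_cnt])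
    then show False using \<open>\<not> r < r0 + g\<close> assms(2) min[OF r] by (simp add: heavy_def)
  qed
  note up = this
  have d: "r0 div g * g \<le> r0" "r0 < r0 div g * g + g"
    using div_mult_mod_eq[of r0 g] mod_less_divisor[of g r0] g_pos by linarith+
  have "cnt h y \<subseteq> window (r0 div g)"
  proof
    fix r assume r: "r \<in> cnt h y"
    then have "r < N" by (simp add: cnt_def)
    moreover have "r0 div g * g \<le> r" using d(1) min[OF r] by (rule le_trans)
    moreover have "r < r0 div g * g + 2 * g" using up[OF r] d(2) by linarith
    ultimately show "r \<in> window (r0 div g)" by (simp add: window_def)
  qed
  moreover have "r0 div g * g < N" using d(1) node_cnt[OF r0] le_less_trans by blast
  ultimately show ?thesis by blast
qed

text \<open>If a and b separate at the node (h, y), then a < \<open>mid\<close> <= b for its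
  midpoint. A nonempty range thus contains the last element before the midpoint or the first one
  from it on. Their ranks R - 1 and R depend on the node only, and the window of R - 1 also reaches
  R.\<close>

lemma lca_window:
  "\<exists>c. c * g < N \<and> (\<forall>a b. a \<le> b \<longrightarrow> hgt a b = h \<longrightarrow> a div 2 ^ h = y \<longrightarrow> inrange a b \<noteq> {} \<longrightarrow> inrange a b \<inter> window c \<noteq> {})"
proof (cases "h = 0")
  case True
  \<comment> \<open>For h = 0 the range is the single value y. If y is not an element, the default 0
    still names an existing window.\<close>
  define r where "r = (if \<exists>r<N. e r = y then SOME r. r < N \<and> e r = y else 0)"
  have "inrange a b \<inter> window (r div g) \<noteq> {}" if ab: "hgt a b = h" "a div 2 ^ h = y" "inrange a b \<noteq> {}" for a b
  proof -
    have "a = b" "a = y" using ab True hgt_eq_0_iff[of a b] by auto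
    then have ex: "\<exists>r<N. e r = y" using ab by (auto simp: inrange_def)
    then have "r = (SOME r. r < N \<and> e r = y)" by (simp add: r_def)
    then have r: "r < N \<and> e r = y" using someI_ex[OF ex] by simp
    have "r div g * g \<le> r" "r < r div g * g + g"
      using div_mult_mod_eq[of r g] mod_less_divisor[of g r] g_pos by linarith+
    then have "r \<in> inrange a b \<inter> window (r div g)" using r \<open>a = b\<close> \<open>a = y\<close> by (simp add: inrange_def window_def)
    then show ?thesis by blast
  qed
  moreover have "r < N"
  proof (cases "\<exists>r<N. e r = y")
    case True
    then show ?thesis using someI_ex[OF True] by (simp add: r_def)
  next
    case False
    then have "r = 0" unfolding r_def by (rule if_not_P)
    then show ?thesis using N1 by simp
  qed
  then have "r div g * g < N" using div_times_less_eq_dividend[of r g] by linarith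
  ultimately show ?thesis by blast
next
  case False
  define mid where "mid = (2 * y + 1) * 2 ^ (h - 1)"
  define R where "R = card {r. r < N \<and> e r < mid}"
  have below: "e r < mid \<longleftrightarrow> r < R" if r: "r < N" for r
  proof
    assume "e r < mid"
    then have "{..r} \<subseteq> {r. r < N \<and> e r < mid}" using r e_le[OF _ r] le_less_trans by auto
    then have "card {..r} \<le> R" unfolding R_def by (intro card_mono) auto
    then show "r < R" by simp
  next
    assume "r < R"
    show "e r < mid"
    proof (rule ccontr)
      assume "\<not> e r < mid"
      have "{r. r < N \<and> e r < mid} \<subseteq> {..<r}"
      proof
        fix s assume s: "s \<in> {r. r < N \<and> e r < mid}"
        then show "s \<in> {..<r}" using e_le[of r s] \<open>\<not> e r < mid\<close> by (cases "r \<le> s") auto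
      qed
      then have "R \<le> card {..<r}" unfolding R_def by (intro card_mono) auto
      then show False using \<open>r < R\<close> by simp
    qed
  qed
  have RN: "R \<le> N" unfolding R_def using card_mono[of "{..<N}" "{r. r < N \<and> e r < mid}"] by auto
  let ?c = "(R - 1) div g"
  have c: "?c * g \<le> R - 1" "R - 1 < ?c * g + g"
    using div_mult_mod_eq[of "R - 1" g] mod_less_divisor[of g "R - 1"] g_pos by linarith+
  have "inrange a b \<inter> window ?c \<noteq> {}" if ab: "a \<le> b" "hgt a b = h" "a div 2 ^ h = y" "inrange a b \<noteq> {}" for a b
  proof -
    have lt: "a < b" using ab False hgt_eq_0_iff[of a b] by auto
    let ?A = "a div 2 ^ (h - 1)" and ?B = "b div 2 ^ (h - 1)"
    have br: "?B = Suc ?A" "even ?A" using hgt_branch[OF lt] ab by auto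
    have "?A div 2 = y" using ab(3) False by (metis Suc_diff_1 div_mult2_eq neq0_conv power_Suc2)
    then have A: "?A = 2 * y" using br by auto
    then have mid: "mid = ?B * 2 ^ (h - 1)" using br by (simp add: mid_def)
    have mb: "mid \<le> b" unfolding mid by simp
    have am: "a < mid"
    proof -
      have "a = ?A * 2 ^ (h - 1) + a mod 2 ^ (h - 1)" by (simp only: div_mult_mod_eq)
      moreover have "a mod 2 ^ (h - 1) < 2 ^ (h - 1)" by simp
      ultimately have "a < Suc ?A * 2 ^ (h - 1)" unfolding mult_Suc by linarith
      then show ?thesis using mid br by simp
    qed
    obtain r where r: "r < N" "a \<le> e r" "e r \<le> b" using ab by (auto simp: inrange_def)
    show ?thesis
    proof (cases "e r < mid")
      case True
      then have rR: "r < R" using below r by simp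
      then have RN': "R - 1 < N" "r \<le> R - 1" using RN by auto
      have "e r \<le> e (R - 1)" using e_le RN' by simp
      moreover have "e (R - 1) < mid" using below[of "R - 1"] RN' rR by simp
      ultimately have "R - 1 \<in> inrange a b" using r mb RN' by (simp add: inrange_def)
      moreover have "R - 1 < ?c * g + 2 * g" using c by linarith
      then have "R - 1 \<in> window ?c" using c RN' unfolding window_def by blast
      ultimately show ?thesis by blast
    next
      case False
      then have rR: "R \<le> r" using below r by simp
      then have "R < N" using r by simp
      have "mid \<le> e R" using below[OF \<open>R < N\<close>] by simp
      then have "R \<in> inrange a b" using \<open>R < N\<close> am e_le[OF rR] r by (auto simp: inrange_def)
      moreover have "?c * g \<le> R" "R < ?c * g + 2 * g" using c g_pos by linarith+
      then have "R \<in> window ?c" using \<open>R < N\<close> unfolding window_def by blast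
      ultimately show ?thesis by blast
    qed
  qed
  moreover have "?c * g < N" using c(1) RN N1 by linarith
  ultimately show ?thesis by blast
qed

text \<open>A light node also serves ranges that separate at one of its descendants; therefore its
  window has to contain all its elements. A window for a heavy node only has to meet the ranges that
  separate there.\<close>

definition pay :: "nat \<times> nat \<Rightarrow> nat" where
  "pay = (\<lambda>(h, y). SOME c. c * g < N \<and> (if cnt h y \<noteq> {} \<and> \<not> heavy h y then cnt h y \<subseteq> window c else
     (\<forall>a b. a \<le> b \<longrightarrow> hgt a b = h \<longrightarrow> a div 2 ^ h = y \<longrightarrow> inrange a b \<noteq> {} \<longrightarrow> inrange a b \<inter> window c \<noteq> {})))"

lemma pay:
  "pay (h, y) * g < N"
  "cnt h y \<noteq> {} \<Longrightarrow> \<not> heavy h y \<Longrightarrow> cnt h y \<subseteq> window (pay (h, y))"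
  "heavy h y \<Longrightarrow> a \<le> b \<Longrightarrow> hgt a b = h \<Longrightarrow> a div 2 ^ h = y \<Longrightarrow> inrange a b \<noteq> {} \<Longrightarrow> inrange a b \<inter> window (pay (h, y)) \<noteq> {}"
proof -
  let ?P = "\<lambda>c. c * g < N \<and> (if cnt h y \<noteq> {} \<and> \<not> heavy h y then cnt h y \<subseteq> window c else
     (\<forall>a b. a \<le> b \<longrightarrow> hgt a b = h \<longrightarrow> a div 2 ^ h = y \<longrightarrow> inrange a b \<noteq> {} \<longrightarrow> inrange a b \<inter> window c \<noteq> {}))"
  have "\<exists>c. ?P c"
  proof (cases "cnt h y \<noteq> {} \<and> \<not> heavy h y")
    case True
    then obtain c where "c * g < N \<and> cnt h y \<subseteq> window c" using light_window[of h y] by blast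
    then show ?thesis using True by (intro exI[of _ c]) simp
  next
    case False
    then show ?thesis using lca_window[of h y] by (simp only: if_False)
  qed
  then have P: "?P (pay (h, y))" unfolding pay_def prod.case by (rule someI_ex)
  then show "pay (h, y) * g < N" by blast
  show "cnt h y \<subseteq> window (pay (h, y))" if "cnt h y \<noteq> {}" "\<not> heavy h y" using P that by simp
  show "inrange a b \<inter> window (pay (h, y)) \<noteq> {}"
    if "heavy h y" "a \<le> b" "hgt a b = h" "a div 2 ^ h = y" "inrange a b \<noteq> {}" using P that by simp
qed

text \<open>
  The lowest common ancestor \<open>(h, y)\<close> of a nonempty range is either heavy, or the height of its
  topmost light ancestor is the value of one of two keys, at heights \<open>h\<close> and \<open>f * \<lceil>h / f\<rceil>\<close>.
\<close>

lemma locate: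
  assumes ab: "a \<le> b" "b < 2 ^ w" "inrange a b \<noteq> {}"
    and h: "h = hgt a b" and y: "y = a div 2 ^ h" and h': "h' = f * ((h + f - 1) div f)"
  shows "((h, y) \<in> K0 \<and> inrange a b \<inter> window (pay (h, y)) \<noteq> {}) \<or>
    (\<exists>k\<in>{(h, y), (h', y div 2 ^ (h' - h))}. k \<in> K1 \<and>
       (let d = TL (fst k) (snd k) in h \<le> d \<and> (d, y div 2 ^ (d - h)) \<in> K0 \<and>
          inrange a b \<inter> window (pay (d, y div 2 ^ (d - h))) \<noteq> {}))"
proof -
  obtain r where r: "r \<in> inrange a b" using ab by blast
  have rN: "r < N" "a \<le> e r" "e r \<le> b" using r by (auto simp: inrange_def)
  have hw: "h \<le> w" unfolding h using ab by (intro hgt_le_width) auto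
  have "a div 2 ^ h \<le> e r div 2 ^ h" "e r div 2 ^ h \<le> b div 2 ^ h" using rN by (auto intro: div_le_mono)
  then have ry: "e r div 2 ^ h = y" using hgt_agree[of a b] by (simp add: y h)
  then have rc: "r \<in> cnt h y" using rN by (simp add: cnt_def)
  have node: "(h, y) \<in> nodes w" using node_in[OF rN(1) hw] ry by simp
  show ?thesis
  proof (cases "heavy h y")
    case True
    then have "(h, y) \<in> K0" using node rc by (auto simp: K0_def)
    then show ?thesis using pay(3)[OF True ab(1) h[symmetric] y[symmetric] ab(3)] by blast
  next
    case False
    note tl = TL[OF False hw]
    let ?d = "TL h y"
    let ?q = "y div 2 ^ (?d - h)"
    have rq: "r \<in> cnt ?d ?q" using cnt_mono[OF tl(1), of y] rc by blast
    have "?q = e r div 2 ^ ?d" using node_cnt[OF rq] by simp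
    then have "(?d, ?q) \<in> nodes w" using node_in[OF rN(1) tl(2)] by simp
    then have q: "(?d, ?q) \<in> K0" using tl(4) rq by (auto simp: K0_def)
    have "cnt ?d ?q \<subseteq> window (pay (?d, ?q))" using pay(2)[OF _ tl(3)] rq by blast
    then have meet: "inrange a b \<inter> window (pay (?d, ?q)) \<noteq> {}" using rq r by blast
    \<comment> \<open>The ancestor at h rounded up to a multiple of f, less than f levels
      above.\<close>
    let ?k = "(h', y div 2 ^ (h' - h))"
    have hh: "h \<le> h'" "h' < h + f"
    proof -
      have "h + f - 1 = h' + (h + f - 1) mod f" unfolding h' by simp
      moreover have "(h + f - 1) mod f < f" using f_pos by simp
      ultimately show "h \<le> h'" "h' < h + f" using f_pos by linarith+
    qed
    show ?thesis
    proof (cases "h' \<le> w \<and> \<not> heavy h' (y div 2 ^ (h' - h))")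
      case True
      then have t: "h' \<le> ?d" "TL h' (y div 2 ^ (h' - h)) = ?d" using tl(5)[OF hh(1)] by auto
      have rk: "r \<in> cnt h' (y div 2 ^ (h' - h))" using cnt_mono[OF hh(1), of y] rc by blast
      have "y div 2 ^ (h' - h) = e r div 2 ^ h'" using node_cnt[OF rk] by simp
      then have "?k \<in> nodes w" using node_in[OF rN(1), of h'] True by simp
      then have "?k \<in> K1" using True rk h' by (auto simp: K1_def)
      then show ?thesis using t q meet tl(1) by (intro disjI2 bexI[of _ ?k]) (auto simp: Let_def)
    next
      case f: False
      \<comment> \<open>If that ancestor is heavy or beyond the root, the topmost light ancestor
        lies below it, hence less than f levels above h, and (h, y) itself is a key.\<close>
      have "?d < h'"
      proof (rule ccontr)
        assume "\<not> ?d < h'"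
        then have le: "h' \<le> ?d" by simp
        then have "heavy h' (y div 2 ^ (h' - h))" using f tl(2) by simp
        then have "heavy ?d (y div 2 ^ (h' - h) div 2 ^ (?d - h'))" by (rule heavy_up[OF le])
        moreover have "y div 2 ^ (h' - h) div 2 ^ (?d - h') = ?q"
          using le hh(1) by (simp add: div_mult2_eq[symmetric] power_add[symmetric])
        ultimately show False using tl(3) by simp
      qed
      then have "(h, y) \<in> K1" using node rc False hh by (auto simp: K1_def)
      then show ?thesis using q meet tl(1) by (intro disjI2 bexI[of _ "(h, y)"]) (auto simp: Let_def)
    qed
  qed
qed

end

section \<open>Segments of a window\<close>

text \<open>A set \<open>E\<close> of boundaries cuts \<open>{0..<nb}\<close> into segments; \<open>{seg_lo E x..<seg_hi nb E x}\<close> is the one containing \<open>x\<close>.\<close>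

definition seg_lo :: "nat set \<Rightarrow> nat \<Rightarrow> nat" where
  "seg_lo E x = Max (insert 0 {e \<in> E. e \<le> x})"

definition seg_hi :: "nat \<Rightarrow> nat set \<Rightarrow> nat \<Rightarrow> nat" where
  "seg_hi nb E x = Min (insert nb {e \<in> E. x < e})"

lemma seg_props:
  assumes E: "E \<subseteq> {1..<nb}" and x: "x < nb"
  shows "seg_lo E x \<le> x" "x < seg_hi nb E x" "seg_hi nb E x \<le> nb"
    "seg_lo E x \<in> insert 0 E" "seg_hi nb E x \<in> insert nb E"
    "\<And>e. e \<in> E \<Longrightarrow> e \<le> seg_lo E x \<or> seg_hi nb E x \<le> e"
proof -
  have fin: "finite E" using E finite_subset by blast
  let ?L = "insert 0 {e \<in> E. e \<le> x}" and ?H = "insert nb {e \<in> E. x < e}"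
  have finL: "finite ?L" and finH: "finite ?H" using fin by auto
  have L: "seg_lo E x \<in> ?L" unfolding seg_lo_def by (rule Max_in[OF finL]) simp
  have H: "seg_hi nb E x \<in> ?H" unfolding seg_hi_def by (rule Min_in[OF finH]) simp
  show "seg_lo E x \<le> x" "seg_lo E x \<in> insert 0 E" using L by auto
  show "x < seg_hi nb E x" "seg_hi nb E x \<le> nb" "seg_hi nb E x \<in> insert nb E" using H x E by auto
  fix e assume e: "e \<in> E"
  show "e \<le> seg_lo E x \<or> seg_hi nb E x \<le> e"
  proof (cases "e \<le> x")
    case True
    then have "e \<le> seg_lo E x" unfolding seg_lo_def using e by (intro Max_ge[OF finL]) simp
    then show ?thesis ..
  next
    case False
    then have "seg_hi nb E x \<le> e" unfolding seg_hi_def using e by (intro Min_le[OF finH]) simp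
    then show ?thesis ..
  qed
qed

lemma seg_unique:
  assumes E: "E \<subseteq> {1..<nb}" and st: "s \<in> insert 0 E" "t \<in> insert nb E" "s \<le> x" "x < t" "t \<le> nb"
    and gap: "\<And>e. e \<in> E \<Longrightarrow> e \<le> s \<or> t \<le> e"
  shows "seg_lo E x = s" "seg_hi nb E x = t"
proof -
  have x: "x < nb" using st by simp
  note p = seg_props[OF E x]
  have "s \<le> seg_lo E x"
  proof (cases "s \<in> E")
    case True
    then show ?thesis using p(6)[OF True] p(2) st(3) by linarith
  qed (use st in simp)
  moreover have "seg_lo E x \<le> s"
  proof (cases "seg_lo E x \<in> E")
    case True
    then show ?thesis using gap[OF True] p(1) st(4) by linarith
  qed (use p(4) in simp)
  ultimately show "seg_lo E x = s" by simp
  have "seg_hi nb E x \<le> t"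
  proof (cases "t \<in> E")
    case True
    then show ?thesis using p(6)[OF True] p(1) st(4) by linarith
  qed (use st p(3) in simp)
  moreover have "t \<le> seg_hi nb E x"
  proof (cases "seg_hi nb E x \<in> E")
    case True
    then show ?thesis using gap[OF True] p(2) st(3) by linarith
  qed (use p(5) st in simp)
  ultimately show "seg_hi nb E x = t" by simp
qed

lemma seg_same:
  assumes E: "E \<subseteq> {1..<nb}" and x: "x < nb" and y: "seg_lo E x \<le> y" "y < seg_hi nb E x"
  shows "seg_lo E y = seg_lo E x" "seg_hi nb E y = seg_hi nb E x"
  by (rule seg_unique[OF E seg_props(4,5)[OF E x] y seg_props(3)[OF E x]], erule seg_props(6)[OF E x])+

lemma seg_boundary:
  assumes E: "E \<subseteq> {1..<nb}" and e: "e \<in> E"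
  shows "seg_lo E e = e" "seg_hi nb E (e - 1) = e"
proof -
  have lt: "e < nb" "0 < e" using E e by auto
  show "seg_lo E e = e" using seg_props(1,2)[OF E lt(1)] seg_props(6)[OF E lt(1) e] by linarith
  have "e - 1 < nb" using lt by simp
  then show "seg_hi nb E (e - 1) = e"
    using seg_props(1,2)[OF E, of "e - 1"] seg_props(6)[OF E _ e, of "e - 1"] lt by linarith
qed

definition seg_union :: "(nat \<Rightarrow> 'a set) \<Rightarrow> nat \<Rightarrow> nat \<Rightarrow> 'a set" where
  "seg_union A s t = (\<Union>y\<in>{s..<t}. A y)"

text \<open>Going down from i = I to 0, the boundaries are thinned to a minimal set that still
  respects the capacity B. Minimality makes any two adjacent segments overfull together.\<close>

lemma merging_chain:
  fixes A :: "nat \<Rightarrow> nat \<Rightarrow> 'a set"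
  assumes mono: "\<And>i j y. i \<le> j \<Longrightarrow> A i y \<subseteq> A j y" and fin: "\<And>i y. finite (A i y)"
    and T: "T \<subseteq> {1..<nb}" "\<And>x. x < nb \<Longrightarrow> card (seg_union (A I) (seg_lo T x) (seg_hi nb T x)) \<le> B"
  shows "\<exists>E. E (Suc I) = T \<and> (\<forall>i\<le>I. E i \<subseteq> E (Suc i) \<and>
    (\<forall>x<nb. card (seg_union (A i) (seg_lo (E i) x) (seg_hi nb (E i) x)) \<le> B) \<and>
    (\<forall>e\<in>E i. B < card (seg_union (A i) (seg_lo (E i) (e - 1)) (seg_hi nb (E i) e))))"
  using T
proof (induction I arbitrary: T)
  fix I and T :: "nat set"
  let ?ok = "\<lambda>i E. \<forall>x<nb. card (seg_union (A i) (seg_lo E x) (seg_hi nb E x)) \<le> B"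
  have step: "\<exists>E\<subseteq>T. ?ok i E \<and> (\<forall>e\<in>E. B < card (seg_union (A i) (seg_lo E (e - 1)) (seg_hi nb E e)))"
    if T: "T \<subseteq> {1..<nb}" "?ok i T" for i T
  proof -
    have finT: "finite T" using T finite_subset by blast
    define Q where "Q = {E. E \<subseteq> T \<and> ?ok i E}"
    have "finite Q" unfolding Q_def by (rule finite_subset[of _ "Pow T"]) (use finT in auto)
    moreover have "Q \<noteq> {}" unfolding Q_def using T by blast
    ultimately obtain E where "E \<in> Q" and min: "\<forall>E'\<in>Q. E' \<subseteq> E \<longrightarrow> E = E'"
      using finite_has_minimal[of Q] by blast
    then have E: "E \<subseteq> T" "?ok i E" by (simp_all add: Q_def)
    have Enb: "E \<subseteq> {1..<nb}" using E T by blast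
    have "B < card (seg_union (A i) (seg_lo E (e - 1)) (seg_hi nb E e))" if e: "e \<in> E" for e
    proof (rule ccontr)
      assume le: "\<not> ?thesis"
      let ?E' = "E - {e}" and ?s = "seg_lo E (e - 1)" and ?t = "seg_hi nb E e"
      have "e \<in> {1..<nb}" using Enb e by blast
      then have elt: "e < nb" "0 < e" "e - 1 < nb" by auto
      note pe = seg_props[OF Enb elt(1)] and pe1 = seg_props[OF Enb elt(3)]
      note be = seg_boundary[OF Enb e]
      have E'nb: "?E' \<subseteq> {1..<nb}" using Enb by blast
      \<comment> \<open>Dropping e fuses the two segments next to it and changes no other, so an
        underfull pair would contradict minimality.\<close>
      have "card (seg_union (A i) (seg_lo ?E' x) (seg_hi nb ?E' x)) \<le> B" if x: "x < nb" for x
      proof (cases "?s \<le> x \<and> x < ?t")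
        case True
        have "seg_lo ?E' x = ?s" "seg_hi nb ?E' x = ?t"
        proof -
          have s: "?s \<in> insert 0 ?E'" using pe1(1,4) elt by auto
          have t: "?t \<in> insert nb ?E'" using pe(2,5) by auto
          have gap: "y \<le> ?s \<or> ?t \<le> y" if "y \<in> ?E'" for y
            using pe(6)[of y] pe1(6)[of y] be that by auto
          show "seg_lo ?E' x = ?s" "seg_hi nb ?E' x = ?t"
            using seg_unique[OF E'nb s t _ _ pe(3) gap] True by blast+
        qed
        then show ?thesis using le by simp
      next
        case False
        note px = seg_props[OF Enb x]
        have nlo: "seg_lo E x \<noteq> e"
        proof
          assume h: "seg_lo E x = e"
          then have "seg_hi nb E e = seg_hi nb E x" using seg_same(2)[OF Enb x, of e] px by linarith
          then show False using False h px(1,2) pe1(1) elt by linarith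
        qed
        have nhi: "seg_hi nb E x \<noteq> e"
        proof
          assume h: "seg_hi nb E x = e"
          then have "seg_lo E (e - 1) = seg_lo E x" using seg_same(1)[OF Enb x, of "e - 1"] px by linarith
          then show False using False h px(1,2) pe(2) by linarith
        qed
        have "seg_lo ?E' x = seg_lo E x" "seg_hi nb ?E' x = seg_hi nb E x"
          using seg_unique[OF E'nb, of "seg_lo E x" "seg_hi nb E x" x] px nlo nhi by blast+
        then show ?thesis using E(2) x by simp
      qed
      then have "?E' \<in> Q" using E(1) unfolding Q_def by blast
      then have "E = ?E'" using min by blast
      then show False using e by blast
    qed
    then show ?thesis using E by blast
  qed
  {
    case 0
    then obtain E where E: "E \<subseteq> T" "?ok 0 E" "\<forall>e\<in>E. B < card (seg_union (A 0) (seg_lo E (e - 1)) (seg_hi nb E e))"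
      using step[of T 0] by blast
    show ?case by (rule exI[of _ "\<lambda>i. if i = 0 then E else T"]) (use E in simp)
  next
    case (Suc I)
    then obtain G where G: "G \<subseteq> T" "?ok (Suc I) G"
      "\<forall>e\<in>G. B < card (seg_union (A (Suc I)) (seg_lo G (e - 1)) (seg_hi nb G e))"
      using step[of T "Suc I"] by blast
    \<comment> \<open>The sets shrink as the index decreases, so the boundaries of the later time
      remain feasible.\<close>
    have "card (seg_union (A I) (seg_lo G x) (seg_hi nb G x)) \<le> B" if "x < nb" for x
    proof -
      have "seg_union (A I) (seg_lo G x) (seg_hi nb G x) \<subseteq> seg_union (A (Suc I)) (seg_lo G x) (seg_hi nb G x)"
        using mono[of I "Suc I"] by (auto simp: seg_union_def)
      then have "card (seg_union (A I) (seg_lo G x) (seg_hi nb G x)) \<le> card (seg_union (A (Suc I)) (seg_lo G x) (seg_hi nb G x))"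
        by (intro card_mono) (auto simp: seg_union_def fin)
      then show ?thesis using G(2) that le_trans by blast
    qed
    then obtain E where E: "E (Suc I) = G" "\<forall>i\<le>I. E i \<subseteq> E (Suc i) \<and> ?ok i (E i) \<and>
      (\<forall>e\<in>E i. B < card (seg_union (A i) (seg_lo (E i) (e - 1)) (seg_hi nb (E i) e)))"
      using Suc.IH[of G] G(1) Suc.prems(1) by blast
    show ?case
      by (rule exI[of _ "E(Suc (Suc I) := T)"]) (use E G in \<open>auto simp: le_Suc_eq\<close>)
  }
qed

text \<open>
  Every segment that ever occurs in the chain is charged to an interior boundary \<open>e\<close> at which it
  was created, so that the snapshots of all segments can be stored in one block per boundary.
  \<open>F i\<close> marks, in each nontrivial segment of time \<open>i\<close>, the boundary whose snapshot serves it.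
\<close>

lemma snapshot_chain:
  fixes A :: "nat \<Rightarrow> nat \<Rightarrow> 'a set"
  assumes mono: "\<And>i j y. i \<le> j \<Longrightarrow> A i y \<subseteq> A j y" and fin: "\<And>i y. finite (A i y)"
    and cap: "\<And>y. card (A I y) \<le> B"
  shows "\<exists>E F snap. (\<forall>i\<le>I. E i \<subseteq> {1..<nb} \<and> F i \<subseteq> {1..<nb}) \<and> (\<forall>e. finite (snap e) \<and> card (snap e) \<le> B) \<and>
    (\<forall>i\<le>I. \<forall>x<nb. seg_hi nb (E i) x = Suc (seg_lo (E i) x) \<or>
      (\<exists>e. F i \<inter> {seg_lo (E i) x<..<seg_hi nb (E i) x} = {e} \<and>
        seg_union (A i) (seg_lo (E i) x) (seg_hi nb (E i) x) \<subseteq> snap e \<and>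
        snap e \<subseteq> seg_union (A I) (seg_lo (E i) x) (seg_hi nb (E i) x))) \<and>
    (\<forall>i\<le>I. \<forall>e\<in>E i. B < card (seg_union (A i) (seg_lo (E i) (e - 1)) (seg_hi nb (E i) e)))"
proof -
  let ?top = "{1..<nb}"
  have top: "card (seg_union (A I) (seg_lo ?top x) (seg_hi nb ?top x)) \<le> B" if x: "x < nb" for x
  proof -
    have "seg_lo ?top x = x" "seg_hi nb ?top x = Suc x"
    proof -
      have *: "x \<in> insert 0 ?top" "Suc x \<in> insert nb ?top" "\<And>e. e \<in> ?top \<Longrightarrow> e \<le> x \<or> Suc x \<le> e" using x by auto
      show "seg_lo ?top x = x" "seg_hi nb ?top x = Suc x"
        using seg_unique[OF subset_refl *(1,2) le_refl lessI _ *(3)] x by simp_all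
    qed
    then show ?thesis using cap[of x] by (simp add: seg_union_def)
  qed
  \<comment> \<open>One time beyond I, every boundary is present and each segment is a single
    block.\<close>
  obtain E where ETop: "E (Suc I) = ?top" and chain: "\<forall>i\<le>I. E i \<subseteq> E (Suc i) \<and>
    (\<forall>x<nb. card (seg_union (A i) (seg_lo (E i) x) (seg_hi nb (E i) x)) \<le> B) \<and>
    (\<forall>e\<in>E i. B < card (seg_union (A i) (seg_lo (E i) (e - 1)) (seg_hi nb (E i) e)))"
  proof -
    have "\<exists>E. E (Suc I) = ?top \<and> (\<forall>i\<le>I. E i \<subseteq> E (Suc i) \<and>
      (\<forall>x<nb. card (seg_union (A i) (seg_lo (E i) x) (seg_hi nb (E i) x)) \<le> B) \<and>
      (\<forall>e\<in>E i. B < card (seg_union (A i) (seg_lo (E i) (e - 1)) (seg_hi nb (E i) e))))"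
      by (rule merging_chain[of A ?top nb I B, OF mono fin subset_refl top])
    then show ?thesis using that by blast
  qed
  have E: "E i \<subseteq> E (Suc i)" if "i \<le> I" for i using chain that by simp
  have small: "card (seg_union (A i) (seg_lo (E i) x) (seg_hi nb (E i) x)) \<le> B" if "i \<le> I" "x < nb" for i x
    using chain that by simp
  have big: "B < card (seg_union (A i) (seg_lo (E i) (e - 1)) (seg_hi nb (E i) e))" if "i \<le> I" "e \<in> E i" for i e
    using chain that by simp
  have Emono: "E i \<subseteq> E j" if "i \<le> j" "j \<le> Suc I" for i j
    using that by (induction j rule: dec_induct) (use E in \<open>auto simp: subset_eq\<close>)
  have Enb: "E i \<subseteq> {1..<nb}" if "i \<le> Suc I" for i using Emono[OF that] ETop by simp
  \<comment> \<open>Boundaries only appear as time grows. At time \<open>last e\<close> the boundary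
    e lies inside a segment that is split at the next time, so it holds the largest version of that
    segment.\<close>
  define last where "last e = Max {i. i \<le> I \<and> e \<notin> E i}" for e
  define snap where "snap e = (if e \<in> {1..<nb} \<and> e \<notin> E 0 then
    seg_union (A (last e)) (seg_lo (E (last e)) e) (seg_hi nb (E (last e)) e) else {})" for e
  have last_le: "last e \<le> I" if "e \<notin> E 0" for e
  proof -
    have "last e \<in> {i. i \<le> I \<and> e \<notin> E i}" unfolding last_def by (rule Max_in) (use that in auto)
    then show ?thesis by simp
  qed
  have snap: "finite (snap e) \<and> card (snap e) \<le> B" for e
    using small[OF last_le, of e e] fin by (auto simp: snap_def seg_union_def)
  have mark: "\<exists>e\<in>{seg_lo (E i) x<..<seg_hi nb (E i) x}. e \<in> {1..<nb} \<and>
      seg_union (A i) (seg_lo (E i) x) (seg_hi nb (E i) x) \<subseteq> snap e \<and>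
      snap e \<subseteq> seg_union (A I) (seg_lo (E i) x) (seg_hi nb (E i) x)"
    if i: "i \<le> I" and x: "x < nb" and ne: "seg_hi nb (E i) x \<noteq> Suc (seg_lo (E i) x)" for i x
  proof -
    let ?s = "seg_lo (E i) x" and ?t = "seg_hi nb (E i) x"
    have iS: "i \<le> Suc I" using i by simp
    note px = seg_props[OF Enb[OF iS] x]
    \<comment> \<open>The segment is followed to the last time T at which it exists. A boundary e
      that splits it then has \<open>last e = T\<close>, and its snapshot contains all earlier
      versions.\<close>
    define T where "T = Max {j. i \<le> j \<and> j \<le> I \<and> seg_lo (E j) x = ?s \<and> seg_hi nb (E j) x = ?t}"
    have T: "T \<in> {j. i \<le> j \<and> j \<le> I \<and> seg_lo (E j) x = ?s \<and> seg_hi nb (E j) x = ?t}"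
      unfolding T_def by (rule Max_in) (use i in auto)
    have Tmax: "j \<le> T" if "i \<le> j" "j \<le> I" "seg_lo (E j) x = ?s" "seg_hi nb (E j) x = ?t" for j
      unfolding T_def by (rule Max_ge) (use that in auto)
    have TS: "T \<le> Suc I" "Suc T \<le> Suc I" using T by auto
    have "\<exists>e\<in>E (Suc T). ?s < e \<and> e < ?t"
    proof (rule ccontr)
      assume no: "\<not> ?thesis"
      have "?s \<in> insert 0 (E (Suc T))" "?t \<in> insert nb (E (Suc T))"
        using px(4,5) Emono[of i "Suc T"] T by auto
      then have seg: "seg_lo (E (Suc T)) x = ?s" "seg_hi nb (E (Suc T)) x = ?t"
        using seg_unique[OF Enb[OF TS(2)], of ?s ?t x] px(1,2,3) no by (meson not_le)+
      show False
      proof (cases "T = I")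
        case True
        have "Suc ?s < ?t" using ne px(1,2) by linarith
        then have "Suc ?s \<in> E (Suc T)" using True ETop px(3) by simp
        then show ?thesis using no \<open>Suc ?s < ?t\<close> by blast
      next
        case False
        then have "Suc T \<le> T" using Tmax[of "Suc T"] T seg by simp
        then show ?thesis by simp
      qed
    qed
    then obtain e where e: "e \<in> E (Suc T)" "?s < e" "e < ?t" by blast
    have eT: "e \<notin> E T"
      using seg_props(6)[OF Enb[OF TS(1)] x, of e] T e by auto
    have enb: "e \<in> {1..<nb}" using e(1) Enb[OF TS(2)] by blast
    have "last e = T" unfolding last_def
    proof (rule Max_eqI)
      show "T \<in> {i. i \<le> I \<and> e \<notin> E i}" using T eT by simp
      fix j assume "j \<in> {i. i \<le> I \<and> e \<notin> E i}"
      then show "j \<le> T" using Emono[of "Suc T" j] e(1) by (metis (mono_tags, lifting) le_SucI mem_Collect_eq not_less_eq_eq subsetD)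
    qed simp
    moreover have "e \<notin> E 0" using Emono[of 0 T] TS eT by blast
    moreover have "seg_lo (E T) e = ?s" "seg_hi nb (E T) e = ?t"
      using seg_same[OF Enb[OF TS(1)] x, of e] T e by auto
    ultimately have "snap e = seg_union (A T) ?s ?t" using enb by (simp add: snap_def)
    moreover have "seg_union (A i) ?s ?t \<subseteq> seg_union (A T) ?s ?t" "seg_union (A T) ?s ?t \<subseteq> seg_union (A I) ?s ?t"
      using mono[of i T] mono[of T I] T by (fastforce simp: seg_union_def)+
    ultimately show ?thesis using e enb by (intro bexI[of _ e]) auto
  qed
  define mk where "mk i s t = (SOME e. e \<in> {s<..<t} \<and> e \<in> {1..<nb} \<and>
      seg_union (A i) s t \<subseteq> snap e \<and> snap e \<subseteq> seg_union (A I) s t)" for i s t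
  have mk: "mk i s t \<in> {s<..<t} \<and> mk i s t \<in> {1..<nb} \<and>
      seg_union (A i) s t \<subseteq> snap (mk i s t) \<and> snap (mk i s t) \<subseteq> seg_union (A I) s t"
    if "i \<le> I" "x < nb" "t \<noteq> Suc s" "s = seg_lo (E i) x" "t = seg_hi nb (E i) x" for i x s t
  proof -
    have "\<exists>e. e \<in> {s<..<t} \<and> e \<in> {1..<nb} \<and> seg_union (A i) s t \<subseteq> snap e \<and> snap e \<subseteq> seg_union (A I) s t"
      using mark[OF that(1,2)] that(3-5) by blast
    then show ?thesis unfolding mk_def by (rule someI_ex)
  qed
  define F where "F i = {mk i (seg_lo (E i) x) (seg_hi nb (E i) x) | x. x < nb \<and> seg_hi nb (E i) x \<noteq> Suc (seg_lo (E i) x)}" for i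
  have F: "F i \<inter> {seg_lo (E i) x<..<seg_hi nb (E i) x} = {mk i (seg_lo (E i) x) (seg_hi nb (E i) x)}"
    if i: "i \<le> I" and x: "x < nb" and ne: "seg_hi nb (E i) x \<noteq> Suc (seg_lo (E i) x)" for i x
  proof -
    have iS: "i \<le> Suc I" using i by simp
    have "mk i (seg_lo (E i) y) (seg_hi nb (E i) y) = mk i (seg_lo (E i) x) (seg_hi nb (E i) x)"
      if y: "y < nb" "seg_hi nb (E i) y \<noteq> Suc (seg_lo (E i) y)"
        and mem: "mk i (seg_lo (E i) y) (seg_hi nb (E i) y) \<in> {seg_lo (E i) x<..<seg_hi nb (E i) x}" for y
    proof -
      let ?e = "mk i (seg_lo (E i) y) (seg_hi nb (E i) y)"
      have "?e \<in> {seg_lo (E i) y<..<seg_hi nb (E i) y}" using mk[OF i y(1) y(2) refl refl] by blast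
      then show ?thesis
        using seg_same[OF Enb[OF iS] y(1), of ?e] seg_same[OF Enb[OF iS] x, of ?e] mem by auto
    qed
    moreover have "mk i (seg_lo (E i) x) (seg_hi nb (E i) x) \<in> {seg_lo (E i) x<..<seg_hi nb (E i) x}"
      using mk[OF i x ne refl refl] by blast
    ultimately show ?thesis using x ne unfolding F_def by blast
  qed
  show ?thesis
  proof (rule exI[of _ E], rule exI[of _ F], rule exI[of _ snap], intro conjI allI impI ballI)
    show "E i \<subseteq> {1..<nb}" if "i \<le> I" for i using Enb that by simp
    show "F i \<subseteq> {1..<nb}" if "i \<le> I" for i using mk[OF that _ _ refl refl] unfolding F_def by blast
    show "seg_hi nb (E i) x = Suc (seg_lo (E i) x) \<or>
      (\<exists>e. F i \<inter> {seg_lo (E i) x<..<seg_hi nb (E i) x} = {e} \<and>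
        seg_union (A i) (seg_lo (E i) x) (seg_hi nb (E i) x) \<subseteq> snap e \<and>
        snap e \<subseteq> seg_union (A I) (seg_lo (E i) x) (seg_hi nb (E i) x))" if "i \<le> I" "x < nb" for i x
      using F[OF that] mk[OF that _ refl refl] by blast
  qed (use snap big in auto)
qed

text \<open>Each segment belongs to at most two of the overfull adjacent pairs.\<close>

lemma card_segments_le:
  fixes A :: "nat \<Rightarrow> 'a set"
  assumes E: "E \<subseteq> {1..<nb}" and fin: "\<And>y. finite (A y)"
    and disj: "\<And>x y. x \<noteq> y \<Longrightarrow> A x \<inter> A y = {}"
    and big: "\<And>e. e \<in> V \<Longrightarrow> B < card (seg_union A (seg_lo E (e - 1)) (seg_hi nb E e))"
    and V: "V \<subseteq> E" and sub: "\<And>e. e \<in> V \<Longrightarrow> seg_union A (seg_lo E (e - 1)) (seg_hi nb E e) \<subseteq> Z" and Z: "finite Z"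
  shows "B * card V \<le> 2 * card Z"
proof -
  \<comment> \<open>Each pair is cut at its boundary e. The left parts of different e are disjoint,
    and so are the right parts, so each family counts Z at most once.\<close>
  let ?L = "\<lambda>e. seg_union A (seg_lo E (e - 1)) e" and ?R = "\<lambda>e. seg_union A e (seg_hi nb E e)"
  have finV: "finite V" by (rule finite_subset[OF subset_trans[OF V E]]) simp
  have finS: "finite (seg_union A s t)" for s t by (simp add: seg_union_def fin)
  have split: "seg_union A (seg_lo E (e - 1)) (seg_hi nb E e) = ?L e \<union> ?R e" if "e \<in> V" for e
  proof -
    have "e \<in> {1..<nb}" using that V E by blast
    then have "e < nb" "e - 1 < nb" by auto
    then have "seg_lo E (e - 1) \<le> e" "e \<le> seg_hi nb E e"
      using seg_props(1)[OF E, of "e - 1"] seg_props(2)[OF E, of e] by linarith+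
    then have "{seg_lo E (e - 1)..<seg_hi nb E e} = {seg_lo E (e - 1)..<e} \<union> {e..<seg_hi nb E e}" by auto
    then show ?thesis by (auto simp: seg_union_def)
  qed
  have ordL: "e \<le> seg_lo E (e' - 1)" and ordR: "seg_hi nb E e \<le> e'" if "e \<in> V" "e' \<in> V" "e < e'" for e e'
  proof -
    have "e \<in> {1..<nb}" "e' \<in> {1..<nb}" using that V E by blast+
    then have lt: "e < nb" "e' - 1 < nb" "e' \<le> nb" by auto
    have ee: "e \<in> E" "e' \<in> E" using that V by auto
    show "e \<le> seg_lo E (e' - 1)"
      using seg_props(6)[OF E lt(2) ee(1)] seg_props(2)[OF E lt(2)] that(3) by linarith
    show "seg_hi nb E e \<le> e'"
      using seg_props(6)[OF E lt(1) ee(2)] seg_props(1)[OF E lt(1)] that(3) by linarith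
  qed
  have dis: "seg_union A s t \<inter> seg_union A s' t' = {}" if "t \<le> s'" for s t s' t'
  proof (rule ccontr)
    assume "\<not> ?thesis"
    then obtain z y y' where "z \<in> A y" "y < t" "z \<in> A y'" "s' \<le> y'" by (auto simp: seg_union_def)
    then show False using disj[of y y'] that by auto
  qed
  have L: "(\<Sum>e\<in>V. card (?L e)) \<le> card Z"
  proof -
    have "(\<Sum>e\<in>V. card (?L e)) = card (\<Union>e\<in>V. ?L e)"
    proof (rule card_UN_disjoint[symmetric])
      show "\<forall>e\<in>V. \<forall>e'\<in>V. e \<noteq> e' \<longrightarrow> ?L e \<inter> ?L e' = {}"
      proof (intro ballI impI)
        fix e e' assume ee: "e \<in> V" "e' \<in> V" "e \<noteq> e'"
        show "?L e \<inter> ?L e' = {}"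
        proof (cases "e < e'")
          case True
          from dis[OF ordL[OF ee(1,2) True]] show ?thesis .
        next
          case False
          then have "e' < e" using ee by simp
          from dis[OF ordL[OF ee(2,1) this]] show ?thesis by (subst Int_commute)
        qed
      qed
    qed (use finV finS in auto)
    also have "\<dots> \<le> card Z" using sub split Z by (intro card_mono) auto
    finally show ?thesis .
  qed
  have R: "(\<Sum>e\<in>V. card (?R e)) \<le> card Z"
  proof -
    have "(\<Sum>e\<in>V. card (?R e)) = card (\<Union>e\<in>V. ?R e)"
    proof (rule card_UN_disjoint[symmetric])
      show "\<forall>e\<in>V. \<forall>e'\<in>V. e \<noteq> e' \<longrightarrow> ?R e \<inter> ?R e' = {}"
      proof (intro ballI impI)
        fix e e' assume ee: "e \<in> V" "e' \<in> V" "e \<noteq> e'"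
        show "?R e \<inter> ?R e' = {}"
        proof (cases "e < e'")
          case True
          from dis[OF ordR[OF ee(1,2) True]] show ?thesis .
        next
          case False
          then have "e' < e" using ee by simp
          from dis[OF ordR[OF ee(2,1) this]] show ?thesis by (subst Int_commute)
        qed
      qed
    qed (use finV finS in auto)
    also have "\<dots> \<le> card Z" using sub split Z by (intro card_mono) auto
    finally show ?thesis .
  qed
  have "B * card V \<le> (\<Sum>e\<in>V. card (?L e) + card (?R e))"
  proof -
    have "B \<le> card (?L e) + card (?R e)" if "e \<in> V" for e
      using big[OF that] split[OF that] card_Un_le[of "?L e" "?R e"] by simp
    then have "card V * B \<le> (\<Sum>e\<in>V. card (?L e) + card (?R e))"
      by (rule sum_bounded_below[of V B, simplified])
    then show ?thesis by (simp add: mult.commute)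
  qed
  then show ?thesis using L R by (simp add: sum.distrib)
qed

section \<open>Simulation of I/O computations\<close>

datatype 'a io = Ret 'a | Rd nat "int list \<Rightarrow> 'a io"

primrec io_bind :: "'a io \<Rightarrow> ('a \<Rightarrow> 'b io) \<Rightarrow> 'b io" where
  "io_bind (Ret x) f = f x"
| "io_bind (Rd j k) f = Rd j (\<lambda>b. io_bind (k b) f)"

primrec io_run :: "int list list \<Rightarrow> 'a io \<Rightarrow> 'a" where
  "io_run D (Ret x) = x"
| "io_run D (Rd j k) = io_run D (k (D ! j))"

primrec io_cost :: "int list list \<Rightarrow> 'a io \<Rightarrow> nat" where
  "io_cost D (Ret x) = 0"
| "io_cost D (Rd j k) = Suc (io_cost D (k (D ! j)))"

primrec io_safe :: "int list list \<Rightarrow> 'a io \<Rightarrow> bool" where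
  "io_safe D (Ret x) = True"
| "io_safe D (Rd j k) = (j < length D \<and> io_safe D (k (D ! j)))"

text \<open>A program cannot keep a continuation in its memory. It keeps the blocks read in the
  current round and replays the computation on them.\<close>

fun io_cont :: "'a io \<Rightarrow> int list list \<Rightarrow> 'a io" where
  "io_cont m [] = m"
| "io_cont (Rd j k) (b # bs) = io_cont (k b) bs"
| "io_cont (Ret x) (b # bs) = Ret x"

lemma io_run_bind [simp]: "io_run D (io_bind m f) = io_run D (f (io_run D m))"
  by (induction m) auto

lemma io_cost_bind [simp]: "io_cost D (io_bind m f) = io_cost D m + io_cost D (f (io_run D m))"
  by (induction m) auto

lemma io_safe_bind [simp]: "io_safe D (io_bind m f) \<longleftrightarrow> io_safe D m \<and> io_safe D (f (io_run D m))"
  by (induction m) auto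

lemma io_cont_snoc: "io_cont m h = Rd j k \<Longrightarrow> io_cont m (h @ [b]) = k b"
  by (induction m h rule: io_cont.induct) auto

section \<open>Encoding control states in memory words\<close>

lemma finite_words: "finite (words w)" by (simp add: words_def)

lemma card_words: "w \<ge> 1 \<Longrightarrow> card (words w) = 2 ^ w"
proof -
  assume "w \<ge> 1"
  then obtain v where "w = Suc v" by (cases w) auto
  then show ?thesis by (simp add: words_def nat_mult_distrib nat_power_eq)
qed

lemma card_lists_length_le_power:
  assumes "finite A" shows "card {xs. set xs \<subseteq> A \<and> length xs \<le> n} \<le> (card A + 1) ^ n"
proof -
  have "card {xs. set xs \<subseteq> A \<and> length xs \<le> n} = (\<Sum>i\<le>n. card A ^ i)"
    using assms by (rule card_lists_length_le)
  also have "\<dots> \<le> (card A + 1) ^ n"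
  proof (induction n)
    case (Suc n)
    have "card A ^ n \<le> (card A + 1) ^ n" by (rule power_mono) auto
    then have "card A * card A ^ n \<le> card A * (card A + 1) ^ n" by (rule mult_le_mono2)
    then have "(\<Sum>i\<le>n. card A ^ i) + card A * card A ^ n \<le> (card A + 1) ^ n + card A * (card A + 1) ^ n"
      using Suc by (rule add_mono[rotated])
    then show ?case by simp
  qed simp
  finally show ?thesis .
qed

lemma power_plus_one_le: "w \<ge> 1 \<Longrightarrow> (2::nat) ^ e + 1 \<le> 2 ^ (e + w)"
proof -
  assume "w \<ge> 1"
  have "(2::nat) ^ e + 1 \<le> 2 ^ e * 2" by (simp add: Suc_le_eq)
  also have "\<dots> = 2 ^ (e + 1)" by simp
  also have "\<dots> \<le> 2 ^ (e + w)" using \<open>w \<ge> 1\<close> by (intro power_increasing) auto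
  finally show ?thesis .
qed

lemma load_end: "length pre = p \<Longrightarrow> load p blk (pre @ rest) = pre @ blk @ drop (length blk) rest"
  by (simp add: load_def)

text \<open>
  A macro machine: in each round the state determines an I/O computation, which yields the output
  of the round and the next state. The control state of the simulating program is the macro state,
  the blocks read so far in the current round and the output that is still pending.
\<close>

type_synonym 's ctl = "bool \<times> 's option \<times> int list list \<times> int list"

locale macro_machine =
  fixes w B M r \<kappa> :: nat and Z :: "'s set" and rnd :: "'s \<Rightarrow> (int list \<times> 's option) io"
    and init :: "int \<Rightarrow> int \<Rightarrow> 's"
begin

definition blocks :: "int list set" where
  "blocks = {xs. set xs \<subseteq> words w \<and> length xs = B}"

definition ctls :: "'s ctl set" where
  "ctls = UNIV \<times> insert None (Some ` Z) \<times> {h. set h \<subseteq> blocks \<and> length h \<le> r}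
     \<times> {p. set p \<subseteq> words w \<and> length p \<le> B}"

definition enc :: "'s ctl \<Rightarrow> int list" where
  "enc = (SOME f. inj_on f ctls \<and> f ` ctls \<subseteq> {xs. set xs \<subseteq> words w \<and> length xs = \<kappa> * B})"

definition dec :: "int list \<Rightarrow> 's ctl" where
  "dec xs = inv_into ctls enc xs"

text \<open>Cell 0 is the output buffer. The -1 in cell 2 distinguishes every later memory from a
  fresh query memory, where this cell is 0. The area behind the code of the control state receives
  the blocks.\<close>

definition mem_of :: "int \<Rightarrow> 's ctl \<Rightarrow> int list" where
  "mem_of v q = [v, 0, -1] @ enc q @ replicate (M - 3 - \<kappa> * B) 0"

text \<open>A round whose last block has arrived is closed at once, its output becoming pending. As
  every round starts with a read, \<open>act\<close> then finds only rounds with a read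
  ahead.\<close>

definition norm_ctl :: "'s option \<Rightarrow> int list list \<Rightarrow> 's option \<times> int list list \<times> int list" where
  "norm_ctl so h = (case so of None \<Rightarrow> (None, [], []) | Some s \<Rightarrow>
     (case io_cont (rnd s) h of Ret x \<Rightarrow> (snd x, [], fst x) | Rd j k \<Rightarrow> (Some s, h, [])))"

definition act :: "'s option \<times> int list list \<times> int list \<Rightarrow> int list \<times> command" where
  "act = (\<lambda>(so, h, p). case p of
     v # vs \<Rightarrow> (mem_of v (False, so, h, vs), Report 0)
   | [] \<Rightarrow> (case so of None \<Rightarrow> (mem_of 0 (False, None, [], []), Halt)
       | Some s \<Rightarrow> (case io_cont (rnd s) h of
           Rd j k \<Rightarrow> (mem_of 0 (True, Some s, h, []), Read j (3 + \<kappa> * B))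
         | Ret x \<Rightarrow> (mem_of 0 (False, None, [], []), Halt))))"

definition view :: "int list \<Rightarrow> 's option \<times> int list list \<times> int list" where
  "view mem = (if mem ! 2 = 0 then (Some (init (mem ! 0) (mem ! 1)), [], []) else
     (case dec (take (\<kappa> * B) (drop 3 mem)) of (wt, so, h, p) \<Rightarrow>
       if wt then norm_ctl so (h @ [take B (drop (3 + \<kappa> * B) mem)]) else (so, h, p)))"

definition prog :: program where
  "prog mem = act (view mem)"

inductive reach :: "int list list \<Rightarrow> 's \<Rightarrow> int list \<Rightarrow> nat \<Rightarrow> 's \<Rightarrow> bool" for D where
  reach_refl: "s \<in> Z \<Longrightarrow> reach D s [] 0 s"
| reach_step: "s \<in> Z \<Longrightarrow> io_run D (rnd s) = (ob, Some s') \<Longrightarrow> set ob \<subseteq> words w \<Longrightarrow> length ob \<le> B \<Longrightarrow>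
    reach D s' out t s'' \<Longrightarrow> reach D s (ob @ out) (Suc t) s''"

lemma reach_trans:
  "reach D s out t s' \<Longrightarrow> reach D s' out' t' s'' \<Longrightarrow> reach D s (out @ out') (t + t') s''"
  by (induction rule: reach.induct) (auto intro: reach_step)

lemma reach_one:
  "s \<in> Z \<Longrightarrow> s' \<in> Z \<Longrightarrow> io_run D (rnd s) = (ob, Some s') \<Longrightarrow> set ob \<subseteq> words w \<Longrightarrow> length ob \<le> B \<Longrightarrow>
    reach D s ob 1 s'"
  using reach_step[OF _ _ _ _ reach_refl] by fastforce

context
  fixes D :: "int list list" and \<kappa>\<^sub>Z :: nat
  assumes w: "w \<ge> 1" and B: "B \<ge> 1" and M: "M \<ge> (\<kappa> + 4) * B" and Z: "finite Z" "card Z \<le> 2 ^ (\<kappa>\<^sub>Z * w)"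
    and \<kappa>: "\<kappa> \<ge> \<kappa>\<^sub>Z + 2 * r + 4"
    and D: "is_disk w B D"
    and rnd: "\<And>s. io_safe D (rnd s)" "\<And>s. io_cost D (rnd s) \<le> r" "\<And>s. \<exists>j k. rnd s = Rd j k"
begin

lemma finite_blocks: "finite blocks" "card blocks = 2 ^ (w * B)"
  using finite_lists_length_eq[OF finite_words, of w B] card_lists_length_eq[OF finite_words, of w B] card_words[OF w]
  unfolding blocks_def by (simp_all add: power_mult)

lemma ctls: "finite ctls" "card ctls \<le> 2 ^ (w * (\<kappa> * B))"
proof -
  let ?H = "{h. set h \<subseteq> blocks \<and> length h \<le> r}" and ?P = "{p. set p \<subseteq> words w \<and> length p \<le> B}"
  have finH: "finite ?H" and finP: "finite ?P"
    using finite_lists_length_le[OF finite_blocks(1)] finite_lists_length_le[OF finite_words] by auto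
  then show "finite ctls" using Z by (simp add: ctls_def finite_cartesian_product)
  have "card ?H \<le> (2 ^ (w * B) + 1) ^ r"
    using card_lists_length_le_power[OF finite_blocks(1), of r] finite_blocks(2) by simp
  also have "\<dots> \<le> (2 ^ (w * B + w)) ^ r" using power_plus_one_le[OF w] by (intro power_mono) auto
  also have "\<dots> \<le> (2 ^ (w * B + w * B)) ^ r" using B by (intro power_mono power_increasing) auto
  also have "\<dots> = 2 ^ (2 * r * (w * B))" by (simp add: algebra_simps flip: power_mult)
  finally have H: "card ?H \<le> 2 ^ (2 * r * (w * B))" .
  have "card ?P \<le> (2 ^ w + 1) ^ B"
    using card_lists_length_le_power[OF finite_words, of w B] card_words[OF w] by simp
  also have "\<dots> \<le> (2 ^ (w + w)) ^ B" using power_plus_one_le[OF w, of w] by (intro power_mono) auto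
  also have "\<dots> = 2 ^ (2 * (w * B))" by (simp add: algebra_simps flip: power_mult)
  finally have P: "card ?P \<le> 2 ^ (2 * (w * B))" .
  have "card (insert None (Some ` Z)) \<le> card Z + 1"
    using Z card_image_le[of Z Some] by (simp add: card_insert_if)
  also have "\<dots> \<le> 2 ^ (\<kappa>\<^sub>Z * w) + 1" using Z by simp
  also have "\<dots> \<le> 2 ^ (\<kappa>\<^sub>Z * w + w)" by (rule power_plus_one_le[OF w])
  also have "\<dots> \<le> 2 ^ ((\<kappa>\<^sub>Z + 1) * (w * B))"
  proof (rule power_increasing)
    have "\<kappa>\<^sub>Z * w + w = (\<kappa>\<^sub>Z + 1) * (w * 1)" by simp
    also have "\<dots> \<le> (\<kappa>\<^sub>Z + 1) * (w * B)" using B by (intro mult_le_mono2)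
    finally show "\<kappa>\<^sub>Z * w + w \<le> (\<kappa>\<^sub>Z + 1) * (w * B)" .
  qed simp
  finally have S: "card (insert None (Some ` Z)) \<le> 2 ^ ((\<kappa>\<^sub>Z + 1) * (w * B))" .
  have two: "(2::nat) \<le> 2 ^ (w * B)"
    using power_increasing[of 1 "w * B" "2::nat"] w B by simp
  have "card ctls = 2 * (card (insert None (Some ` Z)) * (card ?H * card ?P))"
    by (simp add: ctls_def card_cartesian_product)
  also have "\<dots> \<le> 2 ^ (w * B) * (2 ^ ((\<kappa>\<^sub>Z + 1) * (w * B)) * (2 ^ (2 * r * (w * B)) * 2 ^ (2 * (w * B))))"
    using H P S two by (intro mult_mono) auto
  also have "\<dots> = 2 ^ ((\<kappa>\<^sub>Z + 2 * r + 4) * (w * B))" by (simp add: algebra_simps flip: power_add)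
  also have "\<dots> \<le> 2 ^ (\<kappa> * (w * B))" using \<kappa> by (intro power_increasing mult_right_mono) auto
  finally show "card ctls \<le> 2 ^ (w * (\<kappa> * B))" by (simp add: ac_simps)
qed

lemma enc: "inj_on enc ctls" "q \<in> ctls \<Longrightarrow> set (enc q) \<subseteq> words w" "q \<in> ctls \<Longrightarrow> length (enc q) = \<kappa> * B"
proof -
  let ?W = "{xs. set xs \<subseteq> words w \<and> length xs = \<kappa> * B}"
  have "finite ?W" "card ?W = 2 ^ (w * (\<kappa> * B))"
    using finite_lists_length_eq[OF finite_words, of w "\<kappa> * B"] card_lists_length_eq[OF finite_words, of w "\<kappa> * B"]
      card_words[OF w] by (simp_all add: power_mult)
  then have "\<exists>f. inj_on f ctls \<and> f ` ctls \<subseteq> ?W"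
    using inj_on_iff_card_le[OF ctls(1), of ?W] ctls(2) by simp
  then have *: "inj_on enc ctls \<and> enc ` ctls \<subseteq> ?W" unfolding enc_def by (rule someI_ex)
  then show "inj_on enc ctls" by blast
  assume "q \<in> ctls"
  then have "enc q \<in> ?W" using * by blast
  then show "set (enc q) \<subseteq> words w" "length (enc q) = \<kappa> * B" by auto
qed

lemma dec_enc: "q \<in> ctls \<Longrightarrow> dec (enc q) = q"
  unfolding dec_def by (rule inv_into_f_f[OF enc(1)])

lemma zero_word: "0 \<in> words w" "-1 \<in> words w"
proof -
  have "(0::int) < 2 ^ (w - 1)" by simp
  then show "0 \<in> words w" "-1 \<in> words w" unfolding words_def atLeastLessThan_iff by linarith+
qed

lemma M3: "3 + \<kappa> * B + B \<le> M"
  using M B by (simp add: algebra_simps)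

lemma mem_of: "q \<in> ctls \<Longrightarrow> v \<in> words w \<Longrightarrow> is_memory w M (mem_of v q)"
  using enc(2,3)[of q] zero_word M3 by (auto simp: is_memory_def mem_of_def)

lemma view_mem_of: "(False, so, h, p) \<in> ctls \<Longrightarrow> view (mem_of v (False, so, h, p)) = (so, h, p)"
  using enc(3)[of "(False, so, h, p)"] dec_enc[of "(False, so, h, p)"]
  by (simp add: view_def mem_of_def)

lemma view_load:
  assumes "(True, so, h, p) \<in> ctls" "length blk = B"
  shows "view (load (3 + \<kappa> * B) blk (mem_of v (True, so, h, p))) = norm_ctl so (h @ [blk])"
proof -
  have len: "length ([v, 0, -1] @ enc (True, so, h, p)) = 3 + \<kappa> * B" using enc(3)[OF assms(1)] by simp
  have "load (3 + \<kappa> * B) blk (mem_of v (True, so, h, p)) =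
      ([v, 0, -1] @ enc (True, so, h, p)) @ blk @ drop (length blk) (replicate (M - 3 - \<kappa> * B) 0)"
    using load_end[OF len, of blk "replicate (M - 3 - \<kappa> * B) 0"] by (simp add: mem_of_def)
  then show ?thesis using enc(3)[OF assms(1)] dec_enc[OF assms(1)] assms(2) by (simp add: view_def numeral_3_eq_3)
qed

lemma exec_pending:
  assumes "\<And>mem. view mem = (so, h, []) \<Longrightarrow> exec w B M prog D mem out t"
    and "so \<in> insert None (Some ` Z)" "set h \<subseteq> blocks" "length h \<le> r" "set p \<subseteq> words w" "length p \<le> B"
    and "view mem = (so, h, p)"
  shows "exec w B M prog D mem (p @ out) t"
  using assms(5-)
proof (induction p arbitrary: mem)
  case (Cons v vs)
  have q: "(False, so, h, vs) \<in> ctls" using assms(2-4) Cons.prems by (auto simp: ctls_def)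
  have "prog mem = (mem_of v (False, so, h, vs), Report 0)" using Cons.prems by (simp add: prog_def act_def)
  moreover have "is_memory w M (mem_of v (False, so, h, vs))" using mem_of[OF q] Cons.prems by simp
  moreover have "exec w B M prog D (mem_of v (False, so, h, vs)) (vs @ out) t"
    using Cons view_mem_of[OF q] by simp
  moreover have "0 < M" using M3 by simp
  ultimately have "exec w B M prog D mem (mem_of v (False, so, h, vs) ! 0 # (vs @ out)) t"
    by (intro exec_Report)
  then show ?case by (simp add: mem_of_def)
qed (use assms(1) in simp)

lemma exec_halt: "view mem = (None, h, []) \<Longrightarrow> exec w B M prog D mem [] 0"
proof (rule exec_Halt)
  assume "view mem = (None, h, [])"
  then show "prog mem = (mem_of 0 (False, None, [], []), Halt)" by (simp add: prog_def act_def)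
  show "is_memory w M (mem_of 0 (False, None, [], []))" by (rule mem_of) (auto simp: ctls_def zero_word)
qed

lemma exec_round:
  assumes s: "s \<in> Z" and res: "io_run D (rnd s) = (ob, so')"
    and next': "\<And>mem. view mem = (so', [], ob) \<Longrightarrow> exec w B M prog D mem out t"
  shows "view mem = (Some s, [], []) \<Longrightarrow> exec w B M prog D mem out (t + io_cost D (rnd s))"
proof -
  \<comment> \<open>Generalized to the middle of a round: h are the blocks already read and m is the
    rest of the computation.\<close>
  have main: "exec w B M prog D mem out (t + io_cost D m)"
    if "io_cont (rnd s) h = m" "\<exists>j k. m = Rd j k" "io_safe D m" "length h + io_cost D m \<le> r" "set h \<subseteq> blocks"
      "io_run D m = (ob, so')" "view mem = (Some s, h, [])" for m h mem
    using that
  proof (induction m arbitrary: h mem)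
    case (Rd j k)
    let ?q = "(True, Some s, h, [])"
    have jD: "j < length D" using Rd.prems by simp
    have blk: "D ! j \<in> blocks" using D jD by (auto simp: is_disk_def blocks_def)
    then have lenb: "length (D ! j) = B" by (simp add: blocks_def)
    have q: "?q \<in> ctls" using s Rd.prems by (auto simp: ctls_def)
    let ?m' = "k (D ! j)" and ?mem' = "load (3 + \<kappa> * B) (D ! j) (mem_of 0 ?q)"
    have cont: "io_cont (rnd s) (h @ [D ! j]) = ?m'" using Rd.prems(1) by (rule io_cont_snoc)
    have view': "view ?mem' = norm_ctl (Some s) (h @ [D ! j])" by (rule view_load[OF q lenb])
    have "exec w B M prog D ?mem' out (t + io_cost D ?m')"
    proof (cases ?m')
      case (Ret x)
      then have "norm_ctl (Some s) (h @ [D ! j]) = (so', [], ob)"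
        using cont Rd.prems(6) by (simp add: norm_ctl_def)
      then show ?thesis using next' view' Ret by simp
    next
      case m': (Rd j' k')
      then have "norm_ctl (Some s) (h @ [D ! j]) = (Some s, h @ [D ! j], [])"
        using cont by (simp add: norm_ctl_def)
      moreover have mr: "k (D ! j) \<in> range k" by blast
      ultimately show ?thesis
        using Rd.IH[OF mr, of "h @ [D ! j]" ?mem'] Rd.prems cont view' m' blk by simp
    qed
    moreover have "prog mem = (mem_of 0 ?q, Read j (3 + \<kappa> * B))"
      using Rd.prems by (simp add: prog_def act_def)
    moreover have "is_memory w M (mem_of 0 ?q)" using mem_of[OF q] zero_word by simp
    ultimately have "exec w B M prog D mem out (Suc (t + io_cost D ?m'))"
      using M3 jD by (intro exec_Read[of prog mem "mem_of 0 ?q" j "3 + \<kappa> * B"]) auto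
    then show ?case by simp
  qed simp
  show "view mem = (Some s, [], []) \<Longrightarrow> exec w B M prog D mem out (t + io_cost D (rnd s))"
    using main[of "[]" "rnd s" mem] rnd[of s] res by simp
qed

text \<open>\<open>reach\<close> counts t rounds; the one that yields \<open>None\<close> is the
  additional round in t + 1.\<close>

lemma exec_reach:
  assumes "reach D s out t s'" "s' \<in> Z" "io_run D (rnd s') = (ob, None)" "set ob \<subseteq> words w" "length ob \<le> B"
  shows "\<exists>t'. t' \<le> r * (t + 1) \<and> (\<forall>mem. view mem = (Some s, [], []) \<longrightarrow> exec w B M prog D mem (out @ ob) t')"
  using assms
proof (induction rule: reach.induct)
  case (reach_refl s)
  have pend: "exec w B M prog D mem ob 0" if "view mem = (None, [], ob)" for mem
    using exec_pending[of None "[]" "[]" 0 ob mem] exec_halt reach_refl that by simp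
  have "exec w B M prog D mem ob (0 + io_cost D (rnd s))" if v: "view mem = (Some s, [], [])" for mem
    by (rule exec_round[OF reach_refl(1) reach_refl(3) _ v]) (erule pend)
  then show ?case using rnd(2)[of s] by auto
next
  case (reach_step s ob' s1 out t s2)
  then obtain t' where t': "t' \<le> r * (t + 1)"
    "\<forall>mem. view mem = (Some s1, [], []) \<longrightarrow> exec w B M prog D mem (out @ ob) t'" by auto
  have s1: "s1 \<in> Z" using reach_step.hyps(5) by (cases rule: reach.cases) auto
  have pend: "exec w B M prog D mem (ob' @ (out @ ob)) t'" if "view mem = (Some s1, [], ob')" for mem
    by (rule exec_pending[of "Some s1" "[]"]) (use reach_step.hyps t'(2) that s1 in auto)
  have "exec w B M prog D mem (ob' @ out @ ob) (t' + io_cost D (rnd s))" if "view mem = (Some s, [], [])" for mem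
    by (rule exec_round[OF reach_step.hyps(1,2) _ that]) (erule pend)
  moreover have "t' + io_cost D (rnd s) \<le> r * (Suc t + 1)" using t'(1) rnd(2)[of s] by simp
  ultimately show ?case by auto
qed

lemma exec_query:
  assumes "reach D (init a b) out t s'" "s' \<in> Z" "io_run D (rnd s') = (ob, None)" "set ob \<subseteq> words w" "length ob \<le> B"
  shows "\<exists>t'. t' \<le> r * (t + 1) \<and> exec w B M prog D (query_memory M a b) (out @ ob) t'"
proof -
  have "3 \<le> M" using M3 by simp
  then obtain n where "M = 3 + n" using le_Suc_ex by blast
  then have "M - 2 = Suc n" by simp
  then have "query_memory M a b ! 2 = 0" by (simp add: query_memory_def)
  then have "view (query_memory M a b) = (Some (init a b), [], [])"
    by (simp add: view_def query_memory_def)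
  then show ?thesis using exec_reach[OF assms] by auto
qed

end

end

section \<open>Arrays of items on the disk\<close>

primrec read_blocks :: "nat \<Rightarrow> nat \<Rightarrow> int list list io" where
  "read_blocks j 0 = Ret []"
| "read_blocks j (Suc n) = Rd j (\<lambda>b. io_bind (read_blocks (Suc j) n) (\<lambda>bs. Ret (b # bs)))"

lemma read_blocks: "io_run D (read_blocks j n) = map (\<lambda>i. D ! i) [j..<j + n]"
  "io_cost D (read_blocks j n) = n" "j + n \<le> length D \<Longrightarrow> io_safe D (read_blocks j n)"
proof -
  show "io_run D (read_blocks j n) = map (\<lambda>i. D ! i) [j..<j + n]"
  proof (induction n arbitrary: j)
    case (Suc n)
    have "[j..<j + Suc n] = j # [Suc j..<Suc j + n]" by (simp add: upt_conv_Cons del: upt_Suc)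
    then show ?case using Suc by (simp del: upt_Suc)
  qed simp
  show "io_cost D (read_blocks j n) = n" by (induction n arbitrary: j) simp_all
  show "j + n \<le> length D \<Longrightarrow> io_safe D (read_blocks j n)" by (induction n arbitrary: j) simp_all
qed

lemma concat_chunks: "length xs = n * m \<Longrightarrow> concat (map (\<lambda>q. take m (drop (q * m) xs)) [0..<n]) = xs"
proof (induction n arbitrary: xs)
  case (Suc n)
  have "concat (map (\<lambda>q. take m (drop (q * m) xs)) [0..<n]) = concat (map (\<lambda>q. take m (drop (q * m) (take (n * m) xs))) [0..<n])"
  proof (intro arg_cong[of _ _ concat] map_cong refl)
    fix q assume "q \<in> set [0..<n]"
    then have "q * m + m \<le> n * m" by (metis Suc_leI add.commute atLeast0LessThan lessThan_iff mult_Suc mult_le_mono1 set_upt)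
    then show "take m (drop (q * m) xs) = take m (drop (q * m) (take (n * m) xs))"
      by (simp add: drop_take min_def)
  qed
  also have "\<dots> = take (n * m) xs" using Suc by simp
  finally show ?case using Suc.prems by simp
qed simp

lemma take_drop_concat:
  fixes f :: "nat \<Rightarrow> 'a list"
  assumes "\<And>x. x < n \<Longrightarrow> length (f x) = m" "q < n"
  shows "take m (drop (q * m) (concat (map f [0..<n]))) = f q"
proof -
  have len: "length (concat (map f [0..<k])) = k * m" if "k \<le> n" for k
    using that assms(1) by (induction k) (auto simp: length_concat)
  have "[0..<n] = [0..<q] @ [q..<n]" using assms(2) upt_add_eq_append[of 0 q "n - q"] by simp
  then have "[0..<n] = [0..<q] @ q # [Suc q..<n]" using assms(2) by (simp add: upt_conv_Cons)
  then have "concat (map f [0..<n]) = concat (map f [0..<q]) @ f q @ concat (map f [Suc q..<n])" by simp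
  then show ?thesis using len[of q] assms by simp
qed

text \<open>
  Disk layout: an item occupies \<open>K\<close> words, and a superblock of \<open>K\<close> disk blocks holds \<open>B\<close> items.
  Superblock \<open>0\<close> contains the common length \<open>\<Lambda>\<close> (in superblocks) of the \<open>ar\<close> arrays, whose superblocks
  are interleaved after it. Reads beyond \<open>\<Lambda>\<close> yield empty items without touching the disk.
\<close>

locale item_disk =
  fixes w B K ar :: nat and items :: "nat list set"
begin

definition enc_item :: "nat list \<Rightarrow> int list" where
  "enc_item = (SOME f. inj_on f items \<and> f ` items \<subseteq> {xs. set xs \<subseteq> words w \<and> length xs = K})"

definition dec_item :: "int list \<Rightarrow> nat list" where
  "dec_item xs = inv_into items enc_item xs"

definition get_super :: "nat \<Rightarrow> nat list list io" where
  "get_super s = io_bind (read_blocks (s * K) K)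
     (\<lambda>bs. Ret (map (\<lambda>q. dec_item (take K (drop (q * K) (concat bs)))) [0..<B]))"

definition get_block :: "nat \<Rightarrow> nat \<Rightarrow> nat list list io" where
  "get_block i j = io_bind (get_super 0) (\<lambda>h. if i < ar \<and> j < hd (h ! 0)
     then get_super (Suc (j * ar + i)) else Ret (replicate B []))"

definition get :: "nat \<Rightarrow> nat \<Rightarrow> nat list io" where
  "get i n = io_bind (get_block i (n div B)) (\<lambda>blk. Ret (blk ! (n mod B)))"

definition super :: "(nat \<Rightarrow> nat \<Rightarrow> nat list) \<Rightarrow> nat \<Rightarrow> nat \<Rightarrow> nat \<Rightarrow> nat list" where
  "super Y \<Lambda> s q = (if s = 0 then (if q = 0 then [\<Lambda>] else [])
     else Y ((s - 1) mod ar) ((s - 1) div ar * B + q))"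

definition flat :: "(nat \<Rightarrow> nat \<Rightarrow> nat list) \<Rightarrow> nat \<Rightarrow> nat \<Rightarrow> int list" where
  "flat Y \<Lambda> s = concat (map (\<lambda>q. enc_item (super Y \<Lambda> s q)) [0..<B])"

definition disk :: "(nat \<Rightarrow> nat \<Rightarrow> nat list) \<Rightarrow> nat \<Rightarrow> int list list" where
  "disk Y \<Lambda> = map (\<lambda>j. take B (drop (j mod K * B) (flat Y \<Lambda> (j div K)))) [0..<K * Suc (\<Lambda> * ar)]"

context
  fixes Y :: "nat \<Rightarrow> nat \<Rightarrow> nat list" and \<Lambda> :: nat
  assumes w: "w \<ge> 1" and B: "B \<ge> 1" and K: "K \<ge> 1" and ar: "ar \<ge> 1"
    and items: "finite items" "card items \<le> 2 ^ (w * K)" "[] \<in> items" "[\<Lambda>] \<in> items"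
    and Y: "\<And>i n. Y i n \<in> items" "\<And>i n. n \<ge> \<Lambda> * B \<Longrightarrow> Y i n = []"
begin

lemma enc_item: "inj_on enc_item items" "x \<in> items \<Longrightarrow> set (enc_item x) \<subseteq> words w" "x \<in> items \<Longrightarrow> length (enc_item x) = K"
proof -
  let ?W = "{xs. set xs \<subseteq> words w \<and> length xs = K}"
  have "finite ?W" "card ?W = 2 ^ (w * K)"
    using finite_lists_length_eq[OF finite_words, of w K] card_lists_length_eq[OF finite_words, of w K]
      card_words[OF w] by (simp_all add: power_mult)
  then have "\<exists>f. inj_on f items \<and> f ` items \<subseteq> ?W"
    using inj_on_iff_card_le[OF items(1), of ?W] items(2) by simp
  then have *: "inj_on enc_item items \<and> enc_item ` items \<subseteq> ?W" unfolding enc_item_def by (rule someI_ex)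
  then show "inj_on enc_item items" by blast
  assume "x \<in> items"
  then have "enc_item x \<in> ?W" using * by blast
  then show "set (enc_item x) \<subseteq> words w" "length (enc_item x) = K" by auto
qed

lemma dec_enc_item: "x \<in> items \<Longrightarrow> dec_item (enc_item x) = x"
  unfolding dec_item_def by (rule inv_into_f_f[OF enc_item(1)])

lemma super_items: "super Y \<Lambda> s q \<in> items"
  using Y(1) items(3,4) by (simp add: super_def)

lemma length_flat: "length (flat Y \<Lambda> s) = K * B"
proof -
  have "length (concat (map (\<lambda>q. enc_item (super Y \<Lambda> s q)) [0..<n])) = K * n" for n
    by (induction n) (simp_all add: enc_item(3)[OF super_items])
  then show ?thesis by (simp add: flat_def)
qed

lemma set_flat: "set (flat Y \<Lambda> s) \<subseteq> words w"
  using enc_item(2)[OF super_items] by (auto simp: flat_def)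

lemma is_disk_disk: "is_disk w B (disk Y \<Lambda>)"
proof -
  have "B \<le> K * B - j mod K * B" for j
    using mult_le_mono1[OF Suc_leI[OF mod_less_divisor[of K j]], of B] K by simp
  then have "length (take B (drop (j mod K * B) (flat Y \<Lambda> s))) = B" for j s
    by (simp add: length_flat min_absorb2)
  moreover have "set (take B (drop (j mod K * B) (flat Y \<Lambda> s))) \<subseteq> words w" for j s
    using set_flat[of s] by (meson set_drop_subset set_take_subset subset_trans)
  ultimately show ?thesis by (auto simp: is_disk_def disk_def)
qed

lemma length_disk: "length (disk Y \<Lambda>) = K * Suc (\<Lambda> * ar)"
  by (simp add: disk_def)

lemma get_super:
  assumes s: "s < Suc (\<Lambda> * ar)"
  shows "io_run (disk Y \<Lambda>) (get_super s) = map (super Y \<Lambda> s) [0..<B]" "io_cost (disk Y \<Lambda>) (get_super s) = K"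
    "io_safe (disk Y \<Lambda>) (get_super s)"
proof -
  have le: "s * K + K \<le> K * Suc (\<Lambda> * ar)"
    using mult_le_mono1[OF Suc_leI[OF s], of K] by (simp add: mult.commute)
  have "map (\<lambda>i. disk Y \<Lambda> ! i) [s * K..<s * K + K] = map (\<lambda>q. disk Y \<Lambda> ! (s * K + q)) [0..<K]"
    by (rule nth_equalityI) auto
  also have "\<dots> = map (\<lambda>q. take B (drop (q * B) (flat Y \<Lambda> s))) [0..<K]"
  proof (rule map_cong[OF refl])
    fix q assume "q \<in> set [0..<K]"
    then have q: "q < K" by simp
    then have "s * K + q < K * Suc (\<Lambda> * ar)" using le by linarith
    then show "disk Y \<Lambda> ! (s * K + q) = take B (drop (q * B) (flat Y \<Lambda> s))"
      using q by (simp add: disk_def)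
  qed
  finally have "concat (map (\<lambda>i. disk Y \<Lambda> ! i) [s * K..<s * K + K]) = flat Y \<Lambda> s"
    using concat_chunks[OF length_flat] by simp
  then have "io_run (disk Y \<Lambda>) (get_super s) = map (\<lambda>q. dec_item (take K (drop (q * K) (flat Y \<Lambda> s)))) [0..<B]"
    by (simp add: get_super_def read_blocks)
  also have "\<dots> = map (super Y \<Lambda> s) [0..<B]"
    by (rule map_cong[OF refl])
      (simp add: flat_def take_drop_concat enc_item(3)[OF super_items] dec_enc_item[OF super_items])
  finally show "io_run (disk Y \<Lambda>) (get_super s) = map (super Y \<Lambda> s) [0..<B]" .
  show "io_cost (disk Y \<Lambda>) (get_super s) = K" by (simp add: get_super_def read_blocks)
  show "io_safe (disk Y \<Lambda>) (get_super s)" using le by (simp add: get_super_def read_blocks length_disk)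
qed

lemma header: "io_run (disk Y \<Lambda>) (get_super 0) ! 0 = [\<Lambda>]"
  using B by (simp add: get_super super_def)

lemma super_bound: "i < ar \<Longrightarrow> j < \<Lambda> \<Longrightarrow> Suc (j * ar + i) < Suc (\<Lambda> * ar)"
  using mult_le_mono1[of "Suc j" \<Lambda> ar] by simp

lemma run_get_block: "i < ar \<Longrightarrow> io_run (disk Y \<Lambda>) (get_block i j) = map (\<lambda>q. Y i (j * B + q)) [0..<B]"
proof (cases "j < \<Lambda>")
  case True
  assume "i < ar"
  then show ?thesis using True super_bound[of i j] header by (simp add: get_block_def get_super super_def)
next
  case False
  then have "\<Lambda> * B \<le> j * B + q" for q using mult_le_mono1[of \<Lambda> j B] by linarith
  then show ?thesis using False header by (simp add: get_block_def Y(2) map_replicate_const)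
qed

text \<open>One superblock for the header, which is read anew on each access, and one for the
  data.\<close>

lemma get_block_safe: "io_safe (disk Y \<Lambda>) (get_block i j)" "io_cost (disk Y \<Lambda>) (get_block i j) \<le> 2 * K"
  using header super_bound[of i j] get_super(2,3)[of 0] get_super(2,3)[of "Suc (j * ar + i)"]
  by (simp_all add: get_block_def)

lemma get_block_Rd: "\<exists>j' k. get_block i j = Rd j' k"
proof -
  obtain K' where "K = Suc K'" using K by (cases K) auto
  then have "\<exists>k. read_blocks 0 K = Rd 0 k" by simp
  then show ?thesis by (auto simp: get_block_def get_super_def)
qed

lemma run_get: "i < ar \<Longrightarrow> io_run (disk Y \<Lambda>) (get i n) = Y i n"
  using B by (simp add: get_def run_get_block)

lemma get_safe: "io_safe (disk Y \<Lambda>) (get i n)" "io_cost (disk Y \<Lambda>) (get i n) \<le> 2 * K"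
  using get_block_safe by (simp_all add: get_def)

lemma get_Rd: "\<exists>j' k. get i n = Rd j' k"
  using get_block_Rd[of i "n div B"] by (auto simp: get_def)

end

end

section \<open>The query program\<close>

text \<open>
  \<open>fan w\<close> is a power of two of order \<open>\<surd>w\<close>. A window consists of \<open>2 * nblk w\<close> blocks and
  starts at a multiple of \<open>gsz w B\<close>.
\<close>

definition fan :: "nat \<Rightarrow> nat" where "fan w = 2 ^ lev w"
definition nblk :: "nat \<Rightarrow> nat" where "nblk w = fan w * fan w"
definition gsz :: "nat \<Rightarrow> nat \<Rightarrow> nat" where "gsz w B = nblk w * B"

text \<open>
  The three kinds of array entries are short lists of \<open>O(w)\<close>-bit numbers, sketches, and bit vectors over the
  blocks of a window; each of them fits into \<open>O(w)\<close> bits.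
\<close>

definition items :: "nat \<Rightarrow> nat list set" where
  "items w = {xs. set xs \<subseteq> {..<2 ^ (2000 * w)} \<and> length xs \<le> 8} \<union>
     {xs. set xs \<subseteq> {..w} \<and> length xs \<le> 2 * fan w} \<union> {xs. set xs \<subseteq> {..<4} \<and> length xs \<le> 2 * w}"

definition states :: "nat \<Rightarrow> nat list set" where
  "states w = {xs. set xs \<subseteq> {..<2 ^ (4 * w)} \<and> length xs \<le> 8}"

lemma fan_bounds: assumes "w \<ge> 1" shows "fan w \<ge> 1" "nblk w \<ge> 1" "nblk w \<le> w" "w < 4 * nblk w"
proof -
  have "nblk w = 4 ^ lev w" unfolding nblk_def fan_def by (simp flip: power_mult_distrib)
  then show "nblk w \<le> w" "w < 4 * nblk w" "nblk w \<ge> 1" using lev_bounds[OF assms] by simp_all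
qed (simp add: fan_def)

text \<open>The short lists dominate with 8 * 2001 w = 16008 w bits. Sketches fit because they hold
  O(sqrt w) heights of O(log w) bits each.\<close>

lemma items_card: assumes w: "w \<ge> 1" shows "finite (items w)" "card (items w) \<le> 2 ^ (w * 17000)"
proof -
  let ?A = "{xs. set xs \<subseteq> {..<(2::nat) ^ (2000 * w)} \<and> length xs \<le> 8}"
  let ?B = "{xs. set xs \<subseteq> {..w} \<and> length xs \<le> 2 * fan w}"
  let ?C = "{xs. set xs \<subseteq> {..<4::nat} \<and> length xs \<le> 2 * w}"
  have fin: "finite ?A" "finite ?B" "finite ?C" by (rule finite_lists_length_le, simp)+
  then show "finite (items w)" by (simp add: items_def)
  have "card ?A \<le> (2 ^ (2000 * w) + 1) ^ 8" using card_lists_length_le_power[of "{..<(2::nat) ^ (2000 * w)}" 8] by simp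
  also have "\<dots> \<le> (2 ^ (2000 * w + w)) ^ 8" by (rule power_mono[OF power_plus_one_le[OF w]]) simp
  also have "\<dots> = 2 ^ (16008 * w)" by (simp flip: power_mult)
  finally have A: "card ?A \<le> 2 ^ (16008 * w)" .
  have "card ?B \<le> (w + 2) ^ (2 * fan w)" using card_lists_length_le_power[of "{..w}" "2 * fan w"] by simp
  also have "\<dots> \<le> (2 ^ (2 * lev w + 3)) ^ (2 * fan w)"
  proof (rule power_mono)
    have "(2::nat) ^ (2 * lev w + 3) = 8 * 4 ^ lev w" by (simp add: power_add power_mult)
    then show "w + 2 \<le> 2 ^ (2 * lev w + 3)" using lev_bounds[OF w] zero_less_power[of "4::nat" "lev w"] by simp
  qed simp
  also have "\<dots> = 2 ^ ((2 * lev w + 3) * (2 * fan w))" by (simp only: power_mult)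
  also have "\<dots> \<le> 2 ^ (16008 * w)"
  proof (rule power_increasing)
    have "lev w + 1 \<le> fan w" unfolding fan_def by (metis Suc_eq_plus1 Suc_leI less_exp)
    then have "2 * lev w + 3 \<le> 3 * fan w" by simp
    then have "(2 * lev w + 3) * (2 * fan w) \<le> (3 * fan w) * (2 * fan w)" by (rule mult_le_mono1)
    also have "\<dots> = 6 * nblk w" by (simp add: nblk_def)
    also have "\<dots> \<le> 16008 * w" using fan_bounds(3)[OF w] by simp
    finally show "(2 * lev w + 3) * (2 * fan w) \<le> 16008 * w" .
  qed simp
  finally have B: "card ?B \<le> 2 ^ (16008 * w)" .
  have "card ?C \<le> 5 ^ (2 * w)" using card_lists_length_le_power[of "{..<4::nat}" "2 * w"] by simp
  also have "\<dots> \<le> 8 ^ (2 * w)" by (rule power_mono) auto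
  also have "\<dots> = 2 ^ (6 * w)" by (simp add: power_mult)
  also have "\<dots> \<le> 2 ^ (16008 * w)" by (rule power_increasing) auto
  finally have C: "card ?C \<le> 2 ^ (16008 * w)" .
  have "card (items w) \<le> card ?A + card ?B + card ?C"
    unfolding items_def using card_Un_le[of "?A \<union> ?B" ?C] card_Un_le[of ?A ?B] by linarith
  also have "\<dots> \<le> 4 * 2 ^ (16008 * w)" using A B C by linarith
  also have "\<dots> = 2 ^ (16008 * w + 2)" by (simp add: power_add)
  also have "\<dots> \<le> 2 ^ (w * 17000)" using w by (intro power_increasing) auto
  finally show "card (items w) \<le> 2 ^ (w * 17000)" .
qed

lemma states_card: assumes w: "w \<ge> 1" shows "finite (states w)" "card (states w) \<le> 2 ^ (40 * w)"
proof -
  show "finite (states w)" unfolding states_def by (rule finite_lists_length_le) simp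
  have "card (states w) \<le> (2 ^ (4 * w) + 1) ^ 8"
    unfolding states_def using card_lists_length_le_power[of "{..<(2::nat) ^ (4 * w)}" 8] by simp
  also have "\<dots> \<le> (2 ^ (4 * w + w)) ^ 8" by (rule power_mono[OF power_plus_one_le[OF w]]) simp
  also have "\<dots> = 2 ^ (40 * w)" by (simp flip: power_mult)
  finally show "card (states w) \<le> 2 ^ (40 * w)" .
qed

definition gb :: "nat \<Rightarrow> nat \<Rightarrow> nat \<Rightarrow> nat \<Rightarrow> nat list list io" where
  "gb w B = item_disk.get_block w B 17000 11 (items w)"

definition gt :: "nat \<Rightarrow> nat \<Rightarrow> nat \<Rightarrow> nat \<Rightarrow> nat list io" where
  "gt w B = item_disk.get w B 17000 11 (items w)"

definition mkdisk :: "nat \<Rightarrow> nat \<Rightarrow> (nat \<Rightarrow> nat \<Rightarrow> nat list) \<Rightarrow> nat \<Rightarrow> int list list" where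
  "mkdisk w B = item_disk.disk w B 17000 11 (items w)"

text \<open>Words are shifted to natural numbers below \<open>2 ^ w\<close>; \<open>oc\<close> undoes this for colours.\<close>

definition oc :: "nat \<Rightarrow> nat \<Rightarrow> int" where
  "oc w k = int k - 2 ^ (w - 1)"

text \<open>An entry consists of a value, the shifted predecessor value and a colour; the empty item
  is padding.\<close>

definition passes :: "nat \<Rightarrow> nat \<Rightarrow> nat list \<Rightarrow> bool" where
  "passes a b x \<longleftrightarrow> x \<noteq> [] \<and> a \<le> x ! 0 \<and> x ! 0 \<le> b \<and> x ! 1 \<le> a"

definition outs :: "nat \<Rightarrow> nat \<Rightarrow> nat \<Rightarrow> nat list list \<Rightarrow> int list" where
  "outs w a b blk = map (\<lambda>x. oc w (x ! 2)) (filter (passes a b) blk)"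

definition fusion :: "nat \<Rightarrow> nat \<Rightarrow> nat \<Rightarrow> nat \<Rightarrow> nat \<Rightarrow> nat \<Rightarrow> nat io" where
  "fusion w B idx base stride q = io_bind (gt w B 6 idx) (\<lambda>ds.
     io_bind (gt w B 1 (base + cand ds q * stride)) (\<lambda>x. Ret (rank_from ds q (x ! 0))))"

text \<open>The number of blocks of the window whose first element is at most a. The blocks form
  groups of \<open>fan w\<close>. Node 0 of a window searches the group leaders, and node u searches
  the leaders in group u - 1.\<close>

definition window_rank :: "nat \<Rightarrow> nat \<Rightarrow> nat \<Rightarrow> nat \<Rightarrow> nat io" where
  "window_rank w B c a = io_bind (fusion w B (c * (2 * fan w + 1)) (c * gsz w B) (fan w * B) a) (\<lambda>u.
     if u = 0 then Ret 0 else
     io_bind (fusion w B (c * (2 * fan w + 1) + u) (c * gsz w B + (u - 1) * fan w * B) B a) (\<lambda>v.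
       Ret ((u - 1) * fan w + v)))"

text \<open>Let i be the number of block leaders up to a. Elements from a on lie in block i - 1 or
  from leader i on; that leader exceeds a, so only b remains to be tested there.\<close>

definition meets :: "nat \<Rightarrow> nat \<Rightarrow> nat \<Rightarrow> nat \<Rightarrow> nat \<Rightarrow> nat \<Rightarrow> bool io" where
  "meets w B a b c i = io_bind (gb w B 1 (c * nblk w + (i - 1))) (\<lambda>blk.
     io_bind (gt w B 1 (c * gsz w B + i * B)) (\<lambda>x.
       Ret ((0 < i \<and> (\<exists>y\<in>set blk. y \<noteq> [] \<and> a \<le> y ! 0 \<and> y ! 0 \<le> b)) \<or>
            (i < 2 * nblk w \<and> x \<noteq> [] \<and> x ! 0 \<le> b))))"

text \<open>The tables return garbage for nodes that are not keys. A candidate window is therefore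
  accepted only after it has been checked to meet the range.\<close>

definition try_window :: "nat \<Rightarrow> nat \<Rightarrow> nat \<Rightarrow> nat \<Rightarrow> nat \<Rightarrow> nat \<Rightarrow> (nat \<times> nat) option io" where
  "try_window w B N a b c = (if c * gsz w B < N then io_bind (window_rank w B c a) (\<lambda>i.
     io_bind (meets w B a b c i) (\<lambda>m. Ret (if m then Some (c, i) else None))) else Ret None)"

definition try_node :: "nat \<Rightarrow> nat \<Rightarrow> nat list \<Rightarrow> nat \<Rightarrow> nat \<Rightarrow> nat \<times> nat \<Rightarrow> (nat \<times> nat) option io" where
  "try_node w B hdr a b k = io_bind (gt w B 9 (hsh w (hdr ! 0) (hdr ! 2) k)) (\<lambda>x.
     io_bind (gt w B 10 (x ! 0 + rtv w (x ! 1) k)) (\<lambda>z. try_window w B (hdr ! 0) a b (z ! 0)))"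

text \<open>The first table only supplies a height. The ancestor at that height is computed from a
  and then looked up in the second table.\<close>

definition try_via :: "nat \<Rightarrow> nat \<Rightarrow> nat list \<Rightarrow> nat \<Rightarrow> nat \<Rightarrow> nat \<times> nat \<Rightarrow> (nat \<times> nat) option io" where
  "try_via w B hdr a b k = io_bind (gt w B 8 (hsh w (hdr ! 0) (hdr ! 1) k)) (\<lambda>x.
     let d = rtv w (x ! 0) k; h = hgt a b in try_node w B hdr a b (d, a div 2 ^ h div 2 ^ (d - h)))"

definition or_else :: "'a option io \<Rightarrow> 'a option io \<Rightarrow> 'a option io" where
  "or_else m m' = io_bind m (\<lambda>r. case r of None \<Rightarrow> m' | Some x \<Rightarrow> Ret (Some x))"

definition locate_io :: "nat \<Rightarrow> nat \<Rightarrow> nat list \<Rightarrow> nat \<Rightarrow> nat \<Rightarrow> (nat \<times> nat) option io" where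
  "locate_io w B hdr a b = (if a \<le> b \<and> 0 < hdr ! 0 then
     let h = hgt a b; y = a div 2 ^ h; h' = fan w * ((h + fan w - 1) div fan w) in
       or_else (try_node w B hdr a b (h, y)) (or_else (try_via w B hdr a b (h, y))
         (try_via w B hdr a b (h', y div 2 ^ (h' - h)))) else Ret None)"

definition topl :: "nat \<Rightarrow> nat \<Rightarrow> nat \<Rightarrow> nat" where
  "topl w B N = (LEAST l. N \<le> 2 ^ l * gsz w B)"

text \<open>The lists are sorted, so the last of the \<open>gsz w B\<close> places alone tells
  whether a list overflows with elements of the range.\<close>

definition start_rnd :: "nat \<Rightarrow> nat \<Rightarrow> nat list \<Rightarrow> nat \<Rightarrow> nat \<Rightarrow> (int list \<times> nat list option) io" where
  "start_rnd w B hdr a b = io_bind (locate_io w B hdr a b) (\<lambda>res. case res of None \<Rightarrow> Ret ([], None)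
     | Some (c, i) \<Rightarrow> io_bind (gt w B 2 (c * gsz w B + (gsz w B - 1))) (\<lambda>x.
         io_bind (gt w B 3 (c * gsz w B + (gsz w B - 1))) (\<lambda>y.
           if (x \<noteq> [] \<and> a \<le> x ! 0) \<or> (y \<noteq> [] \<and> y ! 0 \<le> b)
           then Ret ([], Some [4, a, b, topl w B (hdr ! 0), 0]) else Ret ([], Some [1, a, b, c, i, 0]))))"

text \<open>P holds on a prefix of the list, so the first entry of block j decides whether the scan
  goes on; the bound on j keeps it within one list.\<close>

definition scan_rnd :: "nat \<Rightarrow> nat \<Rightarrow> nat \<Rightarrow> nat \<Rightarrow> nat \<Rightarrow> nat \<Rightarrow> nat \<Rightarrow> (nat list \<Rightarrow> bool) \<Rightarrow>
    nat list \<Rightarrow> nat list option \<Rightarrow> (int list \<times> nat list option) io" where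
  "scan_rnd w B a b i c j P s s' = io_bind (gb w B i (c * nblk w + j)) (\<lambda>blk.
     if j < nblk w \<and> blk ! 0 \<noteq> [] \<and> P (blk ! 0) then Ret (outs w a b blk, Some s) else Ret ([], s'))"

definition dec_E :: "nat list \<Rightarrow> nat set" where "dec_E l = {x. x < length l \<and> odd (l ! x)}"
definition dec_F :: "nat list \<Rightarrow> nat set" where "dec_F l = {x. x < length l \<and> 2 \<le> l ! x}"

definition walk_rnd :: "nat \<Rightarrow> nat \<Rightarrow> nat \<Rightarrow> nat \<Rightarrow> nat \<Rightarrow> nat \<Rightarrow> nat \<Rightarrow> (int list \<times> nat list option) io" where
  "walk_rnd w B a b c i x = io_bind (gt w B 1 (c * gsz w B + x * B)) (\<lambda>y.
     io_bind (gt w B 5 (c * (2 * nblk w + 1) + i)) (\<lambda>l.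
     if x < 2 * nblk w \<and> y \<noteq> [] \<and> y ! 0 \<le> b then
       (let lo = seg_lo (dec_E l) x; hi = seg_hi (length l) (dec_E l) x in
         io_bind (if hi = Suc lo then gb w B 1 (c * nblk w + lo)
                  else gb w B 4 (c * (2 * nblk w) + the_elem (dec_F l \<inter> {lo<..<hi}))) (\<lambda>blk.
           Ret (outs w a b blk, Some [2, a, b, c, i, hi])))
     else Ret ([], Some [3, a, b, c, i, 0])))"

text \<open>The in-order number of the dyadic node \<open>(l, y)\<close>, which is injective and leaves no large gaps.\<close>

definition node_id :: "nat \<Rightarrow> nat \<Rightarrow> nat" where
  "node_id l y = (2 * y + 1) * 2 ^ l - 1"

text \<open>Entry \<open>gsz w B - 1\<close> of a node list reveals whether all entries with
  predecessor below a have been stored. If not, a node inside the range has enough first occurrences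
  to pay for a descent.\<close>

definition enter_rnd :: "nat \<Rightarrow> nat \<Rightarrow> nat \<Rightarrow> nat \<Rightarrow> nat \<Rightarrow> nat \<Rightarrow> nat \<Rightarrow> (int list \<times> nat list option) io" where
  "enter_rnd w B N a b l y = (let g = gsz w B; lo = y * 2 ^ l * g; hi = min N ((y + 1) * 2 ^ l * g) in
     io_bind (gt w B 1 lo) (\<lambda>x. io_bind (gt w B 1 (hi - 1)) (\<lambda>x'. io_bind (gt w B 7 (node_id l y * g + (g - 1))) (\<lambda>z.
       if N \<le> lo \<or> b < x ! 0 \<or> x' ! 0 < a then Ret ([], Some [6, a, b, l, y])
       else if l = 0 \<or> (a \<le> x ! 0 \<and> x' ! 0 \<le> b \<and> \<not> (z \<noteq> [] \<and> z ! 1 \<le> a))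
       then Ret ([], Some [5, a, b, l, y, 0]) else Ret ([], Some [4, a, b, l - 1, 2 * y])))))"

definition done_rnd :: "nat \<Rightarrow> nat \<Rightarrow> nat \<Rightarrow> nat \<Rightarrow> nat \<Rightarrow> nat \<Rightarrow> nat \<Rightarrow> (int list \<times> nat list option) io" where
  "done_rnd w B N a b l y = Ret ([], if topl w B N \<le> l then None
     else if even y then Some [4, a, b, l, y + 1] else Some [6, a, b, l + 1, y div 2])"

text \<open>
  The first component of a state is a program counter: locating a window (\<open>0\<close>), scanning the left list
  (\<open>1\<close>), the segments (\<open>2\<close>) and the right list (\<open>3\<close>) of the window; entering (\<open>4\<close>), scanning (\<open>5\<close>) and leaving
  (otherwise) a node of the dyadic tree, which is traversed in depth-first order.
\<close>

definition rnd :: "nat \<Rightarrow> nat \<Rightarrow> nat list \<Rightarrow> (int list \<times> nat list option) io" where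
  "rnd w B s = io_bind (gt w B 0 0) (\<lambda>hdr. let pc = s ! 0; a = s ! 1; b = s ! 2 in
     if pc = 0 then start_rnd w B hdr a b
     else if pc = 1 then scan_rnd w B a b 2 (s ! 3) (s ! 5) (\<lambda>x. a \<le> x ! 0)
       [1, a, b, s ! 3, s ! 4, Suc (s ! 5)] (Some [2, a, b, s ! 3, s ! 4, s ! 4 - 1])
     else if pc = 2 then walk_rnd w B a b (s ! 3) (s ! 4) (s ! 5)
     else if pc = 3 then scan_rnd w B a b 3 (s ! 3) (s ! 5) (\<lambda>x. x ! 0 \<le> b)
       [3, a, b, s ! 3, s ! 4, Suc (s ! 5)] None
     else if pc = 4 then enter_rnd w B (hdr ! 0) a b (s ! 3) (s ! 4)
     else if pc = 5 then scan_rnd w B a b 7 (node_id (s ! 3) (s ! 4)) (s ! 5) (\<lambda>x. x ! 1 \<le> a)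
       [5, a, b, s ! 3, s ! 4, Suc (s ! 5)] (Some [6, a, b, s ! 3, s ! 4])
     else done_rnd w B (hdr ! 0) a b (s ! 3) (s ! 4))"

definition init :: "nat \<Rightarrow> int \<Rightarrow> int \<Rightarrow> nat list" where
  "init w a b = [0, nat (a + 2 ^ (w - 1)), nat (b + 2 ^ (w - 1))]"

text \<open>Costs are counted in array accesses, each of at most two superblocks of 17000
  blocks.\<close>

definition io_ok :: "int list list \<Rightarrow> 'a io \<Rightarrow> nat \<Rightarrow> bool" where
  "io_ok D m c \<longleftrightarrow> io_safe D m \<and> io_cost D m \<le> c * 34000"

lemma io_ok_Ret: "io_ok D (Ret x) c" by (simp add: io_ok_def)

lemma io_ok_bind: "io_ok D m c \<Longrightarrow> (\<And>x. io_ok D (f x) c') \<Longrightarrow> io_ok D (io_bind m f) (c + c')"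
  unfolding io_ok_def by (simp add: add_mono add_mult_distrib)

lemma io_ok_mono: "io_ok D m c \<Longrightarrow> c \<le> c' \<Longrightarrow> io_ok D m c'"
  unfolding io_ok_def using mult_le_mono1 le_trans by blast

lemma io_ok_if: "io_ok D m c \<Longrightarrow> io_ok D m' c \<Longrightarrow> io_ok D (if P then m else m') c" by simp

locale disk_of =
  fixes w B :: nat and Y :: "nat \<Rightarrow> nat \<Rightarrow> nat list" and \<Lambda> :: nat
  assumes w: "w \<ge> 1" and B: "B \<ge> 1" and \<Lambda>: "[\<Lambda>] \<in> items w"
    and Y: "\<And>i n. Y i n \<in> items w" "\<And>i n. n \<ge> \<Lambda> * B \<Longrightarrow> Y i n = []"
begin

definition D where "D = mkdisk w B Y \<Lambda>"

lemma nil_item: "[] \<in> items w" by (simp add: items_def)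

lemma run_gt [simp]: "i < 11 \<Longrightarrow> io_run D (gt w B i n) = Y i n"
  unfolding D_def gt_def mkdisk_def
  by (rule item_disk.run_get[OF w B _ _ items_card[OF w] nil_item \<Lambda> Y]) simp_all

lemma run_gb [simp]: "i < 11 \<Longrightarrow> io_run D (gb w B i j) = map (\<lambda>q. Y i (j * B + q)) [0..<B]"
  unfolding D_def gb_def mkdisk_def
  by (rule item_disk.run_get_block[OF w B _ _ items_card[OF w] nil_item \<Lambda> Y]) simp_all

lemma gt_ok: "io_ok D (gt w B i n) 1"
proof -
  have "io_safe D (gt w B i n)" unfolding D_def gt_def mkdisk_def
    by (rule item_disk.get_safe(1)[OF w B _ _ items_card[OF w] nil_item \<Lambda> Y]) simp_all
  moreover have "io_cost D (gt w B i n) \<le> 2 * 17000" unfolding D_def gt_def mkdisk_def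
    by (rule item_disk.get_safe(2)[OF w B _ _ items_card[OF w] nil_item \<Lambda> Y]) simp_all
  ultimately show ?thesis by (simp add: io_ok_def)
qed

lemma gb_ok: "io_ok D (gb w B i n) 1"
proof -
  have "io_safe D (gb w B i n)" unfolding D_def gb_def mkdisk_def
    by (rule item_disk.get_block_safe(1)[OF w B _ _ items_card[OF w] nil_item \<Lambda> Y]) simp_all
  moreover have "io_cost D (gb w B i n) \<le> 2 * 17000" unfolding D_def gb_def mkdisk_def
    by (rule item_disk.get_block_safe(2)[OF w B _ _ items_card[OF w] nil_item \<Lambda> Y]) simp_all
  ultimately show ?thesis by (simp add: io_ok_def)
qed

lemma is_disk_D: "is_disk w B D" unfolding D_def mkdisk_def
  by (rule item_disk.is_disk_disk[OF w B _ _ items_card[OF w] nil_item \<Lambda> Y]) simp_all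

lemma length_D: "length D = 17000 * Suc (\<Lambda> * 11)"
  by (simp add: D_def mkdisk_def item_disk.disk_def)

lemma gt_Rd: "\<exists>j k. gt w B i n = Rd j k" unfolding gt_def
  by (rule item_disk.get_Rd[OF w B _ _ items_card[OF w] nil_item \<Lambda> Y]) simp_all

lemma fusion_ok: "io_ok D (fusion w B idx base stride q) 2"
  unfolding fusion_def by (rule io_ok_mono, (rule io_ok_bind gt_ok io_ok_Ret[where c=0])+, simp)

lemma window_rank_ok: "io_ok D (window_rank w B c a) 4"
  unfolding window_rank_def
  by (rule io_ok_mono, rule io_ok_bind[OF fusion_ok], rule io_ok_if, rule io_ok_Ret,
      rule io_ok_bind[OF fusion_ok], rule io_ok_Ret[where c=0], simp)

lemma meets_ok: "io_ok D (meets w B a b c i) 2"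
  unfolding meets_def by (rule io_ok_mono, (rule io_ok_bind gt_ok gb_ok io_ok_Ret[where c=0])+, simp)

lemma try_window_ok: "io_ok D (try_window w B N a b c) 6"
  unfolding try_window_def
  by (rule io_ok_if[OF _ io_ok_Ret], rule io_ok_mono, rule io_ok_bind[OF window_rank_ok],
      rule io_ok_bind[OF meets_ok], rule io_ok_Ret[where c=0], simp)

lemma try_node_ok: "io_ok D (try_node w B hdr a b k) 8"
  unfolding try_node_def
  by (rule io_ok_mono, (rule io_ok_bind gt_ok try_window_ok)+, simp)

lemma try_via_ok: "io_ok D (try_via w B hdr a b k) 9"
  unfolding try_via_def Let_def
  by (rule io_ok_mono, (rule io_ok_bind gt_ok try_node_ok)+, simp)

lemma or_else_ok: "io_ok D m c \<Longrightarrow> io_ok D m' c' \<Longrightarrow> io_ok D (or_else m m') (c + c')"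
  unfolding or_else_def by (rule io_ok_bind) (auto split: option.splits simp: io_ok_Ret)

lemma locate_io_ok: "io_ok D (locate_io w B hdr a b) 26"
  unfolding locate_io_def Let_def
  by (rule io_ok_if[OF _ io_ok_Ret], rule io_ok_mono, (rule or_else_ok try_node_ok try_via_ok)+, simp)

lemma start_rnd_ok: "io_ok D (start_rnd w B hdr a b) 28"
proof -
  have "io_ok D (start_rnd w B hdr a b) (26 + (1 + (1 + 0)))"
    unfolding start_rnd_def
  proof (rule io_ok_bind[OF locate_io_ok])
    fix res :: "(nat \<times> nat) option"
    show "io_ok D (case res of None \<Rightarrow> Ret ([], None)
     | Some (c, i) \<Rightarrow> io_bind (gt w B 2 (c * gsz w B + (gsz w B - 1))) (\<lambda>x.
         io_bind (gt w B 3 (c * gsz w B + (gsz w B - 1))) (\<lambda>y.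
           if (x \<noteq> [] \<and> a \<le> x ! 0) \<or> (y \<noteq> [] \<and> y ! 0 \<le> b)
           then Ret ([], Some [4, a, b, topl w B (hdr ! 0), 0]) else Ret ([], Some [1, a, b, c, i, 0])))) (1 + (1 + 0))"
    proof (cases res)
      case (Some ci)
      show ?thesis unfolding Some option.case case_prod_unfold
        by (rule io_ok_bind[OF gt_ok], rule io_ok_bind[OF gt_ok], rule io_ok_if, rule io_ok_Ret, rule io_ok_Ret)
    qed (simp add: io_ok_Ret)
  qed
  then show ?thesis by simp
qed

lemma scan_rnd_ok: "io_ok D (scan_rnd w B a b i c j P s s') 28"
  unfolding scan_rnd_def
  by (rule io_ok_mono, rule io_ok_bind[OF gb_ok], rule io_ok_if, rule io_ok_Ret[where c=0], rule io_ok_Ret, simp)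

lemma walk_rnd_ok: "io_ok D (walk_rnd w B a b c i x) 28"
  unfolding walk_rnd_def Let_def
  by (rule io_ok_mono, rule io_ok_bind[OF gt_ok], rule io_ok_bind[OF gt_ok], rule io_ok_if,
      rule io_ok_bind, rule io_ok_if, rule gb_ok, rule gb_ok, rule io_ok_Ret[where c=0], rule io_ok_Ret, simp)

lemma enter_rnd_ok: "io_ok D (enter_rnd w B N a b l y) 28"
  unfolding enter_rnd_def Let_def
  by (rule io_ok_mono, rule io_ok_bind[OF gt_ok], rule io_ok_bind[OF gt_ok], rule io_ok_bind[OF gt_ok], rule io_ok_if,
      rule io_ok_Ret[where c=0], rule io_ok_if, rule io_ok_Ret, rule io_ok_Ret, simp)

lemma done_rnd_ok: "io_ok D (done_rnd w B N a b l y) 28"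
  unfolding done_rnd_def by (rule io_ok_Ret)

text \<open>One access for the header item, and at most 28 for the selected branch. The bound 28 is
  the one for the start: 8 + 9 + 9 to locate a window and 2 for the overflow tests.\<close>

lemma rnd_ok: "io_ok D (rnd w B s) 29"
proof -
  have "io_ok D (rnd w B s) (1 + 28)"
    unfolding rnd_def Let_def
    by (rule io_ok_bind[OF gt_ok])
      (intro io_ok_if start_rnd_ok scan_rnd_ok walk_rnd_ok enter_rnd_ok done_rnd_ok)
  then show ?thesis by simp
qed

lemma rnd_Rd: "\<exists>j k. rnd w B s = Rd j k"
  using gt_Rd[of 0 0] by (auto simp: rnd_def)

end

section \<open>Counting blocks and block leaders\<close>

lemma less_ceil_div_iff: "B \<ge> 1 \<Longrightarrow> x < (m + B - 1) div B \<longleftrightarrow> x * B < (m::nat)"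
  using less_eq_div_iff_mult_less_eq[of B "Suc x" "m + B - 1"] by auto

lemma initial_segment:
  fixes k :: "nat \<Rightarrow> nat"
  assumes "\<And>i j. i < j \<Longrightarrow> j < m \<Longrightarrow> k i < k j"
  shows "x < card {i. i < m \<and> k i \<le> q} \<longleftrightarrow> x < m \<and> k x \<le> q"
proof -
  let ?S = "{i. i < m \<and> k i \<le> q}"
  have down: "i \<in> ?S" if "j \<in> ?S" "i \<le> j" for i j
    using that assms[of i j] by (cases "i = j") auto
  have "?S = {..<card ?S}"
  proof (cases "?S = {}")
    case False
    have M: "Max ?S \<in> ?S" by (rule Max_in) (use False in auto)
    have le: "x \<le> Max ?S" if "x \<in> ?S" for x by (rule Max_ge[OF _ that]) simp
    have eq: "?S = {..<Suc (Max ?S)}"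
    proof (rule set_eqI)
      fix x show "x \<in> ?S \<longleftrightarrow> x \<in> {..<Suc (Max ?S)}"
        using down[OF M, of x] le[of x] unfolding lessThan_iff less_Suc_eq_le by blast
    qed
    have "card ?S = Suc (Max ?S)" by (subst eq) simp
    then show ?thesis using eq by simp
  next
    case True
    show ?thesis unfolding True by simp
  qed
  then have "x \<in> ?S \<longleftrightarrow> x \<in> {..<card ?S}" by (rule arg_cong)
  then show ?thesis by simp
qed

lemma card_initial_segment: "(\<And>x. x < (i::nat) \<longleftrightarrow> P x) \<Longrightarrow> card {x. P x} = i"
proof -
  assume "\<And>x. x < i \<longleftrightarrow> P x"
  then have "{x. P x} = {..<i}" by auto
  then show ?thesis by simp
qed

definition nbc :: "nat \<Rightarrow> nat \<Rightarrow> nat \<Rightarrow> nat \<Rightarrow> nat" where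
  "nbc w B N c = (min (2 * gsz w B) (N - c * gsz w B) + B - 1) div B"

lemma nbc_iff: "B \<ge> 1 \<Longrightarrow> x < nbc w B N c \<longleftrightarrow> x < 2 * nblk w \<and> c * gsz w B + x * B < N"
  unfolding nbc_def by (simp only: less_ceil_div_iff) (auto simp: gsz_def mult.assoc[symmetric])

definition ntc :: "nat \<Rightarrow> nat \<Rightarrow> nat \<Rightarrow> nat \<Rightarrow> nat" where
  "ntc w B N c = (nbc w B N c + fan w - 1) div fan w"

lemma ntc_iff: "w \<ge> 1 \<Longrightarrow> t < ntc w B N c \<longleftrightarrow> t * fan w < nbc w B N c"
  unfolding ntc_def by (rule less_ceil_div_iff) (rule fan_bounds)

context ranked begin

definition ent :: "nat \<Rightarrow> nat list" where "ent r = [e r, pf r, \<kappa> r]"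

text \<open>The left lists hold last instead of first occurrences, so their predecessor entry is \<open>0\<close> in order to pass the filter.\<close>

definition entl :: "nat \<Rightarrow> nat list" where "entl r = [e r, 0, \<kappa> r]"

definition pad :: "nat list list \<Rightarrow> nat \<Rightarrow> nat list" where
  "pad xs q = (if q < length xs then xs ! q else [])"

text \<open>The sets for which the chain of segmentations is built. Time i is a possible number of
  block leaders up to a.\<close>

definition alive :: "nat \<Rightarrow> nat \<Rightarrow> nat \<Rightarrow> nat \<Rightarrow> nat set" where
  "alive B \<beta> i x = {r. \<beta> + x * B \<le> r \<and> r < \<beta> + x * B + B \<and> r < N \<and> pv r \<le> \<beta> + i * B}"

definition dnode :: "nat \<Rightarrow> nat \<Rightarrow> nat \<Rightarrow> nat set" where
  "dnode g l y = {r. y * 2 ^ l * g \<le> r \<and> r < (y + 1) * 2 ^ l * g \<and> r < N}"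

end

section \<open>Correctness of the query program\<close>

text \<open>
  The arrays are: \<open>0\<close> the header; \<open>1\<close> the sorted elements; \<open>2\<close> and \<open>3\<close> the left and right lists of the windows;
  \<open>4\<close> the snapshots and \<open>5\<close> the segmentations; \<open>6\<close> the fusion nodes; \<open>7\<close> the lists of the dyadic tree; \<open>8\<close> the table
  for heights of light ancestors; \<open>9\<close> and \<open>10\<close> the table that maps trie nodes to windows.
\<close>

locale cquery = disk_of w B Y \<Lambda> + trie N e \<kappa> w "gsz w B" "fan w"
  for w B :: nat and Y :: "nat \<Rightarrow> nat \<Rightarrow> nat list" and \<Lambda> N :: nat and e \<kappa> :: "nat \<Rightarrow> nat" +
  fixes s1 s0 :: nat and E F snap :: "nat \<Rightarrow> nat \<Rightarrow> nat set"
  assumes \<kappa>_w: "\<And>r. r < N \<Longrightarrow> \<kappa> r < 2 ^ w"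
    and Y0: "Y 0 0 = [N, s1, s0]"
    and Y1: "\<And>m. Y 1 m = (if m < N then ent m else [])"
    and Y2: "\<And>c q. c * gsz w B < N \<Longrightarrow> q < gsz w B \<Longrightarrow>
      Y 2 (c * gsz w B + q) = pad (map entl (rev (sorted_list_of_set (LB (c * gsz w B))))) q"
    and Y3: "\<And>c q. c * gsz w B < N \<Longrightarrow> q < gsz w B \<Longrightarrow>
      Y 3 (c * gsz w B + q) = pad (map ent (sorted_list_of_set (RB ((c + 2) * gsz w B)))) q"
    and Y4: "\<And>c x q. c * gsz w B < N \<Longrightarrow> x < 2 * nblk w \<Longrightarrow> q < B \<Longrightarrow>
      Y 4 ((c * (2 * nblk w) + x) * B + q) = pad (map ent (sorted_list_of_set (snap c x))) q"
    and Y5: "\<And>c i. c * gsz w B < N \<Longrightarrow> i \<le> nbc w B N c \<Longrightarrow>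
      dec_E (Y 5 (c * (2 * nblk w + 1) + i)) = E c i \<and> dec_F (Y 5 (c * (2 * nblk w + 1) + i)) = F c i \<and>
      length (Y 5 (c * (2 * nblk w + 1) + i)) = nbc w B N c"
    and chain_sub: "\<And>c i. c * gsz w B < N \<Longrightarrow> i \<le> 2 * nblk w \<Longrightarrow> E c i \<subseteq> {1..<nbc w B N c} \<and> F c i \<subseteq> {1..<nbc w B N c}"
    and chain_snap: "\<And>c x. c * gsz w B < N \<Longrightarrow> finite (snap c x) \<and> card (snap c x) \<le> B"
    and chain_seg: "\<And>c i x. c * gsz w B < N \<Longrightarrow> i \<le> 2 * nblk w \<Longrightarrow> x < nbc w B N c \<Longrightarrow>
      seg_hi (nbc w B N c) (E c i) x = Suc (seg_lo (E c i) x) \<or>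
      (\<exists>z. F c i \<inter> {seg_lo (E c i) x<..<seg_hi (nbc w B N c) (E c i) x} = {z} \<and>
        seg_union (alive B (c * gsz w B) i) (seg_lo (E c i) x) (seg_hi (nbc w B N c) (E c i) x) \<subseteq> snap c z \<and>
        snap c z \<subseteq> seg_union (alive B (c * gsz w B) (2 * nblk w)) (seg_lo (E c i) x) (seg_hi (nbc w B N c) (E c i) x))"
    and chain_big: "\<And>c i z. c * gsz w B < N \<Longrightarrow> i \<le> 2 * nblk w \<Longrightarrow> z \<in> E c i \<Longrightarrow>
      B < card (seg_union (alive B (c * gsz w B) i) (seg_lo (E c i) (z - 1)) (seg_hi (nbc w B N c) (E c i) z))"
    and Y6_top: "\<And>c. c * gsz w B < N \<Longrightarrow> Y 6 (c * (2 * fan w + 1)) = sketch (ntc w B N c) (\<lambda>t. e (c * gsz w B + t * (fan w * B)))"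
    and Y6_sub: "\<And>c u. c * gsz w B < N \<Longrightarrow> u < ntc w B N c \<Longrightarrow> Y 6 (c * (2 * fan w + 1) + Suc u) =
      sketch (min (fan w) (nbc w B N c - u * fan w)) (\<lambda>v. e (c * gsz w B + u * fan w * B + v * B))"
    and Y7: "\<And>l y q. l \<le> topl w B N \<Longrightarrow> y < 2 ^ (topl w B N - l) \<Longrightarrow> q < gsz w B \<Longrightarrow> Y 7 (node_id l y * gsz w B + q) =
      pad (map ent (sort_key pf (sorted_list_of_set (dnode (gsz w B) l y)))) q"
    and Y8: "\<And>k. k \<in> K1 \<Longrightarrow> rtv w (Y 8 (hsh w N s1 k) ! 0) k = TL (fst k) (snd k)"
    and Y9: "\<And>k. k \<in> K0 \<Longrightarrow> Y 10 (Y 9 (hsh w N s0 k) ! 0 + rtv w (Y 9 (hsh w N s0 k) ! 1) k) ! 0 = pay k"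
begin

abbreviation g\<^sub>0 where "g\<^sub>0 \<equiv> gsz w B"
abbreviation n where "n \<equiv> nblk w"
abbreviation nb where "nb \<equiv> nbc w B N"

lemmas nb_iff = nbc_iff[OF B, where w = w and N = N]

lemmas Y1s = Y1[unfolded One_nat_def]

lemma fan1: "fan w \<ge> 1" and n1: "n \<ge> 1" and g1: "g\<^sub>0 \<ge> 1" and nB: "g\<^sub>0 = n * B"
  using fan_bounds[OF w] B by (auto simp: gsz_def)

section \<open>Locating a window that meets the range\<close>

lemma run_fusion:
  assumes m: "m \<ge> 1" and sk: "Y 6 idx = sketch m (\<lambda>t. e (base + t * stride))"
    and lt: "\<And>t. t < m \<Longrightarrow> base + t * stride < N" and st: "stride \<ge> 1"
  shows "io_run D (fusion w B idx base stride q) = card {t. t < m \<and> e (base + t * stride) \<le> q}"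
proof -
  let ?k = "\<lambda>t. e (base + t * stride)"
  have mono: "?k i < ?k j" if "i < j" "j < m" for i j
    using that lt[of j] st by (intro e_less) (auto simp: mult_less_cancel2)
  have c: "cand (sketch m ?k) q < m" and r: "rank_from (sketch m ?k) q (?k (cand (sketch m ?k) q)) = card {t. t < m \<and> ?k t \<le> q}"
    using rank_from_sketch[of m ?k q] m mono by auto
  show ?thesis using r lt[OF c] by (simp add: fusion_def sk Y1s ent_def)
qed

definition lead :: "nat \<Rightarrow> nat \<Rightarrow> nat" where
  "lead c a = card {x. x < nb c \<and> e (c * g\<^sub>0 + x * B) \<le> a}"

lemma leader_mono: "x < x' \<Longrightarrow> x' < nb c \<Longrightarrow> e (c * g\<^sub>0 + x * B) < e (c * g\<^sub>0 + x' * B)"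
  using B by (intro e_less) (auto simp: nb_iff)

lemma lead_iff: "x < lead c a \<longleftrightarrow> x < nb c \<and> e (c * g\<^sub>0 + x * B) \<le> a"
  unfolding lead_def by (rule initial_segment[of "nb c" "\<lambda>x. e (c * g\<^sub>0 + x * B)"]) (rule leader_mono)

lemma nb_pos: "c * g\<^sub>0 < N \<Longrightarrow> 0 < nb c"
  using n1 by (simp add: nb_iff)

lemma nb_le: "nb c \<le> 2 * n"
  using nb_iff[of "2 * n" c] by (meson leI less_irrefl)

lemma lead_le: "lead c a \<le> nb c"
  using lead_iff[of "nb c" c a] by (meson leI less_irrefl)

lemma run_window_rank:
  assumes c: "c * g\<^sub>0 < N"
  shows "io_run D (window_rank w B c a) = lead c a"
proof -
  let ?f = "fan w" and ?nt = "ntc w B N c"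
  let ?L = "\<lambda>x. e (c * g\<^sub>0 + x * B)"
  let ?K = "\<lambda>t. e (c * g\<^sub>0 + t * (?f * B))"
  note nt = ntc_iff[OF w, of _ B N c]
  have KL: "?K t = ?L (t * ?f)" for t by (simp add: ac_simps)
  have nt1: "?nt \<ge> 1" using nt[of 0] nb_pos[OF c] by simp
  have lt: "c * g\<^sub>0 + t * (?f * B) < N" if "t < ?nt" for t
    using that nt[of t] nb_iff[of "t * ?f" c] by (simp add: ac_simps)
  define u where "u = card {t. t < ?nt \<and> ?K t \<le> a}"
  have monoK: "?K i < ?K j" if "i < j" "j < ?nt" for i j
    using leader_mono[of "i * ?f" "j * ?f" c] that nt[of j] fan1 unfolding KL by simp
  have u_iff: "t < u \<longleftrightarrow> t < ?nt \<and> ?K t \<le> a" for t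
    unfolding u_def by (rule initial_segment[of ?nt ?K]) (rule monoK)
  have run1: "io_run D (fusion w B (c * (2 * ?f + 1)) (c * g\<^sub>0) (?f * B) a) = u"
    unfolding u_def by (rule run_fusion[OF nt1 Y6_top[OF c] lt]) (use fan1 B in auto)
  show ?thesis
  proof (cases "u = 0")
    case True
    then have "a < ?L 0" using u_iff[of 0] nt1 by (simp add: not_le)
    then have "lead c a = 0" using lead_iff[of 0 c a] by auto
    then show ?thesis using run1 True by (simp add: window_rank_def)
  next
    case False
    let ?s = "u - 1"
    have s: "?s < ?nt" "?K ?s \<le> a" using u_iff[of ?s] False by auto
    let ?m = "min ?f (nb c - ?s * ?f)"
    have m1: "?m \<ge> 1" using nt[of ?s] s(1) fan1 by simp
    have eqv: "c * g\<^sub>0 + ?s * ?f * B + v * B = c * g\<^sub>0 + (?s * ?f + v) * B" for v by (simp add: algebra_simps)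
    have lt2: "c * g\<^sub>0 + ?s * ?f * B + v * B < N" if "v < ?m" for v
    proof -
      have "?s * ?f + v < nb c" using that by (simp add: less_diff_conv add.commute)
      then show ?thesis unfolding eqv using nb_iff[of "?s * ?f + v" c] by simp
    qed
    have sk: "Y 6 (c * (2 * ?f + 1) + u) = sketch ?m (\<lambda>v. e (c * g\<^sub>0 + ?s * ?f * B + v * B))"
      using Y6_sub[OF c s(1)] False by simp
    define v where "v = card {v. v < ?m \<and> e (c * g\<^sub>0 + ?s * ?f * B + v * B) \<le> a}"
    have run2: "io_run D (fusion w B (c * (2 * ?f + 1) + u) (c * g\<^sub>0 + ?s * ?f * B) B a) = v"
      unfolding v_def by (rule run_fusion[OF m1 sk lt2 B])
    have v_iff: "x < v \<longleftrightarrow> x < ?m \<and> ?L (?s * ?f + x) \<le> a" for x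
      unfolding v_def eqv
      by (rule initial_segment[of ?m "\<lambda>v. ?L (?s * ?f + v)"]) (rule leader_mono, auto)
    have "x < ?s * ?f + v \<longleftrightarrow> x < nb c \<and> ?L x \<le> a" for x
    proof (cases "x < ?s * ?f")
      case True
      have "?s * ?f < nb c" using nt[of ?s] s(1) by simp
      then show ?thesis using True leader_mono[of x "?s * ?f" c] s(2) unfolding KL by simp
    next
      case F: False
      show ?thesis
      proof (cases "x < ?s * ?f + ?f")
        case True
        obtain z where z: "x = ?s * ?f + z" using F le_Suc_ex not_less by blast
        have "z < ?m \<longleftrightarrow> x < nb c" using True z by (simp add: less_diff_conv add.commute)
        then show ?thesis using v_iff[of z] unfolding z by simp
      next
        case False
        have "v \<le> ?f" using v_iff[of ?f] by (meson leI less_irrefl min_less_iff_conj)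
        \<comment> \<open>The leader of the next group already exceeds a, for otherwise that group
          would have been counted in u.\<close>
        moreover have "\<not> (x < nb c \<and> ?L x \<le> a)"
        proof
          assume x: "x < nb c \<and> ?L x \<le> a"
          have uf: "u * ?f = ?s * ?f + ?f" using \<open>u \<noteq> 0\<close> by (cases u) auto
          then have "u * ?f < nb c" using x False by simp
          then have "u < ?nt" using nt by simp
          then have "a < ?K u" using u_iff[of u] by simp
          moreover have "?L (u * ?f) \<le> ?L x"
            using leader_mono[of "u * ?f" x c] x False uf by (cases "u * ?f = x") auto
          ultimately show False using x unfolding KL by simp
        qed
        ultimately show ?thesis using False by simp
      qed
    qed
    then have "?s * ?f + v = lead c a" unfolding lead_def by (rule card_initial_segment[symmetric])
    then show ?thesis using run1 run2 False by (simp add: window_rank_def)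
  qed
qed

lemma window_block:
  assumes "r \<in> window c"
  obtains x where "x < nb c" "c * g\<^sub>0 + x * B \<le> r" "r < c * g\<^sub>0 + x * B + B"
proof -
  let ?x = "(r - c * g\<^sub>0) div B"
  have r: "c * g\<^sub>0 \<le> r" "r < c * g\<^sub>0 + 2 * g\<^sub>0" "r < N" using assms by (auto simp: window_def)
  have "?x * B \<le> r - c * g\<^sub>0" "r - c * g\<^sub>0 < ?x * B + B"
    using div_mult_mod_eq[of "r - c * g\<^sub>0" B] mod_less_divisor[of B "r - c * g\<^sub>0"] B by linarith+
  then have x: "c * g\<^sub>0 + ?x * B \<le> r" "r < c * g\<^sub>0 + ?x * B + B" using r by linarith+
  have "?x * B < 2 * n * B" using x r nB by linarith
  then have "?x < nb c" using x r by (simp add: nb_iff)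
  then show ?thesis using that x by blast
qed

lemma window_block_in: "x < nb c \<Longrightarrow> c * g\<^sub>0 + x * B \<le> r \<Longrightarrow> r < c * g\<^sub>0 + x * B + B \<Longrightarrow> r < N \<Longrightarrow> r \<in> window c"
proof -
  assume *: "x < nb c" "c * g\<^sub>0 + x * B \<le> r" "r < c * g\<^sub>0 + x * B + B" "r < N"
  have "Suc x * B \<le> 2 * n * B" using *(1) nb_le[of c] by (intro mult_le_mono1) simp
  then have "x * B + B \<le> 2 * g\<^sub>0" using nB by simp
  then have "r < c * g\<^sub>0 + 2 * g\<^sub>0" "c * g\<^sub>0 \<le> r" using * by linarith+
  then show ?thesis using *(4) by (simp add: window_def)
qed

lemma run_meets:
  assumes c: "c * g\<^sub>0 < N"
  shows "io_run D (meets w B a b c (lead c a)) \<longleftrightarrow> inrange a b \<inter> window c \<noteq> {}"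
proof -
  let ?i = "lead c a"
  have base: "(c * n + x) * B = c * g\<^sub>0 + x * B" for x by (simp add: nB algebra_simps)
  have run: "io_run D (meets w B a b c ?i) \<longleftrightarrow>
    (0 < ?i \<and> (\<exists>q<B. c * g\<^sub>0 + (?i - 1) * B + q \<in> inrange a b)) \<or>
    (?i < 2 * n \<and> c * g\<^sub>0 + ?i * B < N \<and> e (c * g\<^sub>0 + ?i * B) \<le> b)"
  proof -
    have in_block: "(\<exists>y\<in>set (map (\<lambda>q. Y 1 (m + q)) [0..<B]). y \<noteq> [] \<and> a \<le> y ! 0 \<and> y ! 0 \<le> b) \<longleftrightarrow>
        (\<exists>q<B. m + q \<in> inrange a b)" for m
    proof -
      have "(\<exists>y\<in>set (map (\<lambda>q. Y 1 (m + q)) [0..<B]). y \<noteq> [] \<and> a \<le> y ! 0 \<and> y ! 0 \<le> b) \<longleftrightarrow>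
        (\<exists>q<B. Y 1 (m + q) \<noteq> [] \<and> a \<le> Y 1 (m + q) ! 0 \<and> Y 1 (m + q) ! 0 \<le> b)"
        unfolding set_map bex_simps(7) set_upt by auto
      also have "\<dots> \<longleftrightarrow> (\<exists>q<B. m + q \<in> inrange a b)" by (auto simp: Y1s ent_def inrange_def)
      finally show ?thesis .
    qed
    have "io_run D (meets w B a b c ?i) \<longleftrightarrow>
      (0 < ?i \<and> (\<exists>y\<in>set (map (\<lambda>q. Y 1 ((c * n + (?i - 1)) * B + q)) [0..<B]). y \<noteq> [] \<and> a \<le> y ! 0 \<and> y ! 0 \<le> b)) \<or>
      (?i < 2 * n \<and> Y 1 (c * g\<^sub>0 + ?i * B) \<noteq> [] \<and> Y 1 (c * g\<^sub>0 + ?i * B) ! 0 \<le> b)"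
      unfolding meets_def io_run_bind io_run.simps by (simp only: run_gb run_gt)
    then show ?thesis unfolding in_block base by (simp add: Y1s ent_def)
  qed
  show ?thesis
  proof
    assume "io_run D (meets w B a b c ?i)"
    then consider q where "0 < ?i" "q < B" "c * g\<^sub>0 + (?i - 1) * B + q \<in> inrange a b"
      | "?i < 2 * n" "c * g\<^sub>0 + ?i * B < N" "e (c * g\<^sub>0 + ?i * B) \<le> b" unfolding run by blast
    then show "inrange a b \<inter> window c \<noteq> {}"
    proof cases
      case 1
      then have "?i - 1 < nb c" using lead_le[of c a] by linarith
      then have "c * g\<^sub>0 + (?i - 1) * B + q \<in> window c"
        by (rule window_block_in) (use 1 in \<open>auto simp: inrange_def\<close>)
      then show ?thesis using 1 by blast
    next
      case 2
      then have i: "?i < nb c" by (simp add: nb_iff)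
      then have "a < e (c * g\<^sub>0 + ?i * B)" using lead_iff[of ?i c a] by simp
      then have "c * g\<^sub>0 + ?i * B \<in> inrange a b" using 2 by (simp add: inrange_def)
      moreover have "c * g\<^sub>0 + ?i * B \<in> window c"
        by (rule window_block_in[OF i]) (use 2 B in auto)
      ultimately show ?thesis by blast
    qed
  next
    assume "inrange a b \<inter> window c \<noteq> {}"
    then obtain r where r: "r \<in> inrange a b" "r \<in> window c" by blast
    obtain x where x: "x < nb c" "c * g\<^sub>0 + x * B \<le> r" "r < c * g\<^sub>0 + x * B + B" using window_block[OF r(2)] .
    have rr: "r < N" "a \<le> e r" "e r \<le> b" using r by (auto simp: inrange_def)
    show "io_run D (meets w B a b c ?i)"
    proof (cases "?i \<le> x")
      case True
      then have "?i < nb c" using x by simp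
      moreover have "e (c * g\<^sub>0 + ?i * B) \<le> e r"
      proof (rule e_le[OF _ rr(1)])
        have "?i * B \<le> x * B" using True by simp
        then show "c * g\<^sub>0 + ?i * B \<le> r" using x by linarith
      qed
      ultimately show ?thesis unfolding run using rr by (simp add: nb_iff)
    next
      case False
      \<comment> \<open>Any earlier block ends before leader i - 1, which is at most a.\<close>
      have "x = ?i - 1"
      proof (rule ccontr)
        assume "x \<noteq> ?i - 1"
        then have "Suc x \<le> ?i - 1" using False by simp
        then have "Suc x * B \<le> (?i - 1) * B" by (rule mult_le_mono1)
        then have lt: "r < c * g\<^sub>0 + (?i - 1) * B" using x by simp
        have "?i - 1 < ?i" using False by simp
        then have "?i - 1 < nb c" "e (c * g\<^sub>0 + (?i - 1) * B) \<le> a" using lead_iff by blast+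
        then show False using e_less[OF lt] rr by (simp add: nb_iff)
      qed
      then have "c * g\<^sub>0 + (?i - 1) * B + (r - (c * g\<^sub>0 + (?i - 1) * B)) \<in> inrange a b"
        "r - (c * g\<^sub>0 + (?i - 1) * B) < B" using r x by simp_all
      moreover have "0 < ?i" using False by simp
      ultimately show ?thesis unfolding run by blast
    qed
  qed
qed

lemma run_try_window:
  "io_run D (try_window w B N a b c) = (if c * g\<^sub>0 < N \<and> inrange a b \<inter> window c \<noteq> {} then Some (c, lead c a) else None)"
  using run_window_rank[of c a] run_meets[of c a b] by (simp add: try_window_def)

lemma run_or_else: "io_run D (or_else m m') = (case io_run D m of None \<Rightarrow> io_run D m' | Some x \<Rightarrow> Some x)"
  by (simp add: or_else_def split: option.splits)

lemma run_locate:
  assumes b: "b < 2 ^ w" and ab: "a \<le> b"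
  shows "if inrange a b = {} then io_run D (locate_io w B [N, s1, s0] a b) = None
    else \<exists>c. c * g\<^sub>0 < N \<and> inrange a b \<inter> window c \<noteq> {} \<and> io_run D (locate_io w B [N, s1, s0] a b) = Some (c, lead c a)"
proof -
  let ?hd = "[N, s1, s0]"
  define h where "h = hgt a b"
  define y where "y = a div 2 ^ h"
  define h' where "h' = fan w * ((h + fan w - 1) div fan w)"
  let ?node = "\<lambda>k. io_run D (try_node w B ?hd a b k)" and ?via = "\<lambda>k. io_run D (try_via w B ?hd a b k)"
  \<comment> \<open>This holds for arbitrary nodes, keys or not, because of the check in
    \<open>try_window\<close>. Keys matter only for showing that one of the three attempts
    succeeds.\<close>
  have node: "\<exists>c. ?node k = (if c * g\<^sub>0 < N \<and> inrange a b \<inter> window c \<noteq> {} then Some (c, lead c a) else None)" for k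
    by (auto simp: try_node_def run_try_window)
  have node_pay: "?node k = (if inrange a b \<inter> window (pay k) \<noteq> {} then Some (pay k, lead (pay k) a) else None)" if "k \<in> K0" for k
    using pay(1)[of "fst k" "snd k"] Y9[OF that] by (simp add: try_node_def run_try_window)
  have via: "?via k = ?node (d, y div 2 ^ (d - h))" if "d = rtv w (Y 8 (hsh w N s1 k) ! 0) k" for k d
    using that by (simp add: try_via_def Let_def h_def y_def)
  have run: "io_run D (locate_io w B ?hd a b) = (case ?node (h, y) of Some x \<Rightarrow> Some x | None \<Rightarrow>
     (case ?via (h, y) of Some x \<Rightarrow> Some x | None \<Rightarrow> ?via (h', y div 2 ^ (h' - h))))"
    using ab N1 by (simp add: locate_io_def Let_def run_or_else h_def y_def h'_def split: option.splits)
  obtain c1 where c1: "?node (h, y) = (if c1 * g\<^sub>0 < N \<and> inrange a b \<inter> window c1 \<noteq> {} then Some (c1, lead c1 a) else None)"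
    using node by blast
  have viac: "\<exists>c. ?via k = (if c * g\<^sub>0 < N \<and> inrange a b \<inter> window c \<noteq> {} then Some (c, lead c a) else None)" for k
    using via[OF refl, of k] node by simp
  obtain c2 where c2: "?via (h, y) = (if c2 * g\<^sub>0 < N \<and> inrange a b \<inter> window c2 \<noteq> {} then Some (c2, lead c2 a) else None)"
    using viac by blast
  obtain c3 where c3: "?via (h', y div 2 ^ (h' - h)) = (if c3 * g\<^sub>0 < N \<and> inrange a b \<inter> window c3 \<noteq> {} then Some (c3, lead c3 a) else None)"
    using viac by blast
  show ?thesis
  proof (cases "inrange a b = {}")
    case True
    then show ?thesis unfolding run c1 c2 c3 by simp
  next
    case False
    have "?node (h, y) \<noteq> None \<or> ?via (h, y) \<noteq> None \<or> ?via (h', y div 2 ^ (h' - h)) \<noteq> None"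
      using locate[OF ab b False h_def y_def h'_def]
    proof
      assume "(h, y) \<in> K0 \<and> inrange a b \<inter> window (pay (h, y)) \<noteq> {}"
      then show ?thesis using node_pay by simp
    next
      assume "\<exists>k\<in>{(h, y), (h', y div 2 ^ (h' - h))}. k \<in> K1 \<and>
       (let d = TL (fst k) (snd k) in h \<le> d \<and> (d, y div 2 ^ (d - h)) \<in> K0 \<and>
          inrange a b \<inter> window (pay (d, y div 2 ^ (d - h))) \<noteq> {})"
      then obtain k where k0: "k \<in> {(h, y), (h', y div 2 ^ (h' - h))}" "k \<in> K1"
        and k1: "let d = TL (fst k) (snd k) in h \<le> d \<and> (d, y div 2 ^ (d - h)) \<in> K0 \<and>
          inrange a b \<inter> window (pay (d, y div 2 ^ (d - h))) \<noteq> {}" by blast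
      define d where "d = TL (fst k) (snd k)"
      have k: "k \<in> {(h, y), (h', y div 2 ^ (h' - h))}" "k \<in> K1" "d = TL (fst k) (snd k)"
        "(d, y div 2 ^ (d - h)) \<in> K0" "inrange a b \<inter> window (pay (d, y div 2 ^ (d - h))) \<noteq> {}"
        using k0 k1 unfolding Let_def d_def by blast+
      have "?via k = ?node (d, y div 2 ^ (d - h))" by (rule via) (simp add: Y8[OF k(2)] k(3))
      then have "?via k \<noteq> None" using node_pay[OF k(4)] k(5) by simp
      then show ?thesis using k(1) by auto
    qed
    then show ?thesis unfolding run c1 c2 c3 using False by (auto split: if_splits)
  qed
qed

end

section \<open>Scanning sorted lists\<close>

lemma initial_segment_pred:
  assumes "\<And>i j. i < j \<Longrightarrow> j < (m::nat) \<Longrightarrow> Q j \<Longrightarrow> Q i"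
  shows "x < card {i. i < m \<and> Q i} \<longleftrightarrow> x < m \<and> Q x"
proof -
  \<comment> \<open>Indices that violate Q are moved beyond m - 1, which turns Q into a comparison
    with m - 1.\<close>
  let ?k = "\<lambda>i. if Q i then i else m + i"
  have "?k i < ?k j" if "i < j" "j < m" for i j using that assms[OF that] by auto
  from initial_segment[of m ?k, OF this, of x "m - 1"]
  have *: "x < card {i. i < m \<and> ?k i \<le> m - 1} \<longleftrightarrow> x < m \<and> ?k x \<le> m - 1" .
  have "i < m \<and> ?k i \<le> m - 1 \<longleftrightarrow> i < m \<and> Q i" for i by auto
  then show ?thesis using * by presburger
qed

lemma card_set_filter_nth: "distinct xs \<Longrightarrow> card {r \<in> set xs. Q r} = card {i. i < length xs \<and> Q (xs ! i)}"
proof -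
  assume d: "distinct xs"
  have "{r \<in> set xs. Q r} = (!) xs ` {i. i < length xs \<and> Q (xs ! i)}" by (auto simp: in_set_conv_nth)
  moreover have "inj_on ((!) xs) {i. i < length xs \<and> Q (xs ! i)}" using d by (auto intro!: inj_onI simp: nth_eq_iff_index_eq)
  ultimately show ?thesis by (simp add: card_image)
qed

lemma prefix_card:
  assumes "distinct xs" "\<And>i j. i < j \<Longrightarrow> j < length xs \<Longrightarrow> Q (xs ! j) \<Longrightarrow> Q (xs ! i)" "q < length xs"
  shows "Q (xs ! q) \<longleftrightarrow> q < card {r \<in> set xs. Q r}"
proof -
  have "q < card {i. i < length xs \<and> Q (xs ! i)} \<longleftrightarrow> q < length xs \<and> Q (xs ! q)"
    by (rule initial_segment_pred) (rule assms(2))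
  then show ?thesis using assms(1,3) by (simp add: card_set_filter_nth)
qed

context cquery begin

definition RE :: "nat list \<Rightarrow> nat list \<Rightarrow> nat \<Rightarrow> nat list \<Rightarrow> bool" where
  "RE s l t s' \<longleftrightarrow> macro_machine.reach w B (states w) (rnd w B) D s (map (\<lambda>r. oc w (\<kappa> r)) l) t s'"

lemma oc_word: "r < N \<Longrightarrow> oc w (\<kappa> r) \<in> words w"
proof -
  assume "r < N"
  then have "\<kappa> r < 2 ^ w" by (rule \<kappa>_w)
  then have "int (\<kappa> r) < 2 ^ w" by (metis of_nat_less_numeral_power_cancel_iff)
  moreover have "(2::int) ^ w = 2 * 2 ^ (w - 1)" using w by (cases w) auto
  ultimately show ?thesis by (auto simp: words_def oc_def)
qed

lemma RE_refl: "s \<in> states w \<Longrightarrow> RE s [] 0 s"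
  unfolding RE_def by (simp add: macro_machine.reach_refl)

lemma RE_trans: "RE s l t s' \<Longrightarrow> RE s' l' t' s'' \<Longrightarrow> RE s (l @ l') (t + t') s''"
  unfolding RE_def by (simp add: macro_machine.reach_trans)

lemma RE_step:
  assumes "s \<in> states w" "s' \<in> states w" "io_run D (rnd w B s) = (map (\<lambda>r. oc w (\<kappa> r)) l, Some s')" "set l \<subseteq> {..<N}" "length l \<le> B"
  shows "RE s l 1 s'"
  unfolding RE_def by (rule macro_machine.reach_one) (use assms oc_word in auto)

lemma N_le: "N \<le> 2 ^ w"
proof -
  have "inj_on e {..<N}" by (rule inj_onI) (metis e_less_iff lessThan_iff linorder_neqE_nat less_irrefl)
  then have "card {..<N} = card (e ` {..<N})" by (simp add: card_image)
  also have "\<dots> \<le> card {..<(2::nat) ^ w}" using e_w by (intro card_mono) auto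
  finally show ?thesis by simp
qed

lemma in_states: "length xs \<le> 8 \<Longrightarrow> (\<And>x. x \<in> set xs \<Longrightarrow> x \<le> 6 * 2 ^ w) \<Longrightarrow> xs \<in> states w"
proof -
  assume xs: "length xs \<le> 8" "\<And>x. x \<in> set xs \<Longrightarrow> x \<le> 6 * 2 ^ w"
  have "6 * (2::nat) ^ w < 8 * 2 ^ w" by simp
  also have "8 * (2::nat) ^ w = 2 ^ (3 + w)" by (simp add: power_add)
  also have "\<dots> \<le> 2 ^ (4 * w)" using w by (intro power_increasing) auto
  finally have "6 * (2::nat) ^ w < 2 ^ (4 * w)" .
  then show ?thesis using xs unfolding states_def by (auto intro: le_less_trans)
qed

lemma w_le: "w < 2 ^ w" by (rule less_exp)

lemma two_w: "(2::nat) \<le> 2 ^ w" using w power_increasing[of 1 w "2::nat"] by simp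

lemma n_le: "n \<le> w" using fan_bounds[OF w] by simp

lemma small_state:
  assumes "pc \<le> 6" "a < 2 ^ w" "b < 2 ^ w" "c * g\<^sub>0 < N" "i \<le> 2 * n" "j \<le> 2 * n"
  shows "[pc, a, b, c, i, j] \<in> states w"
proof (rule in_states)
  have "c \<le> c * g\<^sub>0" using g1 by simp
  then have "c \<le> 2 ^ w" using assms(4) N_le by linarith
  moreover have "i \<le> 2 * 2 ^ w" "j \<le> 2 * 2 ^ w" using assms(5,6) n_le w_le by linarith+
  moreover have "pc \<le> 6 * 2 ^ w" using assms(1) two_w by linarith
  ultimately show "x \<le> 6 * 2 ^ w" if "x \<in> set [pc, a, b, c, i, j]" for x using that assms(2,3) by auto
qed simp

lemma pad_block: "map (pad ys) [m..<m + B] = take B (drop m ys) @ replicate (B - (length ys - m)) []"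
  by (rule nth_equalityI) (auto simp: pad_def nth_append min_def)

lemma outs_pad:
  assumes "\<And>r. r \<in> set xs \<Longrightarrow> en r ! 2 = \<kappa> r"
  shows "outs w a b (map (pad (map en xs)) [m..<m + B]) =
    map (\<lambda>r. oc w (\<kappa> r)) (filter (\<lambda>r. passes a b (en r)) (take B (drop m xs)))"
proof -
  have "filter (passes a b) (replicate k []) = []" for k by (simp add: passes_def)
  then have "outs w a b (map (pad (map en xs)) [m..<m + B]) = map (\<lambda>x. oc w (x ! 2)) (filter (passes a b) (map en (take B (drop m xs))))"
    unfolding outs_def pad_block by (simp add: take_map drop_map)
  also have "\<dots> = map (\<lambda>r. oc w (en r ! 2)) (filter (\<lambda>r. passes a b (en r)) (take B (drop m xs)))"
    by (simp add: filter_map comp_def)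
  also have "\<dots> = map (\<lambda>r. oc w (\<kappa> r)) (filter (\<lambda>r. passes a b (en r)) (take B (drop m xs)))"
    using assms by (intro map_cong refl) (metis (no_types, lifting) filter_is_subset in_set_dropD in_set_takeD subsetD)
  finally show ?thesis .
qed

text \<open>p is the length of the prefix on which P holds. As p is at most the truncated length,
  the stored part suffices. The last block may reach beyond the prefix, but the filter implies
  P.\<close>

lemma RE_scan:
  assumes i: "i < 11" and Yi: "\<And>q. q < g\<^sub>0 \<Longrightarrow> Y i (c * g\<^sub>0 + q) = pad (map en xs) q"
    and st: "\<And>j. j \<le> n \<Longrightarrow> st j \<in> states w"
    and rn: "\<And>j. j \<le> n \<Longrightarrow> io_run D (rnd w B (st j)) = io_run D (scan_rnd w B a b i c j P (st (Suc j)) s')"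
    and p: "p \<le> g\<^sub>0" "\<And>q. q < length xs \<Longrightarrow> P (en (xs ! q)) \<longleftrightarrow> q < p" "p \<le> length xs"
    and ps: "\<And>r. r \<in> set xs \<Longrightarrow> passes a b (en r) \<Longrightarrow> P (en r)"
    and en: "\<And>r. r \<in> set xs \<Longrightarrow> en r \<noteq> [] \<and> en r ! 2 = \<kappa> r" and xs: "set xs \<subseteq> {..<N}" "distinct xs"
  shows "\<exists>l t J. RE (st 0) l t (st J) \<and> st J \<in> states w \<and> io_run D (rnd w B (st J)) = ([], s') \<and> t \<le> p div B + 1 \<and>
    distinct l \<and> set l = {r \<in> set xs. passes a b (en r)}"
proof -
  let ?l = "\<lambda>J. filter (\<lambda>r. passes a b (en r)) (take (J * B) xs)"
  define J where "J = (p + B - 1) div B"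
  have J_iff: "j < J \<longleftrightarrow> j * B < p" for j unfolding J_def by (rule less_ceil_div_iff[OF B])
  have blk: "io_run D (gb w B i (c * n + j)) = map (pad (map en xs)) [j * B..<j * B + B]" if j: "j < n" for j
  proof -
    have "j * B + q < g\<^sub>0" if "q < B" for q
    proof -
      have "Suc j * B \<le> n * B" using j by (intro mult_le_mono1) simp
      then show ?thesis using that nB by simp
    qed
    then have "Y i ((c * n + j) * B + q) = pad (map en xs) (j * B + q)" if "q < B" for q
      using Yi[of "j * B + q"] that by (simp add: nB algebra_simps)
    then show ?thesis using i by (intro nth_equalityI) auto
  qed
  have Jn: "J \<le> n" using J_iff[of n] p(1) nB by (metis leI linorder_not_less)
  have test: "io_run D (rnd w B (st j)) = (if j < J then
      (map (\<lambda>r. oc w (\<kappa> r)) (filter (\<lambda>r. passes a b (en r)) (take B (drop (j * B) xs))), Some (st (Suc j))) else ([], s'))"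
    if j: "j \<le> n" for j
  proof (cases "j < n")
    case True
    have hd: "map (pad (map en xs)) [j * B..<j * B + B] ! 0 = pad (map en xs) (j * B)" using B by simp
    have "(pad (map en xs) (j * B) \<noteq> [] \<and> P (pad (map en xs) (j * B))) \<longleftrightarrow> j < J"
      using p(2)[of "j * B"] p(3) en[of "xs ! (j * B)"] J_iff[of j] by (auto simp: pad_def)
    then show ?thesis unfolding rn[OF j] scan_rnd_def
      using True blk[OF True] hd outs_pad[of xs en a b "j * B"] en by simp
  next
    case False
    then show ?thesis using rn[OF j] Jn by (simp add: scan_rnd_def)
  qed
  have "RE (st 0) (?l J') J' (st J')" if "J' \<le> J" for J'
    using that
  proof (induction J')
    case 0
    then show ?case using RE_refl[OF st[of 0]] by simp
  next
    case (Suc J')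
    let ?b = "filter (\<lambda>r. passes a b (en r)) (take B (drop (J' * B) xs))"
    have "RE (st J') ?b 1 (st (Suc J'))"
    proof (rule RE_step)
      show "io_run D (rnd w B (st J')) = (map (\<lambda>r. oc w (\<kappa> r)) ?b, Some (st (Suc J')))"
        using test[of J'] Suc.prems Jn by simp
      show "set ?b \<subseteq> {..<N}" using xs(1) by (meson filter_is_subset set_drop_subset set_take_subset subset_trans)
      show "length ?b \<le> B" by (rule le_trans[OF length_filter_le]) simp
    qed (use st Suc.prems Jn in auto)
    then have "RE (st 0) (?l J' @ ?b) (J' + 1) (st (Suc J'))" using Suc by (intro RE_trans) auto
    moreover have "?l J' @ ?b = ?l (Suc J')" by (simp add: take_add add.commute[of B] flip: filter_append)
    ultimately show ?case by simp
  qed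
  then have "RE (st 0) (?l J) J (st J)" by simp
  moreover have "set (?l J) = {r \<in> set xs. passes a b (en r)}"
  proof
    show "set (?l J) \<subseteq> {r \<in> set xs. passes a b (en r)}" by (auto dest: in_set_takeD)
    show "{r \<in> set xs. passes a b (en r)} \<subseteq> set (?l J)"
    proof
      fix r assume r: "r \<in> {r \<in> set xs. passes a b (en r)}"
      then obtain q where q: "q < length xs" "r = xs ! q" by (auto simp: in_set_conv_nth)
      have "P (en r)" using ps r by simp
      then have "q < p" using p(2) q by simp
      moreover have "p \<le> J * B" using J_iff[of J] by simp
      ultimately have "q < J * B" by simp
      then have "r \<in> set (take (J * B) xs)" using q by (auto simp: in_set_conv_nth)
      then show "r \<in> set (?l J)" using r by simp
    qed
  qed
  moreover have "J \<le> p div B + 1"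
  proof -
    have "J \<le> (p + B) div B" unfolding J_def by (rule div_le_mono) simp
    then show ?thesis using B by simp
  qed
  ultimately show ?thesis using st[OF Jn] test[OF Jn] xs(2) by (intro exI[of _ "?l J"] exI[of _ J]) auto
qed

lemma passes_ent: "r < N \<Longrightarrow> passes a b (ent r) \<longleftrightarrow> r \<in> Rep a b"
  by (auto simp: passes_def ent_def Rep_def inrange_def)

context
  fixes a b c
  assumes a: "a < 2 ^ w" and b: "b < 2 ^ w" and c: "c * g\<^sub>0 < N" and meet: "inrange a b \<inter> window c \<noteq> {}"
begin

text \<open>Since the range meets the window, b does not restrict the elements to its left, nor a
  those to its right. Hence each side list is compared with one end only.\<close>

lemma below_window: "s < c * g\<^sub>0 \<Longrightarrow> e s \<le> b"
proof -
  assume s: "s < c * g\<^sub>0"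
  obtain r where r: "c * g\<^sub>0 \<le> r" "r < N" "e r \<le> b" using meet by (auto simp: inrange_def window_def)
  then show ?thesis using e_le[of s r] s by simp
qed

lemma above_window: "(c + 2) * g\<^sub>0 \<le> s \<Longrightarrow> s < N \<Longrightarrow> a \<le> e s"
proof -
  assume s: "(c + 2) * g\<^sub>0 \<le> s" "s < N"
  obtain r where r: "r < c * g\<^sub>0 + 2 * g\<^sub>0" "a \<le> e r" using meet by (auto simp: inrange_def window_def)
  have "r \<le> s" using r s by (simp add: algebra_simps)
  then show ?thesis using e_le[of r s] s r by simp
qed

lemma left_list_prefix:
  defines "xs \<equiv> rev (sorted_list_of_set (LB (c * g\<^sub>0)))"
  shows "distinct xs" "set xs = LB (c * g\<^sub>0)"
    "q < length xs \<Longrightarrow> a \<le> e (xs ! q) \<longleftrightarrow> q < card {s \<in> LB (c * g\<^sub>0). a \<le> e s}"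
proof -
  show d: "distinct xs" and s: "set xs = LB (c * g\<^sub>0)" by (simp_all add: xs_def finite_LB)
  have mono: "e (xs ! j) \<le> e (xs ! i)" if "i < j" "j < length xs" for i j
  proof -
    have "sorted (rev xs)" by (simp add: xs_def)
    then have "xs ! j \<le> xs ! i" using that by (simp add: sorted_rev_nth_mono)
    moreover have "xs ! i < N" using nth_mem[of i xs] s that c by (auto simp: LB_def)
    ultimately show ?thesis by (rule e_le)
  qed
  assume "q < length xs"
  then show "a \<le> e (xs ! q) \<longleftrightarrow> q < card {s \<in> LB (c * g\<^sub>0). a \<le> e s}"
    unfolding s[symmetric] by (intro prefix_card[OF d]) (use mono le_trans in blast)
qed

lemma left_overflow:
  "Y 2 (c * g\<^sub>0 + (g\<^sub>0 - 1)) \<noteq> [] \<and> a \<le> Y 2 (c * g\<^sub>0 + (g\<^sub>0 - 1)) ! 0 \<longleftrightarrow> g\<^sub>0 \<le> card {s \<in> LB (c * g\<^sub>0). a \<le> e s}"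
proof -
  let ?xs = "rev (sorted_list_of_set (LB (c * g\<^sub>0)))"
  have len: "card {s \<in> LB (c * g\<^sub>0). a \<le> e s} \<le> length ?xs"
    using card_mono[of "LB (c * g\<^sub>0)" "{s \<in> LB (c * g\<^sub>0). a \<le> e s}"] by (simp add: finite_LB length_sorted_list_of_set)
  have y: "Y 2 (c * g\<^sub>0 + (g\<^sub>0 - 1)) = pad (map entl ?xs) (g\<^sub>0 - 1)" using Y2[OF c, of "g\<^sub>0 - 1"] g1 by simp
  show ?thesis
  proof (cases "g\<^sub>0 - 1 < length ?xs")
    case True
    then have "Y 2 (c * g\<^sub>0 + (g\<^sub>0 - 1)) = entl (?xs ! (g\<^sub>0 - 1))" unfolding y by (simp add: pad_def)
    then show ?thesis using left_list_prefix(3)[OF True] g1 by (simp add: entl_def) linarith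
  next
    case False
    then show ?thesis unfolding y using len g1 by (simp add: pad_def)
  qed
qed

lemma right_list_prefix:
  defines "xs \<equiv> sorted_list_of_set (RB ((c + 2) * g\<^sub>0))"
  shows "distinct xs" "set xs = RB ((c + 2) * g\<^sub>0)"
    "q < length xs \<Longrightarrow> e (xs ! q) \<le> b \<longleftrightarrow> q < card {s \<in> RB ((c + 2) * g\<^sub>0). e s \<le> b}"
proof -
  show d: "distinct xs" and s: "set xs = RB ((c + 2) * g\<^sub>0)" by (simp_all add: xs_def finite_RB)
  have mono: "e (xs ! i) \<le> e (xs ! j)" if "i < j" "j < length xs" for i j
  proof -
    have "sorted xs" by (simp add: xs_def)
    then have "xs ! i \<le> xs ! j" using that by (simp add: sorted_nth_mono)
    moreover have "xs ! j < N" using nth_mem[of j xs] s that by (auto simp: RB_def)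
    ultimately show ?thesis by (rule e_le)
  qed
  assume "q < length xs"
  then show "e (xs ! q) \<le> b \<longleftrightarrow> q < card {s \<in> RB ((c + 2) * g\<^sub>0). e s \<le> b}"
    unfolding s[symmetric] by (intro prefix_card[OF d]) (use mono le_trans in blast)
qed

lemma right_overflow:
  "Y 3 (c * g\<^sub>0 + (g\<^sub>0 - 1)) \<noteq> [] \<and> Y 3 (c * g\<^sub>0 + (g\<^sub>0 - 1)) ! 0 \<le> b \<longleftrightarrow> g\<^sub>0 \<le> card {s \<in> RB ((c + 2) * g\<^sub>0). e s \<le> b}"
proof -
  let ?xs = "sorted_list_of_set (RB ((c + 2) * g\<^sub>0))"
  have len: "card {s \<in> RB ((c + 2) * g\<^sub>0). e s \<le> b} \<le> length ?xs"
    using card_mono[of "RB ((c + 2) * g\<^sub>0)" "{s \<in> RB ((c + 2) * g\<^sub>0). e s \<le> b}"] by (simp add: finite_RB length_sorted_list_of_set)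
  have y: "Y 3 (c * g\<^sub>0 + (g\<^sub>0 - 1)) = pad (map ent ?xs) (g\<^sub>0 - 1)" using Y3[OF c, of "g\<^sub>0 - 1"] g1 by simp
  show ?thesis
  proof (cases "g\<^sub>0 - 1 < length ?xs")
    case True
    then have "Y 3 (c * g\<^sub>0 + (g\<^sub>0 - 1)) = ent (?xs ! (g\<^sub>0 - 1))" unfolding y by (simp add: pad_def)
    then show ?thesis using right_list_prefix(3)[OF True] g1 by (simp add: ent_def) linarith
  next
    case False
    then show ?thesis unfolding y using len g1 by (simp add: pad_def)
  qed
qed

lemma scan_left:
  assumes i: "i \<le> 2 * n" and small: "card {s \<in> LB (c * g\<^sub>0). a \<le> e s} \<le> g\<^sub>0"
  shows "\<exists>l t. RE [1, a, b, c, i, 0] l t [2, a, b, c, i, i - 1] \<and> t \<le> card {s \<in> LB (c * g\<^sub>0). a \<le> e s} div B + 2 \<and>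
    distinct l \<and> set l = {s \<in> LB (c * g\<^sub>0). a \<le> e s}"
proof -
  let ?xs = "rev (sorted_list_of_set (LB (c * g\<^sub>0)))" and ?p = "card {s \<in> LB (c * g\<^sub>0). a \<le> e s}"
  let ?st = "\<lambda>j. [1, a, b, c, i, j]"
  note lp = left_list_prefix
  have LBN: "r < N" "e r \<le> b" if "r \<in> LB (c * g\<^sub>0)" for r
    using that c below_window[of r] by (auto simp: LB_def)
  have "\<exists>l t J. RE (?st 0) l t (?st J) \<and> ?st J \<in> states w \<and> io_run D (rnd w B (?st J)) = ([], Some [2, a, b, c, i, i - 1]) \<and>
    t \<le> ?p div B + 1 \<and> distinct l \<and> set l = {r \<in> set ?xs. passes a b (entl r)}"
  proof (rule RE_scan[where c = c and i = 2 and P = "\<lambda>x. a \<le> x ! 0"])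
    show "Y 2 (c * g\<^sub>0 + q) = pad (map entl ?xs) q" if "q < g\<^sub>0" for q using Y2[OF c that] .
    show "?st j \<in> states w" if "j \<le> n" for j using that i a b c by (intro small_state) auto
    show "io_run D (rnd w B (?st j)) = io_run D (scan_rnd w B a b 2 c j (\<lambda>x. a \<le> x ! 0) (?st (Suc j)) (Some [2, a, b, c, i, i - 1]))" for j
      by (simp add: rnd_def)
    show "a \<le> entl (?xs ! q) ! 0 \<longleftrightarrow> q < ?p" if "q < length ?xs" for q
      using lp(3)[OF that] by (simp add: entl_def)
    show "?p \<le> length ?xs"
      using card_mono[of "LB (c * g\<^sub>0)" "{s \<in> LB (c * g\<^sub>0). a \<le> e s}"] by (simp add: finite_LB length_sorted_list_of_set)
    show "set ?xs \<subseteq> {..<N}" using LBN lp(2) by auto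
  qed (use small lp(1) in \<open>auto simp: entl_def passes_def\<close>)
  then obtain l t J where l: "RE (?st 0) l t (?st J)" "?st J \<in> states w" "io_run D (rnd w B (?st J)) = ([], Some [2, a, b, c, i, i - 1])"
    "t \<le> ?p div B + 1" "distinct l" "set l = {r \<in> set ?xs. passes a b (entl r)}" by blast
  have "set l = {s \<in> LB (c * g\<^sub>0). a \<le> e s}" unfolding l(6) lp(2) using LBN by (auto simp: entl_def passes_def)
  moreover have "RE (?st J) [] 1 [2, a, b, c, i, i - 1]"
    by (rule RE_step[OF l(2) small_state]) (use l i a b c in auto)
  then have "RE (?st 0) l (t + 1) [2, a, b, c, i, i - 1]" using RE_trans[OF l(1)] by fastforce
  ultimately show ?thesis using l by (intro exI[of _ l] exI[of _ "t + 1"]) auto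
qed

lemma scan_right:
  assumes i: "i \<le> 2 * n" and small: "card {s \<in> RB ((c + 2) * g\<^sub>0). e s \<le> b} \<le> g\<^sub>0"
  shows "\<exists>l t s. RE [3, a, b, c, i, 0] l t s \<and> s \<in> states w \<and> io_run D (rnd w B s) = ([], None) \<and>
    t \<le> card {s \<in> RB ((c + 2) * g\<^sub>0). e s \<le> b} div B + 1 \<and>
    distinct l \<and> set l = {r \<in> Rep a b. (c + 2) * g\<^sub>0 \<le> r}"
proof -
  let ?xs = "sorted_list_of_set (RB ((c + 2) * g\<^sub>0))" and ?p = "card {s \<in> RB ((c + 2) * g\<^sub>0). e s \<le> b}"
  let ?st = "\<lambda>j. [3, a, b, c, i, j]"
  note lp = right_list_prefix
  have "\<exists>l t J. RE (?st 0) l t (?st J) \<and> ?st J \<in> states w \<and> io_run D (rnd w B (?st J)) = ([], None) \<and>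
    t \<le> ?p div B + 1 \<and> distinct l \<and> set l = {r \<in> set ?xs. passes a b (ent r)}"
  proof (rule RE_scan[where c = c and i = 3 and P = "\<lambda>x. x ! 0 \<le> b"])
    show "Y 3 (c * g\<^sub>0 + q) = pad (map ent ?xs) q" if "q < g\<^sub>0" for q using Y3[OF c that] .
    show "?st j \<in> states w" if "j \<le> n" for j using that i a b c by (intro small_state) auto
    show "io_run D (rnd w B (?st j)) = io_run D (scan_rnd w B a b 3 c j (\<lambda>x. x ! 0 \<le> b) (?st (Suc j)) None)" for j
      by (simp add: rnd_def)
    show "ent (?xs ! q) ! 0 \<le> b \<longleftrightarrow> q < ?p" if "q < length ?xs" for q
      using lp(3)[OF that] by (simp add: ent_def)
    show "?p \<le> length ?xs"
      using card_mono[of "RB ((c + 2) * g\<^sub>0)" "{s \<in> RB ((c + 2) * g\<^sub>0). e s \<le> b}"] by (simp add: finite_RB length_sorted_list_of_set)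
    show "set ?xs \<subseteq> {..<N}" unfolding lp(2) by (auto simp: RB_def)
  qed (use small lp(1) in \<open>auto simp: ent_def passes_def\<close>)
  then obtain l t J where l: "RE (?st 0) l t (?st J)" "?st J \<in> states w" "io_run D (rnd w B (?st J)) = ([], None)"
    "t \<le> ?p div B + 1" "distinct l" "set l = {r \<in> set ?xs. passes a b (ent r)}" by blast
  have "set l = {r \<in> Rep a b. (c + 2) * g\<^sub>0 \<le> r}"
  proof
    show "set l \<subseteq> {r \<in> Rep a b. (c + 2) * g\<^sub>0 \<le> r}" unfolding l(6) lp(2) using passes_ent by (auto simp: RB_def)
    show "{r \<in> Rep a b. (c + 2) * g\<^sub>0 \<le> r} \<subseteq> set l"
    proof
      fix r assume r: "r \<in> {r \<in> Rep a b. (c + 2) * g\<^sub>0 \<le> r}"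
      then have rN: "r < N" "pf r \<le> a" by (auto simp: Rep_def inrange_def)
      \<comment> \<open>A predecessor right of the window would itself be at least a, and r would
        not be the first of its colour in the range.\<close>
      have "pv r \<le> (c + 2) * g\<^sub>0"
      proof (rule ccontr)
        assume gt: "\<not> ?thesis"
        then have "(c + 2) * g\<^sub>0 \<le> pv r - 1" "pv r - 1 < N" using pv_pos(1)[of r] rN by auto
        then have "a \<le> e (pv r - 1)" by (rule above_window)
        then show False using rN(2) gt by (simp add: pf_def split: if_splits)
      qed
      then show "r \<in> set l" unfolding l(6) lp(2) using r rN passes_ent[OF rN(1)] by (auto simp: RB_def)
    qed
  qed
  then show ?thesis using l by blast
qed

end

end

section \<open>Walking over the segments of the window\<close>

context cquery begin

context
  fixes a b c
  assumes a: "a < 2 ^ w" and b: "b < 2 ^ w" and c: "c * g\<^sub>0 < N" and meet: "inrange a b \<inter> window c \<noteq> {}"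
begin

abbreviation (input) \<beta> where "\<beta> \<equiv> c * g\<^sub>0"
abbreviation (input) i where "i \<equiv> lead c a"
abbreviation (input) E' where "E' \<equiv> E c (lead c a)"
abbreviation (input) leader where "leader x \<equiv> e (c * g\<^sub>0 + x * B)"

lemma i_le: "i \<le> 2 * n" using lead_le[of c a] nb_le[of c] by simp

lemma E'_sub: "E' \<subseteq> {1..<nb c}" using chain_sub[OF c i_le] by simp

lemma leader_gt: "i \<le> x \<Longrightarrow> x < nb c \<Longrightarrow> a < leader x"
  using lead_iff[of x c a] by simp

text \<open>The predecessor is below a and hence before leader i, so the segmentation for time i
  keeps every first occurrence.\<close>

lemma Rep_alive:
  assumes r: "r \<in> Rep a b" "r \<in> window c" shows "pv r \<le> \<beta> + i * B"
proof (rule ccontr)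
  assume gt: "\<not> ?thesis"
  have rN: "r < N" "pf r \<le> a" "r < \<beta> + 2 * g\<^sub>0" using r by (auto simp: Rep_def inrange_def window_def)
  let ?s = "pv r - 1"
  have s: "?s < r" "\<beta> + i * B \<le> ?s" using gt pv_pos(1)[of r] by auto
  have es: "e ?s < a" using rN(2) gt by (auto simp: pf_def split: if_splits)
  have "i * B < 2 * n * B" using s rN nB by linarith
  then have "i < nb c" using s rN by (simp add: nb_iff)
  then have "a < leader i" using leader_gt by simp
  moreover have "leader i \<le> e ?s" using s rN by (intro e_le) auto
  ultimately show False using es by simp
qed

lemma seg_window: "r < N \<Longrightarrow> \<beta> + lo * B \<le> r \<Longrightarrow> r < \<beta> + hi * B \<Longrightarrow> hi \<le> nb c \<Longrightarrow> r \<in> window c"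
proof -
  assume r: "r < N" "\<beta> + lo * B \<le> r" "r < \<beta> + hi * B" "hi \<le> nb c"
  have "hi * B \<le> 2 * n * B" using r(4) nb_le[of c] by (intro mult_le_mono1) simp
  moreover have "2 * n * B = 2 * g\<^sub>0" by (simp add: nB)
  ultimately have "\<beta> \<le> r" "r < \<beta> + 2 * g\<^sub>0" using r by linarith+
  then show ?thesis using r(1) unfolding window_def by blast
qed

lemma seg_ranks:
  assumes "r \<in> seg_union (alive B \<beta> j) lo hi" shows "\<beta> + lo * B \<le> r" "r < \<beta> + hi * B" "r < N" "pv r \<le> \<beta> + j * B"
proof -
  obtain y where y: "lo \<le> y" "y < hi" "\<beta> + y * B \<le> r" "r < \<beta> + y * B + B" "r < N" "pv r \<le> \<beta> + j * B"
    using assms by (auto simp: seg_union_def alive_def)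
  have "lo * B \<le> y * B" "y * B + B \<le> hi * B" 
    using y mult_le_mono1[of lo y B] mult_le_mono1[of "Suc y" hi B] by simp_all
  then show "\<beta> + lo * B \<le> r" "r < \<beta> + hi * B" using y by linarith+
  show "r < N" "pv r \<le> \<beta> + j * B" using y by auto
qed

lemma seg_ranksI:
  assumes "\<beta> + lo * B \<le> r" "r < \<beta> + hi * B" "r < N" "pv r \<le> \<beta> + j * B"
  shows "r \<in> seg_union (alive B \<beta> j) lo hi"
proof -
  let ?y = "(r - \<beta>) div B"
  have "?y * B \<le> r - \<beta>" "r - \<beta> < ?y * B + B"
    using div_mult_mod_eq[of "r - \<beta>" B] mod_less_divisor[of B "r - \<beta>"] B by linarith+
  then have y: "\<beta> + ?y * B \<le> r" "r < \<beta> + ?y * B + B" using assms(1) by linarith+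
  have "lo * B < Suc ?y * B" "?y * B < hi * B" using y assms(1,2) by (simp, linarith)+
  then have "lo < Suc ?y" "?y < hi" by (metis mult_less_cancel2)+
  then show ?thesis using y assms by (auto simp: seg_union_def alive_def intro!: bexI[of _ ?y])
qed

text \<open>A snapshot may date from a later time and hold extra elements. They all belong to the
  segment, and the filter removes them.\<close>

lemma segment_block:
  assumes x: "x < nb c"
  defines "lo \<equiv> seg_lo E' x" and "hi \<equiv> seg_hi (nb c) E' x"
  shows "\<exists>rk. io_run D (if hi = Suc lo then gb w B 1 (c * n + lo)
       else gb w B 4 (c * (2 * n) + the_elem (F c i \<inter> {lo<..<hi}))) = map (pad (map ent rk)) [0..<0 + B] \<and>
     set rk \<subseteq> {..<N} \<and> distinct rk \<and> length rk \<le> B \<and>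
     {r \<in> set rk. r \<in> Rep a b} = {r \<in> Rep a b. \<beta> + lo * B \<le> r \<and> r < \<beta> + hi * B}"
proof -
  note sp = seg_props[OF E'_sub x, folded lo_def hi_def]
  show ?thesis
  proof (cases "hi = Suc lo")
    case True
    let ?m = "\<beta> + lo * B"
    let ?rk = "[?m..<min N (?m + B)]"
    have base: "(c * n + lo) * B = ?m" by (simp add: nB algebra_simps)
    have "Y (Suc 0) (?m + q) = pad (map ent ?rk) q" if "q < B" for q
      using that by (auto simp: Y1s pad_def)
    then have "io_run D (gb w B 1 (c * n + lo)) = map (pad (map ent ?rk)) [0..<0 + B]"
      by (simp add: base)
    moreover have "{r \<in> set ?rk. r \<in> Rep a b} = {r \<in> Rep a b. \<beta> + lo * B \<le> r \<and> r < \<beta> + hi * B}"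
      unfolding True by (auto simp: Rep_def inrange_def)
    ultimately show ?thesis using True by (intro exI[of _ ?rk]) auto
  next
    case False
    obtain z where z: "F c i \<inter> {lo<..<hi} = {z}" "seg_union (alive B \<beta> i) lo hi \<subseteq> snap c z"
      "snap c z \<subseteq> seg_union (alive B \<beta> (2 * n)) lo hi"
      using chain_seg[OF c i_le x, folded lo_def hi_def] False by blast
    have "z \<in> F c i" using z(1) by blast
    then have zn: "z < 2 * n" using chain_sub[OF c i_le] nb_le[of c] by fastforce
    let ?rk = "sorted_list_of_set (snap c z)"
    have sn: "finite (snap c z)" "card (snap c z) \<le> B" using chain_snap[OF c] by auto
    have te: "the_elem (F c i \<inter> {lo<..<hi}) = z" unfolding z(1) by simp
    have "io_run D (gb w B 4 (c * (2 * n) + z)) = map (pad (map ent ?rk)) [0..<0 + B]"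
      using Y4[OF c zn] by simp
    moreover have "{r \<in> set ?rk. r \<in> Rep a b} = {r \<in> Rep a b. \<beta> + lo * B \<le> r \<and> r < \<beta> + hi * B}"
    proof
      show "{r \<in> set ?rk. r \<in> Rep a b} \<subseteq> {r \<in> Rep a b. \<beta> + lo * B \<le> r \<and> r < \<beta> + hi * B}"
        using z(3) seg_ranks[of _ "2 * n" lo hi] sn(1) by auto
      show "{r \<in> Rep a b. \<beta> + lo * B \<le> r \<and> r < \<beta> + hi * B} \<subseteq> {r \<in> set ?rk. r \<in> Rep a b}"
      proof
        fix r assume r: "r \<in> {r \<in> Rep a b. \<beta> + lo * B \<le> r \<and> r < \<beta> + hi * B}"
        then have rN: "r < N" by (auto simp: Rep_def inrange_def)
        then have "r \<in> window c" using seg_window[of r lo hi] r sp(3) by simp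
        then have "pv r \<le> \<beta> + i * B" using Rep_alive r by blast
        then have "r \<in> seg_union (alive B \<beta> i) lo hi" using r rN by (intro seg_ranksI) auto
        then show "r \<in> {r \<in> set ?rk. r \<in> Rep a b}" using z(2) r sn(1) by auto
      qed
    qed
    moreover have "set ?rk \<subseteq> {..<N}" using z(3) seg_ranks(3)[of _ "2 * n" lo hi] sn(1) by auto
    ultimately show ?thesis using False te sn by (intro exI[of _ ?rk]) (auto simp: length_sorted_list_of_set)
  qed
qed

lemma walk_step:
  assumes x: "x < nb c" "leader x \<le> b"
  shows "\<exists>l. RE [2, a, b, c, i, x] l 1 [2, a, b, c, i, seg_hi (nb c) E' x] \<and> distinct l \<and>
    set l = {r \<in> Rep a b. \<beta> + seg_lo E' x * B \<le> r \<and> r < \<beta> + seg_hi (nb c) E' x * B}"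
proof -
  let ?lo = "seg_lo E' x" and ?hi = "seg_hi (nb c) E' x"
  obtain rk where rk: "io_run D (if ?hi = Suc ?lo then gb w B 1 (c * n + ?lo)
       else gb w B 4 (c * (2 * n) + the_elem (F c i \<inter> {?lo<..<?hi}))) = map (pad (map ent rk)) [0..<0 + B]"
     "set rk \<subseteq> {..<N}" "distinct rk" "length rk \<le> B"
     "{r \<in> set rk. r \<in> Rep a b} = {r \<in> Rep a b. \<beta> + ?lo * B \<le> r \<and> r < \<beta> + ?hi * B}"
    using segment_block[OF x(1)] by blast
  let ?l = "filter (\<lambda>r. passes a b (ent r)) rk"
  have xn: "x < 2 * n" "\<beta> + x * B < N" using x by (auto simp: nb_iff)
  have o: "outs w a b (map (pad (map ent rk)) [0..<0 + B]) = map (\<lambda>r. oc w (\<kappa> r)) ?l"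
    using outs_pad[of rk ent a b 0] rk(4) by (simp add: ent_def)
  have "io_run D (rnd w B [2, a, b, c, i, x]) = (map (\<lambda>r. oc w (\<kappa> r)) ?l, Some [2, a, b, c, i, ?hi])"
  proof -
    let ?W = "Y 5 (c * (2 * n + 1) + i)"
    have W: "dec_E ?W = E'" "dec_F ?W = F c i" "length ?W = nb c" using Y5[OF c lead_le] by auto
    have cond: "x < 2 * n \<and> Y 1 (\<beta> + x * B) \<noteq> [] \<and> Y 1 (\<beta> + x * B) ! 0 \<le> b" using xn x by (simp add: Y1s ent_def)
    have "io_run D (walk_rnd w B a b c i x) = (map (\<lambda>r. oc w (\<kappa> r)) ?l, Some [2, a, b, c, i, ?hi])"
      unfolding walk_rnd_def io_run_bind Let_def
      using cond rk(1) o by (simp only: run_gt[of 1] run_gt[of 5] W if_True simp_thms io_run_bind io_run.simps)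
    then show ?thesis by (simp add: rnd_def)
  qed
  moreover have "seg_hi (nb c) E' x \<le> 2 * n" using seg_props(3)[OF E'_sub x(1)] nb_le[of c] by simp
  ultimately have "RE [2, a, b, c, i, x] ?l 1 [2, a, b, c, i, ?hi]"
    using a b c i_le xn rk(2,4) by (intro RE_step small_state) (auto intro: le_trans[OF length_filter_le])
  moreover have "set ?l = {r \<in> set rk. r \<in> Rep a b}" using passes_ent rk(2) by auto
  ultimately show ?thesis using rk(3,5) by (intro exI[of _ ?l]) auto
qed

definition visited :: "nat \<Rightarrow> nat set" where
  "visited x = {z \<in> E'. x \<le> z \<and> leader z \<le> b}"

lemma finite_visited: "finite (visited x)"
proof -
  have "finite E'" by (rule finite_subset[OF E'_sub]) simp
  then show ?thesis by (simp add: visited_def)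
qed

lemma walk_rest:
  assumes "x \<in> insert (nb c) E'"
  shows "\<exists>l t. RE [2, a, b, c, i, x] l t [3, a, b, c, i, 0] \<and> distinct l \<and>
    set l = {r \<in> Rep a b. r \<in> window c \<and> \<beta> + x * B \<le> r} \<and> t \<le> card (visited x) + 1"
  using assms
proof (induction "nb c - x" arbitrary: x rule: less_induct)
  case less
  have xnb: "x \<le> nb c" using less.prems E'_sub by auto
  show ?case
  proof (cases "x < nb c \<and> leader x \<le> b")
    case True
    then have xE: "x \<in> E'" using less.prems by auto
    let ?hi = "seg_hi (nb c) E' x"
    note sp = seg_props[OF E'_sub conjunct1[OF True]]
    have lo: "seg_lo E' x = x" by (rule seg_boundary(1)[OF E'_sub xE])
    obtain l where l: "RE [2, a, b, c, i, x] l 1 [2, a, b, c, i, ?hi]" "distinct l"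
      "set l = {r \<in> Rep a b. \<beta> + x * B \<le> r \<and> r < \<beta> + ?hi * B}" using walk_step[of x] True lo by auto
    obtain l' t where l': "RE [2, a, b, c, i, ?hi] l' t [3, a, b, c, i, 0]" "distinct l'"
      "set l' = {r \<in> Rep a b. r \<in> window c \<and> \<beta> + ?hi * B \<le> r}" "t \<le> card (visited ?hi) + 1"
    proof -
      have "nb c - ?hi < nb c - x" using sp(2,3) by linarith
      then show ?thesis using less.hyps[OF _ sp(5)] that by blast
    qed
    have "insert x (visited ?hi) \<subseteq> visited x" "x \<notin> visited ?hi" using xE True sp(2) by (auto simp: visited_def)
    then have "Suc (card (visited ?hi)) \<le> card (visited x)"
      using card_mono[OF finite_visited, of "insert x (visited ?hi)" x] finite_visited by simp
    then have "1 + t \<le> card (visited x) + 1" using l'(4) by linarith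
    moreover have sub: "set l \<subseteq> window c"
      unfolding l(3) using seg_window[OF _ _ _ sp(3), of _ x] Rep_subset by (auto simp: inrange_def)
    have xh: "x * B \<le> ?hi * B" using sp(2) by simp
    have "set (l @ l') = {r \<in> Rep a b. r \<in> window c \<and> \<beta> + x * B \<le> r}"
    proof
      show "set (l @ l') \<subseteq> {r \<in> Rep a b. r \<in> window c \<and> \<beta> + x * B \<le> r}"
      proof
        fix r assume "r \<in> set (l @ l')"
        then consider "r \<in> set l" | "r \<in> set l'" by auto
        then show "r \<in> {r \<in> Rep a b. r \<in> window c \<and> \<beta> + x * B \<le> r}"
        proof cases
          case 1
          then show ?thesis using sub l(3) by blast
        next
          case 2
          then have "r \<in> Rep a b" "r \<in> window c" "\<beta> + ?hi * B \<le> r" using l'(3) by auto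
          moreover from this(3) have "\<beta> + x * B \<le> r" using xh by linarith
          ultimately show ?thesis by blast
        qed
      qed
      show "{r \<in> Rep a b. r \<in> window c \<and> \<beta> + x * B \<le> r} \<subseteq> set (l @ l')"
      proof
        fix r assume "r \<in> {r \<in> Rep a b. r \<in> window c \<and> \<beta> + x * B \<le> r}"
        then show "r \<in> set (l @ l')" using l(3) l'(3) by (cases "r < \<beta> + ?hi * B") auto
      qed
    qed
    moreover have "distinct (l @ l')" using l(2,3) l'(2,3) by auto
    ultimately show ?thesis using RE_trans[OF l(1) l'(1)] by blast
  next
    case False
    have cond: "\<not> (x < 2 * n \<and> Y 1 (\<beta> + x * B) \<noteq> [] \<and> Y 1 (\<beta> + x * B) ! 0 \<le> b)"
      using False by (auto simp: Y1s ent_def nb_iff)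
    have "io_run D (walk_rnd w B a b c i x) = ([], Some [3, a, b, c, i, 0])"
      unfolding walk_rnd_def io_run_bind
      using cond by (simp only: run_gt[of 1] run_gt[of 5] if_False io_run.simps)
    then have "io_run D (rnd w B [2, a, b, c, i, x]) = (map (\<lambda>r. oc w (\<kappa> r)) [], Some [3, a, b, c, i, 0])"
      by (simp add: rnd_def)
    then have "RE [2, a, b, c, i, x] [] 1 [3, a, b, c, i, 0]"
      using a b c i_le xnb nb_le[of c] by (intro RE_step small_state) auto
    moreover have "{r \<in> Rep a b. r \<in> window c \<and> \<beta> + x * B \<le> r} = {}"
    proof (rule ccontr)
      assume "\<not> ?thesis"
      then obtain r where r: "r \<in> Rep a b" "r \<in> window c" "\<beta> + x * B \<le> r" by blast
      obtain y where y: "y < nb c" "\<beta> + y * B \<le> r" "r < \<beta> + y * B + B" using window_block[OF r(2)] .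
      have rN: "r < N" "e r \<le> b" using r by (auto simp: Rep_def inrange_def)
      have "x * B < Suc y * B" using r y by simp
      then have "x < Suc y" by (metis mult_less_cancel2)
      then have "x < nb c" using y by simp
      moreover have "leader x \<le> e r" by (rule e_le[OF r(3) rN(1)])
      ultimately show False using False rN by simp
    qed
    ultimately show ?thesis by (intro exI[of _ "[]"] exI[of _ 1]) auto
  qed
qed

text \<open>Between the first and the last visited boundary, adjacent segments consist of first
  occurrences from block i on, all within the range. There are at most k of these, and
  \<open>card_segments_le\<close> applies. The two extreme boundaries account for 2 * B.\<close>

lemma card_visited: "B * card (visited i) \<le> 2 * card (Rep a b) + 2 * B"
proof (cases "visited i = {}")
  case False
  let ?V = "visited i" and ?\<beta>' = "\<beta> + i * B"
  have mm: "Min ?V \<in> ?V" "Max ?V \<in> ?V" using False finite_visited by auto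
  have inb: "i < nb c" using mm(1) E'_sub by (auto simp: visited_def)
  let ?Z = "{s \<in> RB ?\<beta>'. e s \<le> b}"
  have Z: "card ?Z \<le> card (Rep a b)"
  proof (rule card_RB_le)
    fix s assume "?\<beta>' \<le> s" "s < N"
    then show "a \<le> e s" using leader_gt[OF le_refl inb] e_le[of ?\<beta>' s] by simp
  qed
  let ?M = "?V - {Min ?V, Max ?V}"
  have "B * card ?M \<le> 2 * card ?Z"
  proof (rule card_segments_le[OF E'_sub, of "alive B \<beta> i"])
    show "finite (alive B \<beta> i y)" for y by (simp add: alive_def)
    show "alive B \<beta> i y \<inter> alive B \<beta> i y' = {}" if "y \<noteq> y'" for y y'
    proof (rule ccontr)
      assume "\<not> ?thesis"
      then obtain r where r: "\<beta> + y * B \<le> r" "r < \<beta> + y * B + B" "\<beta> + y' * B \<le> r" "r < \<beta> + y' * B + B"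
        by (auto simp: alive_def)
      then have "y * B < Suc y' * B" "y' * B < Suc y * B" by simp_all
      then have "y < Suc y'" "y' < Suc y" by (metis mult_less_cancel2)+
      then show False using that by simp
    qed
    show "?M \<subseteq> E'" by (auto simp: visited_def)
    show "finite ?Z" by (simp add: finite_RB)
    fix z assume z: "z \<in> ?M"
    then have zE: "z \<in> E'" by (auto simp: visited_def)
    then have znb: "z < nb c" "0 < z" using E'_sub by auto
    then have z1: "z - 1 < nb c" by simp
    show "B < card (seg_union (alive B \<beta> i) (seg_lo E' (z - 1)) (seg_hi (nb c) E' z))"
      by (rule chain_big[OF c i_le zE])
    have minz: "Min ?V < z" using z Min_le[OF finite_visited, of z i] by (auto simp: le_less)
    have maxz: "z < Max ?V" using z Max_ge[OF finite_visited, of z i] by (auto simp: le_less)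
    have minE: "Min ?V \<in> E'" "i \<le> Min ?V" and maxE: "Max ?V \<in> E'" "leader (Max ?V) \<le> b"
      using mm by (auto simp: visited_def)
    have lo: "i \<le> seg_lo E' (z - 1)"
      using seg_props(6)[OF E'_sub z1 minE(1)] seg_boundary(2)[OF E'_sub zE] minz minE(2) by linarith
    have hi: "seg_hi (nb c) E' z \<le> Max ?V"
      using seg_props(6)[OF E'_sub znb(1) maxE(1)] seg_props(1)[OF E'_sub znb(1)] maxz by linarith
    show "seg_union (alive B \<beta> i) (seg_lo E' (z - 1)) (seg_hi (nb c) E' z) \<subseteq> ?Z"
    proof
      fix r assume r: "r \<in> seg_union (alive B \<beta> i) (seg_lo E' (z - 1)) (seg_hi (nb c) E' z)"
      note sr = seg_ranks[OF r]
      have "i * B \<le> seg_lo E' (z - 1) * B" "seg_hi (nb c) E' z * B \<le> Max ?V * B" using lo hi by auto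
      then have "?\<beta>' \<le> r" and rm: "r \<le> \<beta> + Max ?V * B" using sr(1,2) by linarith+
      moreover have "\<beta> + Max ?V * B < N" using maxE(1) E'_sub nb_iff[of "Max ?V" c] by auto
      then have "e r \<le> b" using e_le[OF rm] maxE(2) by simp
      ultimately show "r \<in> ?Z" using sr(3,4) by (simp add: RB_def)
    qed
  qed
  moreover have "card ?V \<le> card ?M + 2"
  proof -
    have "card ?V \<le> card (?M \<union> {Min ?V, Max ?V})" using finite_visited by (intro card_mono) auto
    also have "\<dots> \<le> card ?M + card {Min ?V, Max ?V}" by (rule card_Un_le)
    also have "card {Min ?V, Max ?V} \<le> 2" by (simp add: card_insert_if)
    finally show ?thesis by simp
  qed
  then have "B * card ?V \<le> B * (card ?M + 2)" by (rule mult_le_mono2)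
  ultimately show ?thesis using Z by (simp add: algebra_simps)
qed simp

text \<open>Elements from a on may lie in block i - 1, the last one with a leader up to a, so the
  walk starts there, possibly in the middle of a segment. For i = 0 the truncated subtraction gives
  the first block.\<close>

lemma walk:
  "\<exists>l t. RE [2, a, b, c, i, i - 1] l t [3, a, b, c, i, 0] \<and> distinct l \<and>
    set l = Rep a b \<inter> window c \<and> B * t \<le> 2 * card (Rep a b) + 4 * B"
proof -
  let ?x = "i - 1"
  have x: "?x < nb c" using nb_pos[OF c] lead_le[of c a] by linarith
  obtain r where r: "r \<in> inrange a b" "r \<in> window c" using meet by blast
  have lx: "leader ?x \<le> b"
  proof (cases "i = 0")
    case True
    have "leader 0 \<le> e r" using r by (intro e_le) (auto simp: window_def)
    then show ?thesis using True r by (auto simp: inrange_def)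
  next
    case False
    then have "leader ?x \<le> a" using lead_iff[of ?x c a] by simp
    then show ?thesis using r by (auto simp: inrange_def)
  qed
  let ?lo = "seg_lo E' ?x" and ?hi = "seg_hi (nb c) E' ?x"
  note sp = seg_props[OF E'_sub x]
  obtain l where l: "RE [2, a, b, c, i, ?x] l 1 [2, a, b, c, i, ?hi]" "distinct l"
    "set l = {r \<in> Rep a b. \<beta> + ?lo * B \<le> r \<and> r < \<beta> + ?hi * B}" using walk_step[OF x lx] by blast
  obtain l' t where l': "RE [2, a, b, c, i, ?hi] l' t [3, a, b, c, i, 0]" "distinct l'"
    "set l' = {r \<in> Rep a b. r \<in> window c \<and> \<beta> + ?hi * B \<le> r}" "t \<le> card (visited ?hi) + 1"
    using walk_rest[OF sp(5)] by blast
  \<comment> \<open>The segment that contains block i - 1 starts at the window or at a leader up to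
    a, so it misses no element of the range.\<close>
  have low: "\<beta> + ?lo * B \<le> r" if "r \<in> Rep a b" "r \<in> window c" for r
  proof (rule ccontr)
    assume lt: "\<not> ?thesis"
    have "\<beta> \<le> r" using that by (auto simp: window_def)
    then have "?lo \<noteq> 0" using lt by (cases "?lo = 0") auto
    then have "?lo < i" using sp(1) by linarith
    then have "leader ?lo \<le> a" "\<beta> + ?lo * B < N" using lead_iff[of ?lo c a] by (auto simp: nb_iff)
    then have "e r < a" using e_less[of r "\<beta> + ?lo * B"] lt by simp
    then show False using that by (auto simp: Rep_def inrange_def)
  qed
  have sub: "set l \<subseteq> window c" unfolding l(3) using seg_window[OF _ _ _ sp(3), of _ ?lo] Rep_subset by (auto simp: inrange_def)
  have "set (l @ l') = Rep a b \<inter> window c" 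
  proof
    show "set (l @ l') \<subseteq> Rep a b \<inter> window c" using sub l(3) l'(3) by auto
    show "Rep a b \<inter> window c \<subseteq> set (l @ l')"
    proof
      fix r assume "r \<in> Rep a b \<inter> window c"
      then show "r \<in> set (l @ l')" using low[of r] l(3) l'(3) by (cases "r < \<beta> + ?hi * B") auto
    qed
  qed
  moreover have "distinct (l @ l')" using l(2,3) l'(2,3) by auto
  moreover have "visited ?hi \<subseteq> visited i" using sp(2) by (auto simp: visited_def)
  then have "card (visited ?hi) \<le> card (visited i)" by (rule card_mono[OF finite_visited])
  then have "B * (1 + t) \<le> B * (card (visited i) + 2)" using l'(4) by (intro mult_le_mono2) linarith
  then have "B * (1 + t) \<le> 2 * card (Rep a b) + 4 * B" using card_visited by (simp add: algebra_simps)
  ultimately show ?thesis using RE_trans[OF l(1) l'(1)] by blast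
qed

end

end

section \<open>The dyadic tree for large outputs\<close>

context cquery begin

abbreviation dn where "dn \<equiv> dnode g\<^sub>0"
abbreviation top\<^sub>0 where "top\<^sub>0 \<equiv> topl w B N"

lemma topl: "N \<le> 2 ^ top\<^sub>0 * g\<^sub>0" "top\<^sub>0 \<le> w"
proof -
  have ex: "N \<le> 2 ^ w * g\<^sub>0" using N_le g1 mult_le_mono[of N "2 ^ w" 1 g\<^sub>0] by simp
  then show "N \<le> 2 ^ top\<^sub>0 * g\<^sub>0" unfolding topl_def by (rule LeastI)
  show "top\<^sub>0 \<le> w" unfolding topl_def using ex by (rule Least_le)
qed

lemma finite_dn: "finite (dn l y)" by (simp add: dnode_def)

lemma dn_split: "dn (Suc l) y = dn l (2 * y) \<union> dn l (2 * y + 1)"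
  "r \<in> dn l (2 * y) \<Longrightarrow> r' \<in> dn l (2 * y + 1) \<Longrightarrow> r < r'"
proof -
  have eq: "y * 2 ^ Suc l * g\<^sub>0 = 2 * y * 2 ^ l * g\<^sub>0" "(y + 1) * 2 ^ Suc l * g\<^sub>0 = (2 * y + 1 + 1) * 2 ^ l * g\<^sub>0"
    by (simp_all add: algebra_simps)
  have le: "2 * y * 2 ^ l * g\<^sub>0 \<le> (2 * y + 1) * 2 ^ l * g\<^sub>0" "(2 * y + 1) * 2 ^ l * g\<^sub>0 \<le> (2 * y + 1 + 1) * 2 ^ l * g\<^sub>0"
    by (simp_all add: mult_le_mono1)
  define P Q R where "P = 2 * y * 2 ^ l * g\<^sub>0" and "Q = (2 * y + 1) * 2 ^ l * g\<^sub>0" and "R = (2 * y + 1 + 1) * 2 ^ l * g\<^sub>0"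
  have d: "dn (Suc l) y = {r. P \<le> r \<and> r < R \<and> r < N}" "dn l (2 * y) = {r. P \<le> r \<and> r < Q \<and> r < N}"
    "dn l (2 * y + 1) = {r. Q \<le> r \<and> r < R \<and> r < N}"
    unfolding dnode_def eq P_def Q_def R_def by (rule refl)+
  have "P \<le> Q" "Q \<le> R" using le by (simp_all only: P_def Q_def R_def)
  then show "dn (Suc l) y = dn l (2 * y) \<union> dn l (2 * y + 1)" unfolding d by auto
  show "r \<in> dn l (2 * y) \<Longrightarrow> r' \<in> dn l (2 * y + 1) \<Longrightarrow> r < r'" unfolding d by simp
qed

lemma dn_ends:
  assumes "y * 2 ^ l * g\<^sub>0 < N"
  shows "y * 2 ^ l * g\<^sub>0 \<in> dn l y" "min N ((y + 1) * 2 ^ l * g\<^sub>0) - 1 \<in> dn l y"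
proof -
  define P Q where "P = y * 2 ^ l * g\<^sub>0" and "Q = (y + 1) * 2 ^ l * g\<^sub>0"
  have d: "dn l y = {r. P \<le> r \<and> r < Q \<and> r < N}" unfolding dnode_def P_def Q_def by (rule refl)
  have "Q = P + 2 ^ l * g\<^sub>0" by (simp add: P_def Q_def algebra_simps)
  then have "P < Q" "P < N" using g1 assms by (simp_all add: P_def)
  then have "P \<in> dn l y" "min N Q - 1 \<in> dn l y" unfolding d by auto
  then show "y * 2 ^ l * g\<^sub>0 \<in> dn l y" "min N ((y + 1) * 2 ^ l * g\<^sub>0) - 1 \<in> dn l y"
    unfolding P_def Q_def .
qed

lemma card_dn_0: "card (dn 0 y) \<le> g\<^sub>0"
proof -
  have "dn 0 y \<subseteq> {y * g\<^sub>0..<y * g\<^sub>0 + g\<^sub>0}" by (auto simp: dnode_def)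
  then show ?thesis using card_mono[of "{y * g\<^sub>0..<y * g\<^sub>0 + g\<^sub>0}" "dn 0 y"] by simp
qed

lemma dlist_prefix:
  fixes l y :: nat
  defines "xs \<equiv> sort_key pf (sorted_list_of_set (dn l y))"
  shows "distinct xs" "set xs = dn l y" "length xs = card (dn l y)"
    "q < length xs \<Longrightarrow> pf (xs ! q) \<le> a \<longleftrightarrow> q < card {r \<in> dn l y. pf r \<le> a}"
proof -
  show d: "distinct xs" and s: "set xs = dn l y" and "length xs = card (dn l y)"
    by (simp_all add: xs_def finite_dn length_sorted_list_of_set)
  have mono: "pf (xs ! i) \<le> pf (xs ! j)" if "i < j" "j < length xs" for i j
  proof -
    have "sorted (map pf xs)" by (simp add: xs_def)
    from sorted_nth_mono[OF this, of i j] that show ?thesis by simp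
  qed
  assume "q < length xs"
  then show "pf (xs ! q) \<le> a \<longleftrightarrow> q < card {r \<in> dn l y. pf r \<le> a}"
    unfolding s[symmetric] by (intro prefix_card[OF d]) (use mono le_trans in blast)
qed

context
  fixes a b :: nat
  assumes a: "a < 2 ^ w" and b: "b < 2 ^ w"
begin

text \<open>A potential for the analysis: how many of the two ends of the range properly split
  X.\<close>

definition cuts :: "nat set \<Rightarrow> nat" where
  "cuts X = of_bool ((\<exists>r\<in>X. e r < a) \<and> (\<exists>r\<in>X. a \<le> e r)) + of_bool ((\<exists>r\<in>X. e r \<le> b) \<and> (\<exists>r\<in>X. b < e r))"

text \<open>The values in the left child are below those in the right one, so an end of the range
  splits at most one of them.\<close>

lemma cuts_split: "cuts (dn l (2 * y)) + cuts (dn l (2 * y + 1)) \<le> cuts (dn (Suc l) y)"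
proof -
  let ?X = "dn l (2 * y)" and ?Z = "dn l (2 * y + 1)"
  have sep: "e r < e r'" if "r \<in> ?X" "r' \<in> ?Z" for r r'
    using dn_split(2)[OF that] that by (intro e_less) (auto simp: dnode_def)
  have "of_bool ((\<exists>r\<in>?X. Q r) \<and> (\<exists>r\<in>?X. \<not> Q r)) + of_bool ((\<exists>r\<in>?Z. Q r) \<and> (\<exists>r\<in>?Z. \<not> Q r))
      \<le> (of_bool ((\<exists>r\<in>?X \<union> ?Z. Q r) \<and> (\<exists>r\<in>?X \<union> ?Z. \<not> Q r)) :: nat)"
    if down: "\<And>r r'. Q r' \<Longrightarrow> e r < e r' \<Longrightarrow> Q r" for Q
  proof -
    have "\<not> ((\<exists>r\<in>?X. \<not> Q r) \<and> (\<exists>r\<in>?Z. Q r))" using sep down by blast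
    then show ?thesis by (auto simp: of_bool_def)
  qed
  from this[of "\<lambda>r. e r < a"] this[of "\<lambda>r. e r \<le> b"]
  show ?thesis unfolding cuts_def dn_split(1) not_less not_le by fastforce
qed

lemma big_state:
  assumes "pc \<le> 6" "l \<le> top\<^sub>0" "y < 2 ^ (top\<^sub>0 - l)"
  shows "[pc, a, b, l, y] \<in> states w" "j \<le> n \<Longrightarrow> [pc, a, b, l, y, j] \<in> states w"
proof -
  have "(2::nat) ^ (top\<^sub>0 - l) \<le> 2 ^ w" using topl(2) by (intro power_increasing) auto
  then have y: "y \<le> 2 ^ w" using assms(3) by linarith
  have l: "l \<le> 2 ^ w" using assms(2) topl(2) w_le by linarith
  have pc: "pc \<le> 6 * 2 ^ w" using assms(1) two_w by linarith
  show "[pc, a, b, l, y] \<in> states w" by (rule in_states) (use y l pc a b in auto)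
  assume "j \<le> n"
  then have "j \<le> 2 ^ w" using n_le w_le by linarith
  then show "[pc, a, b, l, y, j] \<in> states w" by (intro in_states) (use y l pc a b in auto)
qed

lemma scan_node:
  assumes l: "l \<le> top\<^sub>0" "y < 2 ^ (top\<^sub>0 - l)" and p: "card {r \<in> dn l y. pf r \<le> a} \<le> g\<^sub>0"
  shows "\<exists>L t. RE [5, a, b, l, y, 0] L t [6, a, b, l, y] \<and> distinct L \<and> set L = Rep a b \<inter> dn l y \<and>
    t \<le> card {r \<in> dn l y. pf r \<le> a} div B + 2"
proof -
  let ?xs = "sort_key pf (sorted_list_of_set (dn l y))" and ?p = "card {r \<in> dn l y. pf r \<le> a}"
  let ?st = "\<lambda>j. [5, a, b, l, y, j]"
  note lp = dlist_prefix[where l = l and y = y]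
  have dN: "r < N" if "r \<in> dn l y" for r using that by (auto simp: dnode_def)
  have "\<exists>L t J. RE (?st 0) L t (?st J) \<and> ?st J \<in> states w \<and> io_run D (rnd w B (?st J)) = ([], Some [6, a, b, l, y]) \<and>
    t \<le> ?p div B + 1 \<and> distinct L \<and> set L = {r \<in> set ?xs. passes a b (ent r)}"
  proof (rule RE_scan[where c = "node_id l y" and i = 7 and P = "\<lambda>x. x ! 1 \<le> a"])
    show "Y 7 (node_id l y * g\<^sub>0 + q) = pad (map ent ?xs) q" if "q < g\<^sub>0" for q using Y7[OF l that] .
    show "?st j \<in> states w" if "j \<le> n" for j using that l by (intro big_state(2)) auto
    show "io_run D (rnd w B (?st j)) = io_run D (scan_rnd w B a b 7 (node_id l y) j (\<lambda>x. x ! 1 \<le> a) (?st (Suc j)) (Some [6, a, b, l, y]))" for j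
      by (simp add: rnd_def)
    show "ent (?xs ! q) ! 1 \<le> a \<longleftrightarrow> q < ?p" if "q < length ?xs" for q
      using lp(4)[OF that] by (simp add: ent_def)
    show "?p \<le> length ?xs" unfolding lp(3) by (intro card_mono finite_dn) auto
    show "set ?xs \<subseteq> {..<N}" unfolding lp(2) using dN by auto
  qed (use p lp(1) in \<open>auto simp: ent_def passes_def\<close>)
  then obtain L t J where L: "RE (?st 0) L t (?st J)" "?st J \<in> states w" "io_run D (rnd w B (?st J)) = ([], Some [6, a, b, l, y])"
    "t \<le> ?p div B + 1" "distinct L" "set L = {r \<in> set ?xs. passes a b (ent r)}" by blast
  have "set L = Rep a b \<inter> dn l y" unfolding L(6) lp(2) using dN passes_ent by auto
  moreover have "RE (?st J) [] 1 [6, a, b, l, y]"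
    by (rule RE_step[OF L(2) big_state(1)]) (use L l in auto)
  then have "RE (?st 0) L (t + 1) [6, a, b, l, y]" using RE_trans[OF L(1)] by fastforce
  ultimately show ?thesis using L by (intro exI[of _ L] exI[of _ "t + 1"]) auto
qed

lemma run_enter:
  fixes l y :: nat
  assumes l: "l \<le> top\<^sub>0" "y < 2 ^ (top\<^sub>0 - l)"
  defines "lo \<equiv> y * 2 ^ l * g\<^sub>0" and "hi \<equiv> min N ((y + 1) * 2 ^ l * g\<^sub>0)"
  shows "io_run D (rnd w B [4, a, b, l, y]) = ([], Some (
      if N \<le> lo \<or> b < e lo \<or> e (hi - 1) < a then [6, a, b, l, y]
      else if l = 0 \<or> (a \<le> e lo \<and> e (hi - 1) \<le> b \<and> card {r \<in> dn l y. pf r \<le> a} < g\<^sub>0)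
      then [5, a, b, l, y, 0] else [4, a, b, l - 1, 2 * y]))"
proof -
  let ?z = "Y 7 (node_id l y * g\<^sub>0 + (g\<^sub>0 - 1))" and ?xs = "sort_key pf (sorted_list_of_set (dn l y))"
  note lp = dlist_prefix[where l = l and y = y]
  have z: "?z = pad (map ent ?xs) (g\<^sub>0 - 1)" using Y7[OF l, of "g\<^sub>0 - 1"] g1 by simp
  have ple: "card {r \<in> dn l y. pf r \<le> a} \<le> length ?xs" unfolding lp(3) by (intro card_mono finite_dn) auto
  have full: "\<not> (?z \<noteq> [] \<and> ?z ! 1 \<le> a) \<longleftrightarrow> card {r \<in> dn l y. pf r \<le> a} < g\<^sub>0"
  proof (cases "g\<^sub>0 - 1 < length ?xs")
    case True
    then have "?z = ent (?xs ! (g\<^sub>0 - 1))" unfolding z by (simp add: pad_def)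
    then show ?thesis using lp(4)[OF True, of a] g1 by (simp add: ent_def) linarith
  next
    case False
    then show ?thesis unfolding z using ple g1 by (simp add: pad_def)
  qed
  have pos: "0 < 2 ^ l * g\<^sub>0" using g1 by simp
  have hiN: "hi - 1 < N" using N1 by (auto simp: hi_def)
  have y1: "Y 1 lo ! 0 = e lo" if "\<not> N \<le> lo" using that by (simp add: Y1s ent_def)
  have y2: "Y 1 (hi - 1) ! 0 = e (hi - 1)" using hiN by (simp add: Y1s ent_def)
  have run: "io_run D (rnd w B [4, a, b, l, y]) = (
       if N \<le> lo \<or> b < Y 1 lo ! 0 \<or> Y 1 (hi - 1) ! 0 < a then ([], Some [6, a, b, l, y])
       else if l = 0 \<or> (a \<le> Y 1 lo ! 0 \<and> Y 1 (hi - 1) ! 0 \<le> b \<and> \<not> (?z \<noteq> [] \<and> ?z ! 1 \<le> a))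
       then ([], Some [5, a, b, l, y, 0]) else ([], Some [4, a, b, l - 1, 2 * y]))"
  proof -
    have "io_run D (rnd w B [4, a, b, l, y]) = io_run D (enter_rnd w B N a b l y)" by (simp add: rnd_def Y0)
    moreover have "io_run D (gt w B 1 m) = Y 1 m" "io_run D (gt w B 7 m) = Y 7 m" for m by (rule run_gt, simp)+
    ultimately show ?thesis unfolding enter_rnd_def Let_def io_run_bind lo_def hi_def
      by (simp only: if_distrib[of "io_run D"] io_run.simps)
  qed
  show ?thesis
  proof (cases "N \<le> lo")
    case True
    then show ?thesis unfolding run by simp
  next
    case False
    show ?thesis unfolding run y1[OF False] y2 full by simp
  qed
qed

lemma run_done:
  "io_run D (rnd w B [6, a, b, l, y]) = ([], if top\<^sub>0 \<le> l then None
     else if even y then Some [4, a, b, l, y + 1] else Some [6, a, b, l + 1, y div 2])"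
  by (simp add: rnd_def done_rnd_def Y0)

text \<open>An inner node adds 6 to the constant 3, since 3 + 3 + 3 = 3 + 6. These 6 rounds are
  charged either to at least \<open>g\<^sub>0\<close> first occurrences below the node, once per
  level, or to an end of the range that splits it. A split leaf may cost n further rounds without
  output.\<close>

lemma visit_node:
  assumes "l \<le> top\<^sub>0" "y < 2 ^ (top\<^sub>0 - l)"
  shows "\<exists>L t. RE [4, a, b, l, y] L t [6, a, b, l, y] \<and> distinct L \<and> set L = Rep a b \<inter> dn l y \<and>
    real t \<le> 3 + real (card (Rep a b \<inter> dn l y)) / B + 6 * real l * real (card (Rep a b \<inter> dn l y)) / g\<^sub>0
      + real (cuts (dn l y)) * (real n + 6 * (real l + 1))"
  using assms
proof (induction l arbitrary: y rule: less_induct)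
  case (less l)
  note l = less.prems
  have IH: "\<exists>L t. RE [4, a, b, l', y'] L t [6, a, b, l', y'] \<and> distinct L \<and> set L = Rep a b \<inter> dn l' y' \<and>
      real t \<le> 3 + real (card (Rep a b \<inter> dn l' y')) / B + 6 * real l' * real (card (Rep a b \<inter> dn l' y')) / g\<^sub>0
        + real (cuts (dn l' y')) * (real n + 6 * (real l' + 1))"
    if "l = Suc l'" "y' < 2 ^ (top\<^sub>0 - l')" for l' y'
    using less.IH[of l' y'] that l by simp
  let ?lo = "y * 2 ^ l * g\<^sub>0" and ?hi = "min N ((y + 1) * 2 ^ l * g\<^sub>0)"
  let ?\<rho> = "card (Rep a b \<inter> dn l y)" and ?\<epsilon> = "cuts (dn l y)" and ?p = "card {r \<in> dn l y. pf r \<le> a}"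
  let ?bound = "3 + real ?\<rho> / B + 6 * real l * real ?\<rho> / g\<^sub>0 + real ?\<epsilon> * (real n + 6 * (real l + 1))"
  note run = run_enter[OF l]
  have bpos: "0 \<le> 6 * real l * real ?\<rho> / g\<^sub>0" "0 \<le> real ?\<epsilon> * (real n + 6 * (real l + 1))" "0 \<le> real ?\<rho> / B" by auto
  have s4: "[4, a, b, l, y] \<in> states w" and s6: "[6, a, b, l, y] \<in> states w" by (rule big_state(1); use l in simp)+
  have ends: "?lo \<le> r" "r \<le> ?hi - 1" "r < N" if "r \<in> dn l y" for r
  proof -
    have r: "?lo \<le> r" "r < (y + 1) * 2 ^ l * g\<^sub>0" "r < N" using that unfolding dnode_def by blast+
    then have "r < ?hi" by (simp only: min_less_iff_conj)
    then show "?lo \<le> r" "r \<le> ?hi - 1" "r < N" using r by linarith+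
  qed
  have hiN: "?hi - 1 < N" using N1 by auto
  consider (skip) "N \<le> ?lo \<or> b < e ?lo \<or> e (?hi - 1) < a"
    | (scan) "\<not> (N \<le> ?lo \<or> b < e ?lo \<or> e (?hi - 1) < a)" "l = 0 \<or> (a \<le> e ?lo \<and> e (?hi - 1) \<le> b \<and> ?p < g\<^sub>0)"
    | (down) "\<not> (N \<le> ?lo \<or> b < e ?lo \<or> e (?hi - 1) < a)" "\<not> (l = 0 \<or> (a \<le> e ?lo \<and> e (?hi - 1) \<le> b \<and> ?p < g\<^sub>0))"
    by blast
  then show ?case
  proof cases
    case skip
    have "Rep a b \<inter> dn l y = {}"
    proof (rule ccontr)
      assume "\<not> ?thesis"
      then obtain r where r: "r \<in> Rep a b" "r \<in> dn l y" by blast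
      note er = ends[OF r(2)]
      have "e ?lo \<le> e r" "e r \<le> e (?hi - 1)" using er hiN by (auto intro!: e_le)
      then show False using skip er r(1) by (auto simp: Rep_def inrange_def)
    qed
    moreover have "RE [4, a, b, l, y] [] 1 [6, a, b, l, y]"
      by (rule RE_step[OF s4 s6]) (use run skip in simp_all)
    ultimately show ?thesis using bpos by (intro exI[of _ "[]"] exI[of _ 1]) auto
  next
    case scan
    have inN: "?lo < N" using scan(1) by simp
    note loM = dn_ends[OF inN]
    have pg: "?p \<le> g\<^sub>0"
    proof (cases "l = 0")
      case True
      have "?p \<le> card (dn l y)" by (intro card_mono finite_dn) auto
      then show ?thesis using True card_dn_0 le_trans by blast
    qed (use scan in simp)
    obtain L t where L: "RE [5, a, b, l, y, 0] L t [6, a, b, l, y]" "distinct L" "set L = Rep a b \<inter> dn l y" "t \<le> ?p div B + 2"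
      using scan_node[OF l pg] by blast
    have "RE [4, a, b, l, y] [] 1 [5, a, b, l, y, 0]"
      by (rule RE_step[OF s4]) (use run scan big_state(2)[of 5 l y 0] l in simp_all)
    then have re: "RE [4, a, b, l, y] L (1 + t) [6, a, b, l, y]" using RE_trans[OF _ L(1)] by fastforce
    have "real (?p div B) \<le> real ?\<rho> / B + real ?\<epsilon> * real n"
    proof (cases "a \<le> e ?lo \<and> e (?hi - 1) \<le> b")
      case True
      have "{r \<in> dn l y. pf r \<le> a} \<subseteq> Rep a b \<inter> dn l y"
      proof
        fix r assume r: "r \<in> {r \<in> dn l y. pf r \<le> a}"
        then have "e ?lo \<le> e r" "e r \<le> e (?hi - 1)" using ends[of r] hiN by (auto intro!: e_le)
        then show "r \<in> Rep a b \<inter> dn l y" using r True ends(3)[of r] by (auto simp: Rep_def inrange_def)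
      qed
      then have "?p \<le> ?\<rho>" by (intro card_mono) (auto simp: finite_dn)
      then have "?p div B \<le> ?\<rho> div B" by (rule div_le_mono)
      then have "real (?p div B) \<le> real (?\<rho> div B)" by simp
      also have "\<dots> \<le> real ?\<rho> / B" by (rule of_nat_div_le_of_nat)
      finally show ?thesis by (simp add: add_increasing2)
    next
      case False
      \<comment> \<open>The node meets the range without being inside it, so an end of the range
        separates its first element from its last one.\<close>
      then have "1 \<le> ?\<epsilon>"
        using loM scan(1) unfolding cuts_def by (auto simp: of_bool_def not_le not_less split: if_splits intro: leI)
      then have "real n \<le> real ?\<epsilon> * real n" by (simp add: mult_le_cancel_right1)
      moreover have "?p div B \<le> n"
      proof -
        have "?p div B \<le> n * B div B" using pg nB by (intro div_le_mono) simp
        then show ?thesis using B by simp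
      qed
      ultimately show ?thesis using bpos(3) by linarith
    qed
    moreover have "real (1 + t) \<le> 3 + real (?p div B)" using L(4) by linarith
    moreover have "real ?\<epsilon> * (real n + 6 * (real l + 1)) \<ge> real ?\<epsilon> * real n" by (intro mult_left_mono) auto
    ultimately have "real (1 + t) \<le> ?bound" using bpos(1) by linarith
    then show ?thesis using re L by blast
  next
    case down
    then obtain l' where l': "l = Suc l'" by (cases l) auto
    have sub: "2 * y < 2 ^ (top\<^sub>0 - l')" "2 * y + 1 < 2 ^ (top\<^sub>0 - l')" "l' \<le> top\<^sub>0" "\<not> top\<^sub>0 \<le> l'"
    proof -
      have "top\<^sub>0 - l' = Suc (top\<^sub>0 - l)" using l(1) l' by simp
      then have "(2::nat) ^ (top\<^sub>0 - l') = 2 * 2 ^ (top\<^sub>0 - l)" by simp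
      then show "2 * y < 2 ^ (top\<^sub>0 - l')" "2 * y + 1 < 2 ^ (top\<^sub>0 - l')" using l(2) by linarith+
      show "l' \<le> top\<^sub>0" "\<not> top\<^sub>0 \<le> l'" using l(1) l' by auto
    qed
    obtain L1 t1 where L1: "RE [4, a, b, l', 2 * y] L1 t1 [6, a, b, l', 2 * y]" "distinct L1" "set L1 = Rep a b \<inter> dn l' (2 * y)"
      "real t1 \<le> 3 + real (card (Rep a b \<inter> dn l' (2 * y))) / B + 6 * real l' * real (card (Rep a b \<inter> dn l' (2 * y))) / g\<^sub>0
        + real (cuts (dn l' (2 * y))) * (real n + 6 * (real l' + 1))" using IH[OF l' sub(1)] by blast
    obtain L2 t2 where L2: "RE [4, a, b, l', 2 * y + 1] L2 t2 [6, a, b, l', 2 * y + 1]" "distinct L2" "set L2 = Rep a b \<inter> dn l' (2 * y + 1)"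
      "real t2 \<le> 3 + real (card (Rep a b \<inter> dn l' (2 * y + 1))) / B + 6 * real l' * real (card (Rep a b \<inter> dn l' (2 * y + 1))) / g\<^sub>0
        + real (cuts (dn l' (2 * y + 1))) * (real n + 6 * (real l' + 1))" using IH[OF l' sub(2)] by blast
    have r1: "RE [4, a, b, l, y] [] 1 [4, a, b, l', 2 * y]"
      by (rule RE_step[OF s4 big_state(1)]) (use run down l' sub in simp_all)
    have r2: "RE [6, a, b, l', 2 * y] [] 1 [4, a, b, l', 2 * y + 1]"
      by (rule RE_step[OF big_state(1) big_state(1)]) (use run_done[of l' "2 * y"] sub in simp_all)
    have r3: "RE [6, a, b, l', 2 * y + 1] [] 1 [6, a, b, l, y]"
      by (rule RE_step[OF big_state(1) s6]) (use run_done[of l' "2 * y + 1"] sub l' in simp_all)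
    have re: "RE [4, a, b, l, y] (L1 @ L2) (t1 + t2 + 3) [6, a, b, l, y]"
      using RE_trans[OF r1 RE_trans[OF L1(1) RE_trans[OF r2 RE_trans[OF L2(1) r3]]]] by (simp add: algebra_simps numeral_3_eq_3)
    have disj: "dn l' (2 * y) \<inter> dn l' (2 * y + 1) = {}" using dn_split(2)[of _ l' y] by blast
    have set: "set (L1 @ L2) = Rep a b \<inter> dn l y" using L1(3) L2(3) dn_split(1)[of l' y] l' by auto
    have dis: "distinct (L1 @ L2)" using L1(2,3) L2(2,3) disj by auto
    let ?\<rho>1 = "card (Rep a b \<inter> dn l' (2 * y))" and ?\<rho>2 = "card (Rep a b \<inter> dn l' (2 * y + 1))"
    let ?\<epsilon>1 = "cuts (dn l' (2 * y))" and ?\<epsilon>2 = "cuts (dn l' (2 * y + 1))"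
    have \<rho>: "?\<rho> = ?\<rho>1 + ?\<rho>2"
      unfolding l' dn_split(1) Int_Un_distrib using disj by (intro card_Un_disjoint) (auto simp: finite_dn)
    have \<epsilon>: "?\<epsilon>1 + ?\<epsilon>2 \<le> ?\<epsilon>" unfolding l' by (rule cuts_split)
    \<comment> \<open>A node is descended into either because its list overflows, which gives at
      least \<open>g\<^sub>0\<close> first occurrences, or because an end of the range splits
      it.\<close>
    have key: "6 \<le> 6 * real ?\<rho> / g\<^sub>0 + 6 * real ?\<epsilon>"
    proof (cases "a \<le> e ?lo \<and> e (?hi - 1) \<le> b")
      case True
      then have "g\<^sub>0 \<le> ?p" using down by auto
      also have "?p \<le> ?\<rho>"
      proof (rule card_mono)
        show "{r \<in> dn l y. pf r \<le> a} \<subseteq> Rep a b \<inter> dn l y"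
        proof
          fix r assume r: "r \<in> {r \<in> dn l y. pf r \<le> a}"
          then have "e ?lo \<le> e r" "e r \<le> e (?hi - 1)" using ends[of r] hiN by (auto intro!: e_le)
          then show "r \<in> Rep a b \<inter> dn l y" using r True ends(3)[of r] by (auto simp: Rep_def inrange_def)
        qed
      qed (simp add: finite_dn)
      finally have "real g\<^sub>0 \<le> real ?\<rho>" by simp
      then have "6 \<le> 6 * real ?\<rho> / g\<^sub>0" using g1 by (simp add: field_simps)
      then show ?thesis by simp
    next
      case False
      have inN: "?lo < N" using down(1) by simp
      note loM = dn_ends(1)[OF inN] and hiM = dn_ends(2)[OF inN]
      have "1 \<le> ?\<epsilon>"
        using loM hiM down(1) False unfolding cuts_def by (auto simp: of_bool_def not_le not_less split: if_splits intro: leI)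
      then have "6 \<le> 6 * real ?\<epsilon>" by simp
      then show ?thesis by (simp add: add_increasing)
    qed
    have "real (t1 + t2 + 3) \<le> ?bound"
    proof -
      have e1: "real ?\<epsilon>1 * (real n + 6 * (real l' + 1)) + real ?\<epsilon>2 * (real n + 6 * (real l' + 1)) \<le> real ?\<epsilon> * (real n + 6 * (real l' + 1))"
        unfolding distrib_right[symmetric] using \<epsilon> by (intro mult_right_mono) (auto simp flip: of_nat_add)
      have e2: "real ?\<epsilon> * (real n + 6 * (real l + 1)) = real ?\<epsilon> * (real n + 6 * (real l' + 1)) + 6 * real ?\<epsilon>"
        unfolding l' by (simp add: algebra_simps)
      have p1: "real ?\<rho> / B = real ?\<rho>1 / B + real ?\<rho>2 / B" unfolding \<rho> by (simp add: add_divide_distrib)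
      have p2: "6 * real l * real ?\<rho> / g\<^sub>0 = 6 * real l' * real ?\<rho>1 / g\<^sub>0 + 6 * real l' * real ?\<rho>2 / g\<^sub>0 + 6 * real ?\<rho> / g\<^sub>0"
      proof -
        have rl: "real l = real l' + 1" using l' by simp
        show ?thesis unfolding \<rho> rl by (simp add: algebra_simps add_divide_distrib)
      qed
      have "real (t1 + t2 + 3) = real t1 + real t2 + 3" by simp
      then show ?thesis using L1(4) L2(4) e1 e2 p1 p2 key by linarith
    qed
    then show ?thesis using re set dis by blast
  qed
qed

text \<open>From k >= n * B follows n <= k / B, and the tree has at most w <= 4 n levels. The three
  terms of \<open>visit_node\<close> contribute 1, 24 and 62 times k / B.\<close>

lemma big_mode:
  assumes k: "g\<^sub>0 \<le> card (Rep a b)"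
  shows "\<exists>L t. RE [4, a, b, top\<^sub>0, 0] L t [6, a, b, top\<^sub>0, 0] \<and> distinct L \<and> set L = Rep a b \<and>
    real t \<le> 3 + 100 * (real (card (Rep a b)) / B)"
proof -
  have all: "Rep a b \<inter> dn top\<^sub>0 0 = Rep a b" using topl(1) by (auto simp: dnode_def Rep_def inrange_def)
  obtain L t where L: "RE [4, a, b, top\<^sub>0, 0] L t [6, a, b, top\<^sub>0, 0]" "distinct L" "set L = Rep a b"
    "real t \<le> 3 + real (card (Rep a b)) / B + 6 * real top\<^sub>0 * real (card (Rep a b)) / g\<^sub>0
      + real (cuts (dn top\<^sub>0 0)) * (real n + 6 * (real top\<^sub>0 + 1))"
    using visit_node[of top\<^sub>0 0] unfolding all by auto
  let ?k = "real (card (Rep a b))"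
  have tn: "real top\<^sub>0 \<le> 4 * real n" using topl(2) fan_bounds(4)[OF w] by simp
  have n0: "1 \<le> real n" using n1 by simp
  have Bp: "0 < real B" using B by simp
  have g0: "real g\<^sub>0 = real n * real B" by (simp add: nB)
  have nk: "real n \<le> ?k / B" using k Bp unfolding nB by (simp add: pos_le_divide_eq flip: of_nat_mult)
  have "6 * real top\<^sub>0 * ?k / g\<^sub>0 = 6 * real top\<^sub>0 / n * (?k / B)" unfolding g0 by (simp add: field_simps)
  also have "\<dots> \<le> 24 * (?k / B)" using tn n0 by (intro mult_right_mono) (auto simp: field_simps)
  finally have 1: "6 * real top\<^sub>0 * ?k / g\<^sub>0 \<le> 24 * (?k / B)" .
  have "cuts (dn top\<^sub>0 0) \<le> 2" by (simp add: cuts_def of_bool_def)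
  then have "real (cuts (dn top\<^sub>0 0)) * (real n + 6 * (real top\<^sub>0 + 1)) \<le> 2 * (real n + 6 * (4 * real n + real n))"
    using tn n0 by (intro mult_mono add_mono) auto
  also have "\<dots> = 62 * real n" by simp
  also have "\<dots> \<le> 62 * (?k / B)" using nk by simp
  finally have "real t \<le> 3 + 100 * (?k / B)" using L(4) 1 by (smt (verit) divide_nonneg_nonneg of_nat_0_le_iff)
  then show ?thesis using L by blast
qed

end

end

context cquery begin

text \<open>With X = k / B, the dyadic tree takes at most 100 X + 4 rounds and a window with its two
  lists 4 X + 8; the factor 110 covers both.\<close>

lemma query:
  assumes a: "a < 2 ^ w" and b: "b < 2 ^ w"
  shows "\<exists>l t s. RE [0, a, b] l t s \<and> s \<in> states w \<and> io_run D (rnd w B s) = ([], None) \<and> distinct l \<and>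
    inj_on \<kappa> (set l) \<and> \<kappa> ` set l = \<kappa> ` inrange a b \<and>
    real t \<le> 110 * (real (card (\<kappa> ` inrange a b)) / B + 1)"
proof -
  let ?k = "card (Rep a b)"
  have s0: "[0, a, b] \<in> states w" by (rule in_states) (use a b in auto)
  have run0: "io_run D (rnd w B [0, a, b]) = io_run D (start_rnd w B [N, s1, s0] a b)" by (simp add: rnd_def Y0)
  show ?thesis
  proof (cases "a \<le> b \<and> inrange a b \<noteq> {}")
    case False
    have "io_run D (locate_io w B [N, s1, s0] a b) = None"
    proof (cases "a \<le> b")
      case True
      then show ?thesis using run_locate[OF b True] False by simp
    qed (simp add: locate_io_def)
    then have "io_run D (rnd w B [0, a, b]) = ([], None)" unfolding run0 by (simp add: start_rnd_def)
    moreover have "inrange a b = {}" using False by (auto simp: inrange_def)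
    ultimately show ?thesis using RE_refl[OF s0] s0 by (intro exI[of _ "[]"] exI[of _ 0] exI[of _ "[0, a, b]"]) auto
  next
    case True
    then obtain c where c: "c * g\<^sub>0 < N" and meet: "inrange a b \<inter> window c \<noteq> {}"
      and loc: "io_run D (locate_io w B [N, s1, s0] a b) = Some (c, lead c a)"
      using run_locate[OF b, of a] by auto
    let ?i = "lead c a"
    let ?p = "card {s \<in> LB (c * g\<^sub>0). a \<le> e s}" and ?p' = "card {s \<in> RB ((c + 2) * g\<^sub>0). e s \<le> b}"
    have i: "?i \<le> 2 * n" using lead_le[of c a] nb_le[of c] by simp
    have below: "e s \<le> b" if "s < c * g\<^sub>0" for s using below_window[OF a b c meet that] .
    have above: "a \<le> e s" if "(c + 2) * g\<^sub>0 \<le> s" "s < N" for s using above_window[OF a b c meet that] .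
    have pk: "?p \<le> ?k" using c below by (intro card_LB_le) auto
    have pk': "?p' \<le> ?k" using above by (intro card_RB_le) auto
    have Bp: "0 < real B" using B by simp
    have run: "io_run D (rnd w B [0, a, b]) = ([], Some (if g\<^sub>0 \<le> ?p \<or> g\<^sub>0 \<le> ?p' then [4, a, b, top\<^sub>0, 0] else [1, a, b, c, ?i, 0]))"
      unfolding run0 start_rnd_def
      using left_overflow[OF a b c meet] right_overflow[OF a b c meet] by (simp add: loc)
    show ?thesis
    proof (cases "g\<^sub>0 \<le> ?p \<or> g\<^sub>0 \<le> ?p'")
      case True
      then have "g\<^sub>0 \<le> ?k" using pk pk' by linarith
      then obtain L t where L: "RE [4, a, b, top\<^sub>0, 0] L t [6, a, b, top\<^sub>0, 0]" "distinct L" "set L = Rep a b"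
        "real t \<le> 3 + 100 * (real ?k / B)" using big_mode[OF a b] by blast
      have s4: "[4, a, b, top\<^sub>0, 0] \<in> states w" and s6: "[6, a, b, top\<^sub>0, 0] \<in> states w"
        by (rule big_state(1)[OF a b]; simp)+
      have "RE [0, a, b] [] 1 [4, a, b, top\<^sub>0, 0]" by (rule RE_step[OF s0 s4]) (use run True in simp_all)
      then have re: "RE [0, a, b] L (1 + t) [6, a, b, top\<^sub>0, 0]" using RE_trans[OF _ L(1)] by fastforce
      have fin: "io_run D (rnd w B [6, a, b, top\<^sub>0, 0]) = ([], None)" using run_done[OF a b, of top\<^sub>0 0] by simp
      have "real (1 + t) \<le> 110 * (real (card (\<kappa> ` inrange a b)) / B + 1)"
      proof -
        have "0 \<le> real ?k / B" by simp
        then have "real (1 + t) \<le> 110 * (real ?k / B + 1)" using L(4) by simp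
        then show ?thesis by (simp add: card_Rep)
      qed
      moreover have "inj_on \<kappa> (set L)" "\<kappa> ` set L = \<kappa> ` inrange a b" unfolding L(3) by (rule inj_on_Rep, rule Rep_image)
      ultimately show ?thesis using re s6 fin L(2) by blast
    next
      case False
      then have small: "?p \<le> g\<^sub>0" "?p' \<le> g\<^sub>0" by auto
      obtain l1 t1 where l1: "RE [1, a, b, c, ?i, 0] l1 t1 [2, a, b, c, ?i, ?i - 1]" "t1 \<le> ?p div B + 2" "distinct l1"
        "set l1 = {s \<in> LB (c * g\<^sub>0). a \<le> e s}" using scan_left[OF a b c meet i small(1)] by blast
      obtain l2 t2 where l2: "RE [2, a, b, c, ?i, ?i - 1] l2 t2 [3, a, b, c, ?i, 0]" "distinct l2"
        "set l2 = Rep a b \<inter> window c" "B * t2 \<le> 2 * ?k + 4 * B" using walk[OF a b c meet] by blast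
      obtain l3 t3 s where l3: "RE [3, a, b, c, ?i, 0] l3 t3 s" "s \<in> states w" "io_run D (rnd w B s) = ([], None)"
        "t3 \<le> ?p' div B + 1" "distinct l3" "set l3 = {r \<in> Rep a b. (c + 2) * g\<^sub>0 \<le> r}"
        using scan_right[OF a b c meet i small(2)] by blast
      have "[1, a, b, c, ?i, 0] \<in> states w" using a b c i by (intro small_state) auto
      then have "RE [0, a, b] [] 1 [1, a, b, c, ?i, 0]" by (intro RE_step[OF s0]) (use run False in simp_all)
      then have re: "RE [0, a, b] (l1 @ l2 @ l3) (1 + (t1 + (t2 + t3))) s"
        using RE_trans[OF _ RE_trans[OF l1(1) RE_trans[OF l2(1) l3(1)]]] by fastforce
      have end2: "(c + 2) * g\<^sub>0 = c * g\<^sub>0 + 2 * g\<^sub>0" by (simp add: algebra_simps)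
      have set: "set (l1 @ l2 @ l3) = cover (c * g\<^sub>0) a b"
        unfolding cover_def set_append l1(4) l2(3) l3(6) end2 by (auto simp: window_def Rep_def inrange_def)
      have "distinct (l1 @ l2 @ l3)"
        using l1(3) l2(2) l3(5) l1(4) l2(3) l3(6) unfolding end2 by (auto simp: LB_def window_def)
      moreover have "inj_on \<kappa> (set (l1 @ l2 @ l3))" unfolding set by (rule inj_on_cover)
      moreover have "\<kappa> ` set (l1 @ l2 @ l3) = \<kappa> ` inrange a b" unfolding set
        by (rule cover_image) (use c below in auto)
      moreover have "real (1 + (t1 + (t2 + t3))) \<le> 110 * (real (card (\<kappa> ` inrange a b)) / B + 1)"
      proof -
        have d: "real (q div B) \<le> real ?k / B" if "q \<le> ?k" for q
        proof -
          have "real (q div B) \<le> real q / B" by (rule of_nat_div_le_of_nat)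
          also have "\<dots> \<le> real ?k / B" using that by (intro divide_right_mono) auto
          finally show ?thesis .
        qed
        define X where "X = real ?k / B"
        have "real t1 \<le> X + 2" using l1(2) d[OF pk] unfolding X_def by linarith
        moreover have "real t3 \<le> X + 1" using l3(4) d[OF pk'] unfolding X_def by linarith
        moreover have "real t2 \<le> 2 * X + 4"
        proof -
          have "real (B * t2) \<le> real (2 * ?k + 4 * B)" using l2(4) by (simp only: of_nat_le_iff)
          then have "real B * real t2 \<le> 2 * real ?k + 4 * real B" by simp
          then show ?thesis using Bp unfolding X_def by (simp add: field_simps)
        qed
        moreover have "0 \<le> X" unfolding X_def by simp
        ultimately have "real (1 + (t1 + (t2 + t3))) \<le> 110 * (X + 1)" by simp
        then have "real (1 + (t1 + (t2 + t3))) \<le> 110 * (real ?k / B + 1)" unfolding X_def .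
        then show ?thesis by (simp add: card_Rep)
      qed
      ultimately show ?thesis using re l3 by blast
    qed
  qed
qed

end

section \<open>Construction of the data structure\<close>

locale cbuild = trie N e \<kappa> w "gsz w B" "fan w"
  for N :: nat and e \<kappa> :: "nat \<Rightarrow> nat" and w B :: nat +
  assumes B1: "B \<ge> 1" and \<kappa>_less: "\<And>r. r < N \<Longrightarrow> \<kappa> r < 2 ^ w"
begin

abbreviation (input) g' where "g' \<equiv> gsz w B"
abbreviation (input) n' where "n' \<equiv> nblk w"
abbreviation (input) nb' where "nb' \<equiv> nbc w B N"

lemma N_le_w: "N \<le> 2 ^ w"
proof -
  have "inj_on e {..<N}" by (rule inj_onI) (metis e_less_iff lessThan_iff linorder_neqE_nat less_irrefl)
  then have "card {..<N} = card (e ` {..<N})" by (simp add: card_image)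
  also have "\<dots> \<le> card {..<(2::nat) ^ w}" using e_w by (intro card_mono) auto
  finally show ?thesis by simp
qed

lemma n'_pos: "n' \<ge> 1" and fan_pos: "fan w \<ge> 1" and g'_eq: "g' = n' * B" and n'_le: "n' \<le> g'"
  using fan_bounds[OF w1] B1 by (auto simp: gsz_def)

lemmas nb'_iff = nbc_iff[OF B1, where w = w and N = N]

lemma nb'_le: "nb' c \<le> 2 * n'" "nb' c \<le> N"
proof -
  show "nb' c \<le> 2 * n'" using nb'_iff[of "2 * n'" c] by (meson leI less_irrefl)
  have "\<not> N < nb' c"
  proof
    assume "N < nb' c"
    then have "c * g' + N * B < N" using nb'_iff[of N c] by blast
    moreover have "N * 1 \<le> N * B" using B1 by (intro mult_le_mono2)
    ultimately show False by linarith
  qed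
  then show "nb' c \<le> N" by simp
qed

lemma ntc_le: "ntc w B N c \<le> 2 * fan w" "ntc w B N c \<le> N"
proof -
  have "\<not> 2 * fan w < ntc w B N c"
  proof
    assume "2 * fan w < ntc w B N c"
    then have "2 * fan w * fan w < nb' c" by (simp add: ntc_iff[OF w1])
    then show False using nb'_le(1)[of c] by (simp add: nblk_def)
  qed
  then show "ntc w B N c \<le> 2 * fan w" by simp
  have "\<not> N < ntc w B N c"
  proof
    assume "N < ntc w B N c"
    then have "N * fan w < nb' c" by (simp add: ntc_iff[OF w1])
    moreover have "N * 1 \<le> N * fan w" using fan_pos by (intro mult_le_mono2)
    ultimately show False using nb'_le(2)[of c] by simp
  qed
  then show "ntc w B N c \<le> N" by simp
qed

definition chainP :: "nat \<Rightarrow> (nat \<Rightarrow> nat set) \<times> (nat \<Rightarrow> nat set) \<times> (nat \<Rightarrow> nat set) \<Rightarrow> bool" where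
  "chainP c = (\<lambda>(E, F, snap). (\<forall>i\<le>2 * n'. E i \<subseteq> {1..<nb' c} \<and> F i \<subseteq> {1..<nb' c}) \<and>
    (\<forall>x. finite (snap x) \<and> card (snap x) \<le> B) \<and>
    (\<forall>i\<le>2 * n'. \<forall>x<nb' c. seg_hi (nb' c) (E i) x = Suc (seg_lo (E i) x) \<or>
      (\<exists>z. F i \<inter> {seg_lo (E i) x<..<seg_hi (nb' c) (E i) x} = {z} \<and>
        seg_union (alive B (c * g') i) (seg_lo (E i) x) (seg_hi (nb' c) (E i) x) \<subseteq> snap z \<and>
        snap z \<subseteq> seg_union (alive B (c * g') (2 * n')) (seg_lo (E i) x) (seg_hi (nb' c) (E i) x))) \<and>
    (\<forall>i\<le>2 * n'. \<forall>z\<in>E i. B < card (seg_union (alive B (c * g') i) (seg_lo (E i) (z - 1)) (seg_hi (nb' c) (E i) z))))"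

definition ch where "ch c = (SOME x. chainP c x)"
definition Ec where "Ec c = fst (ch c)"
definition Fc where "Fc c = fst (snd (ch c))"
text \<open>Restricting to existing boundaries and ranks keeps the array of snapshots short. Nothing
  relevant is lost, since segments contain only ranks below N.\<close>

definition Sc where "Sc c x = (if x < nb' c then snd (snd (ch c)) x \<inter> {..<N} else {})"

lemma ch: "chainP c (ch c)"
proof -
  have "\<exists>E F snap. chainP c (E, F, snap)" unfolding chainP_def prod.case
  proof (rule snapshot_chain)
    show "alive B (c * g') i y \<subseteq> alive B (c * g') j y" if "i \<le> j" for i j y
    proof -
      have "c * g' + i * B \<le> c * g' + j * B" using mult_le_mono1[OF that, of B] by simp
      then show ?thesis unfolding alive_def using le_trans by blast
    qed
    show "finite (alive B (c * g') i y)" for i y by (simp add: alive_def)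
    fix y
    have "alive B (c * g') (2 * n') y \<subseteq> {c * g' + y * B..<c * g' + y * B + B}" by (auto simp: alive_def)
    then show "card (alive B (c * g') (2 * n') y) \<le> B"
      using card_mono[of "{c * g' + y * B..<c * g' + y * B + B}"] by fastforce
  qed
  then have "\<exists>x. chainP c x" by blast
  then show ?thesis unfolding ch_def by (rule someI_ex)
qed

lemma chain_facts:
  "i \<le> 2 * n' \<Longrightarrow> Ec c i \<subseteq> {1..<nb' c} \<and> Fc c i \<subseteq> {1..<nb' c}"
  "finite (Sc c x) \<and> card (Sc c x) \<le> B"
  "i \<le> 2 * n' \<Longrightarrow> x < nb' c \<Longrightarrow> seg_hi (nb' c) (Ec c i) x = Suc (seg_lo (Ec c i) x) \<or>
      (\<exists>z. Fc c i \<inter> {seg_lo (Ec c i) x<..<seg_hi (nb' c) (Ec c i) x} = {z} \<and>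
        seg_union (alive B (c * g') i) (seg_lo (Ec c i) x) (seg_hi (nb' c) (Ec c i) x) \<subseteq> Sc c z \<and>
        Sc c z \<subseteq> seg_union (alive B (c * g') (2 * n')) (seg_lo (Ec c i) x) (seg_hi (nb' c) (Ec c i) x))"
  "i \<le> 2 * n' \<Longrightarrow> z \<in> Ec c i \<Longrightarrow> B < card (seg_union (alive B (c * g') i) (seg_lo (Ec c i) (z - 1)) (seg_hi (nb' c) (Ec c i) z))"
proof -
  have "chainP c (Ec c, Fc c, snd (snd (ch c)))" using ch[of c] by (simp add: Ec_def Fc_def)
  note P = this[unfolded chainP_def prod.case]
  show sub: "Ec c i \<subseteq> {1..<nb' c} \<and> Fc c i \<subseteq> {1..<nb' c}" if "i \<le> 2 * n'"
    using P[THEN conjunct1, rule_format, OF that] .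
  have fc: "finite (snd (snd (ch c)) x)" "card (snd (snd (ch c)) x) \<le> B"
    using P[THEN conjunct2, THEN conjunct1] by auto
  have "card (snd (snd (ch c)) x \<inter> {..<N}) \<le> card (snd (snd (ch c)) x)" using fc(1) by (intro card_mono) auto
  then show "finite (Sc c x) \<and> card (Sc c x) \<le> B" using fc by (simp add: Sc_def)
  show "B < card (seg_union (alive B (c * g') i) (seg_lo (Ec c i) (z - 1)) (seg_hi (nb' c) (Ec c i) z))"
    if "i \<le> 2 * n'" "z \<in> Ec c i"
    using P[THEN conjunct2, THEN conjunct2, THEN conjunct2, rule_format, OF that] .
  assume i: "i \<le> 2 * n'" and x: "x < nb' c"
  show "seg_hi (nb' c) (Ec c i) x = Suc (seg_lo (Ec c i) x) \<or>
      (\<exists>z. Fc c i \<inter> {seg_lo (Ec c i) x<..<seg_hi (nb' c) (Ec c i) x} = {z} \<and>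
        seg_union (alive B (c * g') i) (seg_lo (Ec c i) x) (seg_hi (nb' c) (Ec c i) x) \<subseteq> Sc c z \<and>
        Sc c z \<subseteq> seg_union (alive B (c * g') (2 * n')) (seg_lo (Ec c i) x) (seg_hi (nb' c) (Ec c i) x))"
  proof (cases "seg_hi (nb' c) (Ec c i) x = Suc (seg_lo (Ec c i) x)")
    case False
    let ?s = "seg_lo (Ec c i) x" and ?t = "seg_hi (nb' c) (Ec c i) x"
    have "\<exists>z. Fc c i \<inter> {?s<..<?t} = {z} \<and> seg_union (alive B (c * g') i) ?s ?t \<subseteq> snd (snd (ch c)) z \<and>
      snd (snd (ch c)) z \<subseteq> seg_union (alive B (c * g') (2 * n')) ?s ?t"
      using P[THEN conjunct2, THEN conjunct2, THEN conjunct1, rule_format, OF i x]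
      by (rule disjE) (erule notE[OF False], assumption)
    then obtain z where z: "Fc c i \<inter> {?s<..<?t} = {z}" "seg_union (alive B (c * g') i) ?s ?t \<subseteq> snd (snd (ch c)) z"
      "snd (snd (ch c)) z \<subseteq> seg_union (alive B (c * g') (2 * n')) ?s ?t" by (elim exE conjE)
    have "z \<in> Fc c i" using z(1) by blast
    then have "z < nb' c" using sub[OF i] by auto
    then have S: "Sc c z = snd (snd (ch c)) z \<inter> {..<N}" by (simp add: Sc_def)
    have le: "seg_union (alive B (c * g') i) ?s ?t \<subseteq> {..<N}" by (auto simp: seg_union_def alive_def)
    show ?thesis
    proof (intro disjI2 exI conjI)
      show "Fc c i \<inter> {?s<..<?t} = {z}" by (rule z(1))
      show "seg_union (alive B (c * g') i) ?s ?t \<subseteq> Sc c z" unfolding S by (rule Int_greatest[OF z(2) le])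
      show "Sc c z \<subseteq> seg_union (alive B (c * g') (2 * n')) ?s ?t" unfolding S by (rule le_infI1[OF z(3)])
    qed
  qed (rule disjI1)
qed

definition r1 where "r1 = (SOME x. fst x < 2 ^ (2000 * w) \<and> (\<forall>\<beta>. snd x \<beta> < 2 ^ (2000 * w)) \<and>
  (\<forall>k\<in>K1. hsh w N (fst x) k < N \<and> rtv w (snd x (hsh w N (fst x) k)) k = TL (fst k) (snd k)))"

lemma K_nodes: "K0 \<subseteq> nodes w" "K1 \<subseteq> nodes w" by (auto simp: K0_def K1_def)

lemma r1: "fst r1 < 2 ^ (2000 * w)" "\<And>\<beta>. snd r1 \<beta> < 2 ^ (2000 * w)"
  "k \<in> K1 \<Longrightarrow> hsh w N (fst r1) k < N \<and> rtv w (snd r1 (hsh w N (fst r1) k)) k = TL (fst k) (snd k)"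
proof -
  have "\<exists>i tab. i < 2 ^ (2000 * w) \<and> (\<forall>\<beta>. tab \<beta> < 2 ^ (2000 * w)) \<and>
    (\<forall>k\<in>K1. hsh w N i k < N \<and> rtv w (tab (hsh w N i k)) k = TL (fst k) (snd k))"
  proof (rule small_retrieval[OF w1 N1 N_le_w K_nodes(2)])
    show "card K1 \<le> N * (13 * 2 ^ lev w)" using card_K1 by (simp add: fan_def)
    fix k assume "k \<in> K1"
    then have "\<not> heavy (fst k) (snd k)" "fst k \<le> w" by (auto simp: K1_def nodes_def)
    then have "TL (fst k) (snd k) \<le> w" by (rule TL(2))
    then show "TL (fst k) (snd k) < nval w" using nval_gt(1)[OF w1] by simp
  qed
  then have "\<exists>x. fst x < 2 ^ (2000 * w) \<and> (\<forall>\<beta>. snd x \<beta> < 2 ^ (2000 * w)) \<and>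
    (\<forall>k\<in>K1. hsh w N (fst x) k < N \<and> rtv w (snd x (hsh w N (fst x) k)) k = TL (fst k) (snd k))" by simp
  from someI_ex[OF this, folded r1_def]
  show "fst r1 < 2 ^ (2000 * w)" "\<And>\<beta>. snd r1 \<beta> < 2 ^ (2000 * w)"
    "k \<in> K1 \<Longrightarrow> hsh w N (fst r1) k < N \<and> rtv w (snd r1 (hsh w N (fst r1) k)) k = TL (fst k) (snd k)" by blast+
qed

lemma word_tables:
  obtains i tab off slot where "i < 2 ^ (2000 * w)" "\<And>\<beta>. tab \<beta> < 2 ^ (2000 * w)" "\<And>\<beta>. off \<beta> \<le> card K0"
    "\<And>j. slot j \<in> insert 0 (pay ` K0)"
    "\<And>k. k \<in> K0 \<Longrightarrow> hsh w N i k < N \<and> off (hsh w N i k) + rtv w (tab (hsh w N i k)) k < card K0 \<and>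
       slot (off (hsh w N i k) + rtv w (tab (hsh w N i k)) k) = pay k"
proof -
  have "card K0 \<le> N * (13 * 2 ^ lev w)"
  proof -
    have "13 * N * 1 \<le> 13 * N * 2 ^ lev w" by (intro mult_le_mono2) simp
    then have "card K0 \<le> 13 * N * 2 ^ lev w" using card_K0 by linarith
    then show ?thesis by (simp only: ac_simps)
  qed
  from word_retrieval[OF w1 N1 N_le_w K_nodes(1) this, of pay] that show ?thesis by blast
qed

definition dlist where "dlist nid = (if \<exists>l y. l \<le> topl w B N \<and> y < 2 ^ (topl w B N - l) \<and> node_id l y = nid
  then (case (SOME (l, y). l \<le> topl w B N \<and> y < 2 ^ (topl w B N - l) \<and> node_id l y = nid) of (l, y) \<Rightarrow>
    sort_key pf (sorted_list_of_set (dnode g' l y))) else [])"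

text \<open>A positive number is an odd number times a power of two in only one way.\<close>

lemma node_id_inj: "node_id l y = node_id l' y' \<Longrightarrow> l = l' \<and> y = y'"
proof -
  assume eq: "node_id l y = node_id l' y'"
  have pos: "0 < (2 * y + 1) * 2 ^ l" "0 < (2 * y' + 1) * 2 ^ l'" by simp_all
  then have eq: "(2 * y + 1) * 2 ^ l = (2 * y' + 1) * 2 ^ l'" using eq unfolding node_id_def by linarith
  have aux: False if eq: "(2 * y + 1) * 2 ^ l = (2 * y' + 1) * 2 ^ l'" and lt: "l < l'" for l l' y y' :: nat
  proof -
    obtain d where d: "l' = l + Suc d" using lt less_iff_Suc_add[of l l'] by auto
    have "(2 * y + 1) * 2 ^ l = ((2 * y' + 1) * 2 ^ Suc d) * 2 ^ l" using eq unfolding d power_add by (simp only: ac_simps)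
    then have "2 * y + 1 = (2 * y' + 1) * 2 ^ Suc d" by (simp only: mult_cancel2) simp
    then have "even (2 * y + 1)" by simp
    then show False by simp
  qed
  then have "l = l'" using eq by (metis linorder_neqE_nat)
  then show ?thesis using eq by simp
qed

lemma dlist_node:
  assumes "l \<le> topl w B N" "y < 2 ^ (topl w B N - l)"
  shows "dlist (node_id l y) = sort_key pf (sorted_list_of_set (dnode g' l y))"
proof -
  let ?P = "\<lambda>(l', y'). l' \<le> topl w B N \<and> y' < 2 ^ (topl w B N - l') \<and> node_id l' y' = node_id l y"
  have "(SOME x. ?P x) = (l, y)"
  proof (rule some_equality)
    show "?P (l, y)" using assms by simp
    fix x assume "?P x"
    then have "node_id (fst x) (snd x) = node_id l y" by (simp add: case_prod_unfold)
    then have "fst x = l \<and> snd x = y" by (rule node_id_inj)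
    then show "x = (l, y)" by (simp add: prod_eq_iff)
  qed
  moreover have "\<exists>l' y'. l' \<le> topl w B N \<and> y' < 2 ^ (topl w B N - l') \<and> node_id l' y' = node_id l y"
    using assms by blast
  ultimately show ?thesis unfolding dlist_def by (simp only: if_True prod.case)
qed

lemma dlist_subset: "set (dlist nid) \<subseteq> {..<N}"
proof (cases "\<exists>l y. l \<le> topl w B N \<and> y < 2 ^ (topl w B N - l) \<and> node_id l y = nid")
  case True
  then obtain l y where l: "l \<le> topl w B N" "y < 2 ^ (topl w B N - l)" "node_id l y = nid" by blast
  have "finite (dnode g' l y)" "dnode g' l y \<subseteq> {..<N}" by (auto simp: dnode_def)
  then show ?thesis using dlist_node[OF l(1,2)] l(3) by simp
next
  case False
  then have "dlist nid = []" unfolding dlist_def by (rule if_not_P)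
  then show ?thesis by simp
qed

lemma top_bound: "l \<le> topl w B N \<Longrightarrow> 0 < l \<Longrightarrow> 2 ^ l * g' < 2 * N"
proof -
  assume l: "l \<le> topl w B N" "0 < l"
  let ?t = "topl w B N"
  have "\<not> N \<le> 2 ^ (?t - 1) * g'"
  proof
    assume "N \<le> 2 ^ (?t - 1) * g'"
    then have "?t \<le> ?t - 1" unfolding topl_def by (rule Least_le)
    then show False using l by simp
  qed
  moreover have "(2::nat) ^ l \<le> 2 ^ ?t" using l by (intro power_increasing) auto
  then have "2 ^ l * g' \<le> 2 ^ ?t * g'" by (rule mult_le_mono1)
  moreover have "2 ^ ?t * g' = 2 * (2 ^ (?t - 1) * g')" using l by (cases ?t) auto
  ultimately show ?thesis by linarith
qed

text \<open>A nonempty node starts before N, and a node above the leaves is shorter than 2 N by the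
  minimality of the tree height. In-order numbers double the start and add one length: 2 N + 2 N,
  and N for q.\<close>

lemma dlist_support: assumes "q < length (dlist nid)" "q < g'" shows "nid * g' + q < 5 * N"
proof -
  have "\<exists>l y. l \<le> topl w B N \<and> y < 2 ^ (topl w B N - l) \<and> node_id l y = nid"
  proof (rule ccontr)
    assume "\<not> ?thesis"
    then have "dlist nid = []" unfolding dlist_def by (rule if_not_P)
    then show False using assms(1) by simp
  qed
  then obtain l y where l: "l \<le> topl w B N" "y < 2 ^ (topl w B N - l)" "node_id l y = nid" by blast
  have fin: "finite (dnode g' l y)" by (simp add: dnode_def)
  have "q < card (dnode g' l y)" using assms(1) dlist_node[OF l(1,2)] l(3) by (simp add: length_sorted_list_of_set)
  moreover have "card (dnode g' l y) \<le> card {..<N}" by (intro card_mono) (auto simp: dnode_def)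
  ultimately have q: "q < N" "dnode g' l y \<noteq> {}" by auto
  then have lo: "y * 2 ^ l * g' < N" by (auto simp: dnode_def)
  \<comment> \<open>The subtraction of 1 in \<open>node_id\<close> matters for leaves: their length
    \<open>g'\<close> may be far above N.\<close>
  have "nid * g' \<le> 2 * (y * 2 ^ l * g') + (if l = 0 then 0 else 2 ^ l * g')"
  proof (cases "l = 0")
    case True
    then show ?thesis using l(3) by (auto simp: node_id_def)
  next
    case False
    have "nid \<le> (2 * y + 1) * 2 ^ l" using l(3) by (auto simp: node_id_def)
    then have "nid * g' \<le> (2 * y + 1) * 2 ^ l * g'" by (rule mult_le_mono1)
    then show ?thesis using False by (simp add: algebra_simps)
  qed
  moreover have "(if l = 0 then 0 else 2 ^ l * g') \<le> 2 * N" using top_bound[OF l(1)] by (auto simp: less_imp_le)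
  ultimately show ?thesis using lo q(1) by linarith
qed

definition arr :: "nat \<Rightarrow> (nat \<Rightarrow> nat) \<Rightarrow> (nat \<Rightarrow> nat) \<Rightarrow> (nat \<Rightarrow> nat) \<Rightarrow> nat \<Rightarrow> nat \<Rightarrow> nat list" where
  "arr s0 tab off slot i m = (
    if i = 0 then (if m = 0 then [N, fst r1, s0] else [])
    else if i = 1 then (if m < N then ent m else [])
    else if i = 2 then (let c = m div g' in if c * g' < N then pad (map entl (rev (sorted_list_of_set (LB (c * g'))))) (m mod g') else [])
    else if i = 3 then (let c = m div g' in if c * g' < N then pad (map ent (sorted_list_of_set (RB ((c + 2) * g')))) (m mod g') else [])
    else if i = 4 then (let t = m div B; c = t div (2 * n') in if c * g' < N then
      pad (map ent (sorted_list_of_set (Sc c (t mod (2 * n'))))) (m mod B) else [])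
    else if i = 5 then (let c = m div (2 * n' + 1); j = m mod (2 * n' + 1) in if c * g' < N \<and> j \<le> nb' c then
      map (\<lambda>x. of_bool (x \<in> Ec c j) + 2 * of_bool (x \<in> Fc c j)) [0..<nb' c] else [])
    else if i = 6 then (let c = m div (2 * fan w + 1); u = m mod (2 * fan w + 1) in if c * g' < N \<and> u \<le> ntc w B N c then
      (if u = 0 then sketch (ntc w B N c) (\<lambda>t. e (c * g' + t * (fan w * B)))
       else sketch (min (fan w) (nb' c - (u - 1) * fan w)) (\<lambda>v. e (c * g' + (u - 1) * fan w * B + v * B))) else [])
    else if i = 7 then pad (map ent (dlist (m div g'))) (m mod g')
    else if i = 8 then (if m < N then [snd r1 m] else [])
    else if i = 9 then (if m < N then [off m, tab m] else [])
    else if i = 10 then (if m < card K0 then [slot m] else [])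
    else [])"

lemma array_index_cases:
  obtains "i = 0" | "i = 1" | "i = 2" | "i = 3" | "i = 4" | "i = 5" | "i = 6" | "i = 7" | "i = 8" | "i = 9" | "i = (10::nat)" | "i > 10"
proof (cases "i > 10")
  case False
  then have "i < 11" by simp
  then show ?thesis using that(1-11) by (auto simp: numeral_eq_Suc less_Suc_eq)
qed (rule that(12))

lemma bit_sum: "odd (of_bool P + 2 * of_bool Q :: nat) = P" "(2 \<le> (of_bool P + 2 * of_bool Q :: nat)) = Q"
  by (cases P; cases Q; simp)+

lemma nat_list_items: "length xs \<le> 8 \<Longrightarrow> (\<And>x. x \<in> set xs \<Longrightarrow> x < 2 ^ (2000 * w)) \<Longrightarrow> xs \<in> items w"
  by (auto simp: items_def)

lemma small_less: "x \<le> 13 * 2 ^ w \<Longrightarrow> x < 2 ^ (2000 * w)" for x :: nat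
proof -
  assume "x \<le> 13 * 2 ^ w"
  also have "13 * (2::nat) ^ w < 16 * 2 ^ w" by simp
  also have "16 * (2::nat) ^ w = 2 ^ (4 + w)" by (simp add: power_add)
  also have "\<dots> \<le> 2 ^ (2000 * w)" using w1 by (intro power_increasing) auto
  finally show ?thesis .
qed

lemma ent_items: "r < N \<Longrightarrow> ent r \<in> items w" "r < N \<Longrightarrow> entl r \<in> items w"
proof -
  assume r: "r < N"
  have "pf r \<le> 2 ^ w" using pv_pos(1)[of r] e_w[of "pv r - 1"] r by (auto simp: pf_def Suc_le_eq)
  then have "x < 2 ^ (2000 * w)" if "x \<in> {e r, pf r, \<kappa> r, 0}" for x
    using that e_w[OF r] \<kappa>_less[OF r] by (intro small_less) auto
  moreover have "set (ent r) \<subseteq> {e r, pf r, \<kappa> r, 0}" "set (entl r) \<subseteq> {e r, pf r, \<kappa> r, 0}"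
    "length (ent r) \<le> 8" "length (entl r) \<le> 8" by (simp_all add: ent_def entl_def)
  ultimately show "ent r \<in> items w" "entl r \<in> items w" by (meson nat_list_items subsetD)+
qed

lemma pad_items: "(\<And>x. x \<in> set xs \<Longrightarrow> x \<in> items w) \<Longrightarrow> pad xs q \<in> items w"
  by (auto simp: pad_def items_def)

lemma nil_items: "[] \<in> items w" by (simp add: items_def)

text \<open>All arrays are supported below 13 N + B: there are at most 13 N window slots by
  \<open>card_K0\<close>, and B accounts for a last, partly filled snapshot block.\<close>

definition \<Lambda>' where "\<Lambda>' = 14 * (N div B + 1)"

lemma \<Lambda>'_bound: "13 * N + B \<le> \<Lambda>' * B"
proof -
  have "N = N div B * B + N mod B" by (simp only: div_mult_mod_eq)
  moreover have "N mod B < B" using B1 by simp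
  moreover have "(N div B + 1) * B = N div B * B + B" by simp
  ultimately have "N < (N div B + 1) * B" by linarith
  moreover have "B \<le> (N div B + 1) * B" by simp
  ultimately show ?thesis unfolding \<Lambda>'_def mult.assoc by linarith
qed

lemma \<Lambda>'_items: "[\<Lambda>'] \<in> items w"
proof (rule nat_list_items)
  have "14 * (q + 1) \<le> 28 * p" if "q \<le> p" "1 \<le> p" for q p :: nat using that by presburger
  from this[OF order_trans[OF div_le_dividend N_le_w]] have "\<Lambda>' \<le> 28 * 2 ^ w" unfolding \<Lambda>'_def by simp
  also have "\<dots> < 32 * 2 ^ w" by simp
  also have "(32::nat) * 2 ^ w = 2 ^ (5 + w)" by (simp add: power_add)
  also have "\<dots> \<le> 2 ^ (2000 * w)" using w1 by (intro power_increasing) auto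
  finally show "x < 2 ^ (2000 * w)" if "x \<in> set [\<Lambda>']" for x using that by simp
qed simp

context
  fixes s0 :: nat and tab off slot :: "nat \<Rightarrow> nat"
  assumes s0: "s0 < 2 ^ (2000 * w)" and tab: "\<And>\<beta>. tab \<beta> < 2 ^ (2000 * w)" and off: "\<And>\<beta>. off \<beta> \<le> card K0"
    and slot: "\<And>j. slot j \<in> insert 0 (pay ` K0)"
    and ret: "\<And>k. k \<in> K0 \<Longrightarrow> hsh w N s0 k < N \<and> off (hsh w N s0 k) + rtv w (tab (hsh w N s0 k)) k < card K0 \<and>
       slot (off (hsh w N s0 k) + rtv w (tab (hsh w N s0 k)) k) = pay k"
begin

abbreviation (input) Y where "Y \<equiv> arr s0 tab off slot"

lemma sketch_items:
  assumes "\<And>i. i < m \<Longrightarrow> k i < 2 ^ w" "m \<le> 2 * fan w" shows "sketch m k \<in> items w"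
  using sketch_bounds[of m k w] assms by (auto simp: items_def)

lemma arr_items: "Y i m \<in> items w"
proof -
  have ents: "pad (map ent xs) q \<in> items w" "pad (map entl xs) q \<in> items w" if "set xs \<subseteq> {..<N}" for xs q
    using that by (auto intro!: pad_items ent_items)
  have Nw: "N \<le> 13 * 2 ^ w" using N_le_w by simp
  have Kw: "card K0 \<le> 13 * 2 ^ w" using card_K0 N_le_w by linarith
  have payw: "slot j \<le> 13 * 2 ^ w" for j
  proof -
    have "pay k \<le> N" for k
    proof -
      have "pay k * 1 \<le> pay k * g'" using g_pos by (intro mult_le_mono2)
      then have "pay k \<le> pay k * g'" by (simp only: mult_1_right)
      moreover have "pay k * g' < N" using pay(1)[of "fst k" "snd k"] by simp
      ultimately show ?thesis by linarith
    qed
    then have "slot j \<le> N" using slot[of j] by auto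
    then show ?thesis using Nw by linarith
  qed
  show ?thesis
  proof (cases rule: array_index_cases[of i])
    case 1
    then show ?thesis using s0 r1(1) small_less[OF Nw] by (auto simp: arr_def nil_items intro!: nat_list_items)
  next
    case 2
    then show ?thesis by (simp add: arr_def nil_items ent_items)
  next
    case 3
    have "set (rev (sorted_list_of_set (LB \<beta>))) \<subseteq> {..<N}" if "\<beta> < N" for \<beta> using that by (auto simp: finite_LB) (auto simp: LB_def)
    then show ?thesis using 3 ents(2) by (simp add: arr_def nil_items Let_def del: set_rev)
  next
    case 4
    have "set (sorted_list_of_set (RB \<beta>)) \<subseteq> {..<N}" for \<beta> by (auto simp: finite_RB) (auto simp: RB_def)
    then show ?thesis using 4 ents(1) by (simp add: arr_def nil_items Let_def)
  next
    case 5
    have "set (sorted_list_of_set (Sc c x)) \<subseteq> {..<N}" for c x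
      using chain_facts(2)[of c x] by (auto simp: Sc_def split: if_splits)
    then show ?thesis using 5 ents(1) by (simp add: arr_def nil_items Let_def)
  next
    case 6
    have "map (\<lambda>x. of_bool (x \<in> X) + 2 * of_bool (x \<in> Z) :: nat) [0..<nb' c] \<in> items w" for X Z c
    proof -
      have "nb' c \<le> 2 * w" using nb'_le(1)[of c] fan_bounds(3)[OF w1] by linarith
      moreover have "of_bool P + 2 * of_bool Q < (4::nat)" for P Q by (cases P; cases Q; simp)
      ultimately have "map (\<lambda>x. of_bool (x \<in> X) + 2 * of_bool (x \<in> Z) :: nat) [0..<nb' c] \<in> {xs. set xs \<subseteq> {..<4} \<and> length xs \<le> 2 * w}"
        by auto
      then show ?thesis unfolding items_def by (rule UnI2)
    qed
    then show ?thesis using 6 by (simp add: arr_def nil_items Let_def)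
  next
    case 7
    let ?c = "m div (2 * fan w + 1)" and ?u = "m mod (2 * fan w + 1)"
    have top: "sketch (ntc w B N c) (\<lambda>t. e (c * g' + t * (fan w * B))) \<in> items w" for c
    proof (rule sketch_items[OF _ ntc_le(1)])
      fix t assume "t < ntc w B N c"
      then have "t * fan w < nb' c" by (simp add: ntc_iff[OF w1])
      then have "c * g' + t * fan w * B < N" by (simp add: nb'_iff)
      then show "e (c * g' + t * (fan w * B)) < 2 ^ w" by (intro e_w) (simp only: ac_simps)
    qed
    have sub: "sketch (min (fan w) (nb' c - u * fan w)) (\<lambda>v. e (c * g' + u * fan w * B + v * B)) \<in> items w" for c u
    proof (rule sketch_items)
      fix v assume "v < min (fan w) (nb' c - u * fan w)"
      then have "u * fan w + v < nb' c" by (simp add: less_diff_conv add.commute)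
      then have "c * g' + (u * fan w + v) * B < N" using nb'_iff by blast
      then show "e (c * g' + u * fan w * B + v * B) < 2 ^ w" by (intro e_w) (simp add: algebra_simps)
    qed simp
    show ?thesis using 7 top sub by (simp add: arr_def nil_items Let_def)
  next
    case 8
    have "pad (map ent (dlist (m div g'))) (m mod g') \<in> items w" by (rule ents(1)[OF dlist_subset])
    then show ?thesis using 8 by (simp add: arr_def)
  next
    case 9
    then show ?thesis using r1(2) by (auto simp: arr_def nil_items intro!: nat_list_items)
  next
    case 10
    have "off m \<le> 13 * 2 ^ w" using off[of m] Kw by linarith
    then show ?thesis using 10 tab small_less by (auto simp: arr_def nil_items intro!: nat_list_items)
  next
    case 11
    then show ?thesis using small_less[OF payw] by (auto simp: arr_def nil_items intro!: nat_list_items)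
  next
    case 12
    then show ?thesis by (simp add: arr_def nil_items)
  qed
qed

lemma pad_nonempty: "pad xs q \<noteq> [] \<Longrightarrow> q < length xs"
  by (simp add: pad_def split: if_splits)

lemma arr_support: assumes "Y i m \<noteq> []" shows "m < 13 * N + B"
proof -
  have gp: "0 < g'" using g_pos by simp
  have mg: "m = m div g' * g' + m mod g'" by (simp only: div_mult_mod_eq)
  \<comment> \<open>Windows start every \<open>g'\<close> ranks, so 2 q + 1 entries per window with
    q up to \<open>g'\<close> amount to at most three entries per rank.\<close>
  have le3: "c * (2 * q + 1) \<le> 3 * (c * g')" if "1 \<le> q" "q \<le> g'" for c q
  proof -
    have "c * (2 * q + 1) \<le> c * (3 * g')" using that by (intro mult_le_mono2) linarith
    then show ?thesis by simp
  qed
  have fg: "fan w \<le> g'"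
  proof -
    have "fan w * 1 \<le> fan w * fan w" using fan_pos by (intro mult_le_mono2)
    then have "fan w \<le> n'" unfolding nblk_def by (simp only: mult_1_right)
    then show ?thesis using n'_le by linarith
  qed
  show ?thesis
  proof (cases rule: array_index_cases[of i])
    case 1
    then show ?thesis using assms N1 by (auto simp: arr_def split: if_splits)
  next
    case 2
    then show ?thesis using assms by (auto simp: arr_def split: if_splits)
  next
    case 3
    let ?c = "m div g'"
    have c: "?c * g' < N" and p: "pad (map entl (rev (sorted_list_of_set (LB (?c * g'))))) (m mod g') \<noteq> []"
      using assms 3 unfolding arr_def by (simp_all add: Let_def del: div_mult_self1_is_m split: if_splits)
    have "card (LB (?c * g')) \<le> card {..<?c * g'}" by (intro card_mono) (auto simp: LB_def)
    then have "m mod g' < ?c * g'" using pad_nonempty[OF p] by (simp add: finite_LB length_sorted_list_of_set)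
    then show ?thesis using mg c by linarith
  next
    case 4
    let ?c = "m div g'"
    have c: "?c * g' < N" and p: "pad (map ent (sorted_list_of_set (RB ((?c + 2) * g')))) (m mod g') \<noteq> []"
      using assms 4 unfolding arr_def by (simp_all add: Let_def split: if_splits)
    have "card (RB ((?c + 2) * g')) \<le> card {..<N}" by (intro card_mono) (auto simp: RB_def)
    then have "m mod g' < N" using pad_nonempty[OF p] by (simp add: finite_RB length_sorted_list_of_set)
    then show ?thesis using mg c by linarith
  next
    case 5
    define t c x where "t = m div B" and "c = t div (2 * n')" and "x = t mod (2 * n')"
    have c: "c * g' < N" and p: "pad (map ent (sorted_list_of_set (Sc c x))) (m mod B) \<noteq> []"
      using assms 5 unfolding arr_def t_def c_def x_def by (simp_all add: Let_def split: if_splits)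
    have "Sc c x \<noteq> {}" using pad_nonempty[OF p] by auto
    then have "x < nb' c" by (auto simp: Sc_def split: if_splits)
    then have x: "c * g' + x * B < N" by (simp add: nb'_iff)
    have "m = t * B + m mod B" "t = c * (2 * n') + x" unfolding t_def c_def x_def by (simp_all only: div_mult_mod_eq)
    then have "m = 2 * (c * g') + x * B + m mod B" by (simp add: g'_eq algebra_simps)
    moreover have "m mod B < B" using B1 by simp
    ultimately show ?thesis using x c N1 by linarith
  next
    case 6
    define c j where "c = m div (2 * n' + 1)" and "j = m mod (2 * n' + 1)"
    have c: "c * g' < N \<and> j \<le> nb' c"
      using assms 6 unfolding arr_def c_def j_def by (simp add: Let_def split: if_splits)
    have "m = c * (2 * n' + 1) + j" unfolding c_def j_def by (simp only: div_mult_mod_eq)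
    moreover have "c * (2 * n' + 1) \<le> 3 * (c * g')" by (rule le3[OF n'_pos n'_le])
    ultimately show ?thesis using c nb'_le(2)[of c] B1 by linarith
  next
    case 7
    define c j where "c = m div (2 * fan w + 1)" and "j = m mod (2 * fan w + 1)"
    have c: "c * g' < N \<and> j \<le> ntc w B N c"
      using assms 7 unfolding arr_def c_def j_def by (simp add: Let_def split: if_splits)
    have "m = c * (2 * fan w + 1) + j" unfolding c_def j_def by (simp only: div_mult_mod_eq)
    moreover have "c * (2 * fan w + 1) \<le> 3 * (c * g')" by (rule le3[OF fan_pos fg])
    ultimately show ?thesis using c ntc_le(2)[of c] B1 by linarith
  next
    case 8
    then have "pad (map ent (dlist (m div g'))) (m mod g') \<noteq> []" using assms by (simp add: arr_def)
    then have "m mod g' < length (dlist (m div g'))" using pad_nonempty by fastforce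
    then have "m div g' * g' + m mod g' < 5 * N" using gp by (intro dlist_support) auto
    then show ?thesis using mg by linarith
  next
    case 9
    then show ?thesis using assms by (auto simp: arr_def split: if_splits)
  next
    case 10
    then show ?thesis using assms by (auto simp: arr_def split: if_splits)
  next
    case 11
    then show ?thesis using assms card_K0 by (auto simp: arr_def split: if_splits)
  next
    case 12
    then show ?thesis using assms by (simp add: arr_def)
  qed
qed

lemma arr_cquery: "cquery w B Y \<Lambda>' N e \<kappa> (fst r1) s0 Ec Fc Sc"
proof -
  have gp: "0 < g'" using g_pos by simp
  have idx: "(c * k + q) div k = c" "(c * k + q) mod k = q" if "q < k" for c k q :: nat using that by simp_all
  interpret disk_of w B Y \<Lambda>'
  proof
    show "Y i m = []" if "\<Lambda>' * B \<le> m" for i m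
      using arr_support[of i m] \<Lambda>'_bound that by linarith
  qed (use w1 B1 \<Lambda>'_items arr_items in auto)
  show ?thesis
  proof
    show "\<kappa> r < 2 ^ w" if "r < N" for r using \<kappa>_less[OF that] .
    show "Y 0 0 = [N, fst r1, s0]" by (simp add: arr_def)
    show "Y 1 m = (if m < N then ent m else [])" for m by (simp add: arr_def)
    show "Y 2 (c * g' + q) = pad (map entl (rev (sorted_list_of_set (LB (c * g'))))) q" if "c * g' < N" "q < g'" for c q
      using that(1) idx[OF that(2)] by (simp add: arr_def Let_def)
    show "Y 3 (c * g' + q) = pad (map ent (sorted_list_of_set (RB ((c + 2) * g')))) q" if "c * g' < N" "q < g'" for c q
      using that(1) idx[OF that(2)] by (simp add: arr_def Let_def)
    show "Y 4 ((c * (2 * n') + x) * B + q) = pad (map ent (sorted_list_of_set (Sc c x))) q" if "c * g' < N" "x < 2 * n'" "q < B" for c x q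
      unfolding arr_def Let_def idx[OF that(3)] idx[OF that(2)] using that(1) by simp
    show "dec_E (Y 5 (c * (2 * n' + 1) + j)) = Ec c j \<and> dec_F (Y 5 (c * (2 * n' + 1) + j)) = Fc c j \<and>
      length (Y 5 (c * (2 * n' + 1) + j)) = nb' c" if c: "c * g' < N" and j: "j \<le> nb' c" for c j
    proof -
      have j2: "j \<le> 2 * n'" and jlt: "j < 2 * n' + 1" using j nb'_le(1)[of c] by auto
      have Y5: "Y 5 (c * (2 * n' + 1) + j) = map (\<lambda>x. of_bool (x \<in> Ec c j) + 2 * of_bool (x \<in> Fc c j)) [0..<nb' c]"
        unfolding arr_def Let_def idx[OF jlt] using c j by simp
      have "Ec c j \<subseteq> {1..<nb' c}" "Fc c j \<subseteq> {1..<nb' c}" using chain_facts(1)[OF j2] by auto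
      then show ?thesis unfolding Y5 dec_E_def dec_F_def by (auto simp: bit_sum)
    qed
    show "Ec c j \<subseteq> {1..<nb' c} \<and> Fc c j \<subseteq> {1..<nb' c}" if "j \<le> 2 * n'" for c j using chain_facts(1)[OF that] .
    show "finite (Sc c x) \<and> card (Sc c x) \<le> B" for c x by (rule chain_facts(2))
    show "seg_hi (nb' c) (Ec c j) x = Suc (seg_lo (Ec c j) x) \<or>
      (\<exists>z. Fc c j \<inter> {seg_lo (Ec c j) x<..<seg_hi (nb' c) (Ec c j) x} = {z} \<and>
        seg_union (alive B (c * g') j) (seg_lo (Ec c j) x) (seg_hi (nb' c) (Ec c j) x) \<subseteq> Sc c z \<and>
        Sc c z \<subseteq> seg_union (alive B (c * g') (2 * n')) (seg_lo (Ec c j) x) (seg_hi (nb' c) (Ec c j) x))"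
      if "j \<le> 2 * n'" "x < nb' c" for c j x by (rule chain_facts(3)[OF that])
    show "B < card (seg_union (alive B (c * g') j) (seg_lo (Ec c j) (z - 1)) (seg_hi (nb' c) (Ec c j) z))"
      if "j \<le> 2 * n'" "z \<in> Ec c j" for c j z by (rule chain_facts(4)[OF that])
    show "Y 6 (c * (2 * fan w + 1)) = sketch (ntc w B N c) (\<lambda>t. e (c * g' + t * (fan w * B)))" if "c * g' < N" for c
    proof -
      have "(0::nat) < 2 * fan w + 1" by simp
      note i0 = idx[OF this, of c, unfolded add_0_right]
      show ?thesis unfolding arr_def Let_def i0 using that by simp
    qed
    show "Y 6 (c * (2 * fan w + 1) + Suc u) =
      sketch (min (fan w) (nb' c - u * fan w)) (\<lambda>v. e (c * g' + u * fan w * B + v * B))" if "c * g' < N" "u < ntc w B N c" for c u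
    proof -
      have "Suc u < 2 * fan w + 1" using that(2) ntc_le(1)[of c] by linarith
      note i0 = idx[OF this, of c]
      show ?thesis unfolding arr_def Let_def i0 using that by simp
    qed
    show "Y 7 (node_id l y * g' + q) = pad (map ent (sort_key pf (sorted_list_of_set (dnode g' l y)))) q"
      if "l \<le> topl w B N" "y < 2 ^ (topl w B N - l)" "q < g'" for l y q
      unfolding arr_def idx[OF that(3)] dlist_node[OF that(1,2)] by simp
    show "rtv w (Y 8 (hsh w N (fst r1) k) ! 0) k = TL (fst k) (snd k)" if "k \<in> K1" for k
      using r1(3)[OF that] by (simp add: arr_def)
    show "Y 10 (Y 9 (hsh w N s0 k) ! 0 + rtv w (Y 9 (hsh w N s0 k) ! 1) k) ! 0 = pay k" if "k \<in> K0" for k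
      using ret[OF that] by (simp add: arr_def)
  qed
qed

end

lemma exists_cquery: "\<exists>Y s1 s0 E F snap. cquery w B Y (14 * (N div B + 1)) N e \<kappa> s1 s0 E F snap"
proof -
  obtain i tab off slot where t: "i < 2 ^ (2000 * w)" "\<And>\<beta>. tab \<beta> < 2 ^ (2000 * w)" "\<And>\<beta>. off \<beta> \<le> card K0"
    "\<And>j. slot j \<in> insert 0 (pay ` K0)"
    "\<And>k. k \<in> K0 \<Longrightarrow> hsh w N i k < N \<and> off (hsh w N i k) + rtv w (tab (hsh w N i k)) k < card K0 \<and>
       slot (off (hsh w N i k) + rtv w (tab (hsh w N i k)) k) = pay k" using word_tables by blast
  have "cquery w B (arr i tab off slot) \<Lambda>' N e \<kappa> (fst r1) i Ec Fc Sc" by (rule arr_cquery[OF t])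
  then show ?thesis unfolding \<Lambda>'_def by (intro exI)
qed

end

text \<open>
  A round makes at most \<open>29\<close> array accesses of at most \<open>34000\<close> reads each, hence \<open>986000\<close> reads; the control state
  takes \<open>1972044 * B\<close> words.
\<close>

definition query_prog :: "nat \<Rightarrow> nat \<Rightarrow> nat \<Rightarrow> program" where
  "query_prog w B M = macro_machine.prog w B M 986000 1972044 (states w) (rnd w B) (init w)"

text \<open>1972044 = 40 + 2 * 986000 + 4, where 40 comes from \<open>states_card\<close> and the
  rest from the count in \<open>ctls\<close>; the memory needs 4 * B more words.\<close>

lemma (in disk_of) exec_query_prog:
  assumes "1972048 * B \<le> M" "macro_machine.reach w B (states w) (rnd w B) D (init w a b) out t s"
    "s \<in> states w" "io_run D (rnd w B s) = ([], None)"
  shows "\<exists>t'. t' \<le> 986000 * (t + 1) \<and> exec w B M (query_prog w B M) D (query_memory M a b) out t'"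
proof -
  have "\<exists>t'. t' \<le> 986000 * (t + 1) \<and> exec w B M (query_prog w B M) D (query_memory M a b) (out @ []) t'"
    unfolding query_prog_def
  proof (rule macro_machine.exec_query[OF w B _ states_card[OF w]])
    show "io_safe D (rnd w B s)" "io_cost D (rnd w B s) \<le> 986000" for s using rnd_ok[of s] by (simp_all add: io_ok_def)
    show "\<exists>j k. rnd w B s = Rd j k" for s by (rule rnd_Rd)
  qed (use assms is_disk_D in auto)
  then show ?thesis by simp
qed

section \<open>From coloured sets of words to ranks, and the final constants\<close>

lemma signed_word:
  assumes "w \<ge> 1" "x \<in> words w"
  shows "nat (x + 2 ^ (w - 1)) < 2 ^ w" "oc w (nat (x + 2 ^ (w - 1))) = x"
proof -
  have "(2::int) ^ w = 2 * 2 ^ (w - 1)" using assms(1) by (cases w) auto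
  then have "x + 2 ^ (w - 1) < 2 ^ w" "0 \<le> x + 2 ^ (w - 1)" using assms(2) by (auto simp: words_def)
  then show "nat (x + 2 ^ (w - 1)) < 2 ^ w" "oc w (nat (x + 2 ^ (w - 1))) = x"
    by (auto simp: oc_def nat_less_iff)
qed

text \<open>The trie needs at least one element. The empty set is served by a header with N = 0, on
  which the search for a window gives up at once.\<close>

lemma structure_empty:
  assumes w: "w \<ge> 1" and B: "B \<ge> 1" and M: "1972048 * B \<le> M"
  shows "\<exists>D. color_reporting_structure (2 * 10 ^ 8) w B M (query_prog w B M) {} col D"
proof -
  let ?Y = "\<lambda>i m. if i = 0 \<and> m = 0 then [0] else [] :: nat list"
  interpret disk_of w B ?Y "Suc 0" by unfold_locales (use w B in \<open>auto simp: items_def\<close>)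
  have "\<exists>out t. exec w B M (query_prog w B M) D (query_memory M a b) out t \<and> distinct out \<and>
     set out = range_colors {} col a b \<and> real t \<le> 2 * 10 ^ 8 * (real (card (range_colors {} col a b)) / real B + 1)"
    if a: "a \<in> words w" and b: "b \<in> words w" for a b
  proof -
    have "x < 2 ^ (4 * w)" if "x < 2 ^ w" for x :: nat
      by (rule less_le_trans[OF that]) (rule power_increasing, auto)
    from this[OF signed_word(1)[OF w a]] this[OF signed_word(1)[OF w b]]
    have s: "init w a b \<in> states w" by (simp add: states_def init_def)
    have "io_run D (rnd w B (init w a b)) = ([], None)"
      by (simp add: rnd_def init_def start_rnd_def locate_io_def Let_def)
    from exec_query_prog[OF M macro_machine.reach_refl[OF s] s this]
    obtain t where "t \<le> 986000 * (0 + 1)" "exec w B M (query_prog w B M) D (query_memory M a b) [] t" by blast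
    then show ?thesis by (intro exI[of _ "[]"] exI[of _ t]) (simp add: range_colors_def)
  qed
  moreover have "real (length D) \<le> 2 * 10 ^ 8 * (real (card ({}::int set)) / real B + 1)"
    unfolding length_D by simp
  ultimately show ?thesis unfolding color_reporting_structure_def using is_disk_D by blast
qed

lemma structure_nonempty:
  assumes w: "w \<ge> 1" and B: "B \<ge> 1" and M: "1972048 * B \<le> M"
    and S: "S \<subseteq> words w" "col ` S \<subseteq> words w" "S \<noteq> {}"
  shows "\<exists>D. color_reporting_structure (2 * 10 ^ 8) w B M (query_prog w B M) S col D"
proof -
  have fin: "finite S" using S(1) by (rule finite_subset) (simp add: words_def)
  define sh where "sh x = nat (x + 2 ^ (w - 1))" for x :: int
  have sh_mono: "sh x \<le> sh y \<longleftrightarrow> x \<le> y" if "x \<in> words w" "y \<in> words w" for x y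
    using that by (auto simp: sh_def words_def nat_le_eq_zle)
  have sh_w: "sh x < 2 ^ w" and oc_sh: "oc w (sh x) = x" if "x \<in> words w" for x
    unfolding sh_def by (rule signed_word[OF w that])+
  define xs where "xs = sorted_list_of_set S"
  define N where "N = card S"
  define e where "e r = sh (xs ! r)" for r
  define \<kappa> where "\<kappa> r = sh (col (xs ! r))" for r
  have len: "length xs = N" and sx: "set xs = S" and sorted: "sorted_wrt (<) xs"
    using fin by (simp_all add: xs_def N_def length_sorted_list_of_set)
  have xs: "xs ! r \<in> S" if "r < N" for r using that sx len nth_mem by metis
  have xw: "xs ! r \<in> words w" "col (xs ! r) \<in> words w" if "r < N" for r using xs[OF that] S by auto
  interpret cbuild N e \<kappa> w B
  proof
    fix i j assume "i < j" "j < N"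
    then have "xs ! i < xs ! j" using sorted len by (simp add: sorted_wrt_iff_nth_less)
    then show "e i < e j" using sh_mono[of "xs ! j" "xs ! i"] xw \<open>i < j\<close> \<open>j < N\<close> unfolding e_def by (meson leD leI less_trans)
  next
    show "1 \<le> N" using fin S(3) by (simp add: N_def Suc_le_eq card_gt_0_iff)
    have "fan w * fan w * 1 \<le> gsz w B" unfolding gsz_def nblk_def using B by (intro mult_le_mono2)
    then show "fan w * fan w \<le> gsz w B" by simp
    show "e r < 2 ^ w" "\<kappa> r < 2 ^ w" if "r < N" for r unfolding e_def \<kappa>_def using xw[OF that] by (auto intro: sh_w)
  qed (use w B in \<open>auto simp: fan_def\<close>)
  obtain Y s1 s0 E F snap where "cquery w B Y (14 * (N div B + 1)) N e \<kappa> s1 s0 E F snap" using exists_cquery by (elim exE)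
  then interpret cquery w B Y "14 * (N div B + 1)" N e \<kappa> s1 s0 E F snap .
  have "\<exists>out t. exec w B M (query_prog w B M) D (query_memory M a b) out t \<and> distinct out \<and>
     set out = range_colors S col a b \<and> real t \<le> 2 * 10 ^ 8 * (real (card (range_colors S col a b)) / real B + 1)"
    if a: "a \<in> words w" and b: "b \<in> words w" for a b
  proof -
    obtain l t s where l: "RE [0, sh a, sh b] l t s" "s \<in> states w" "io_run D (rnd w B s) = ([], None)" "distinct l"
      "inj_on \<kappa> (set l)" "\<kappa> ` set l = \<kappa> ` inrange (sh a) (sh b)"
      "real t \<le> 110 * (real (card (\<kappa> ` inrange (sh a) (sh b))) / B + 1)"
      using query[OF sh_w[OF a] sh_w[OF b]] by blast
    let ?out = "map (\<lambda>r. oc w (\<kappa> r)) l"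
    have "macro_machine.reach w B (states w) (rnd w B) D (init w a b) ?out t s"
      using l(1) unfolding RE_def init_def sh_def .
    from exec_query_prog[OF M this l(2,3)]
    obtain t' where t': "t' \<le> 986000 * (t + 1)" "exec w B M (query_prog w B M) D (query_memory M a b) ?out t'" by blast
    have "xs ! r \<in> {a..b} \<longleftrightarrow> sh a \<le> e r \<and> e r \<le> sh b" if "r < N" for r
      using sh_mono[OF a xw(1)[OF that]] sh_mono[OF xw(1)[OF that] b] by (simp add: e_def)
    then have "inrange (sh a) (sh b) = {r. r < N \<and> xs ! r \<in> {a..b}}" unfolding inrange_def by blast
    moreover have "S \<inter> {a..b} = (!) xs ` {r. r < N \<and> xs ! r \<in> {a..b}}"
      unfolding sx[symmetric] using len by (auto simp: in_set_conv_nth)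
    ultimately have "S \<inter> {a..b} = (!) xs ` inrange (sh a) (sh b)" by simp
    then have "range_colors S col a b = (\<lambda>r. col (xs ! r)) ` inrange (sh a) (sh b)"
      by (simp add: range_colors_def image_image)
    also have "\<dots> = (\<lambda>r. oc w (\<kappa> r)) ` inrange (sh a) (sh b)"
      by (rule image_cong) (auto simp: inrange_def \<kappa>_def oc_sh xw)
    also have "\<dots> = oc w ` \<kappa> ` set l" by (simp add: l(6) image_image)
    finally have rc: "range_colors S col a b = oc w ` \<kappa> ` set l" .
    have inj: "inj (oc w)" by (rule injI) (simp add: oc_def)
    have "distinct ?out"
      using l(4,5) inj by (auto simp: distinct_map inj_on_def)
    moreover have "set ?out = range_colors S col a b" by (simp add: rc image_image)
    moreover have "real t' \<le> 2 * 10 ^ 8 * (real (card (range_colors S col a b)) / real B + 1)"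
    proof -
      define X where "X = real (card (range_colors S col a b)) / real B"
      have "card (range_colors S col a b) = card (\<kappa> ` inrange (sh a) (sh b))"
        unfolding rc l(6) by (rule card_image) (rule inj_on_subset[OF inj subset_UNIV])
      then have "real t \<le> 110 * (X + 1)" using l(7) unfolding X_def by simp
      moreover have "real t' \<le> 986000 * (real t + 1)"
        using of_nat_mono[OF t'(1), where 'a = real] by simp
      moreover have "0 \<le> X" by (simp add: X_def)
      \<comment> \<open>986000 * (110 + 1) is below 2 * 10^8.\<close>
      ultimately have "real t' \<le> 2 * 10 ^ 8 * (X + 1)" by simp
      then show ?thesis by (simp only: X_def)
    qed
    ultimately show ?thesis using t'(2) by blast
  qed
  moreover have "real (length D) \<le> 2 * 10 ^ 8 * (real (card S) / real B + 1)"
  proof -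
    define X where "X = real (card S) / real B"
    have "real (N div B) \<le> X" unfolding X_def N_def by (rule of_nat_div_le_of_nat)
    \<comment> \<open>154 = 11 * 14: eleven arrays of 14 * (N div B + 1) superblocks each.\<close>
    moreover have "real (length D) = 17000 * (1 + 154 * (real (N div B) + 1))" unfolding length_D by simp
    moreover have "0 \<le> X" by (simp add: X_def)
    ultimately have "real (length D) \<le> 2 * 10 ^ 8 * (X + 1)" by simp
    then show ?thesis by (simp only: X_def)
  qed
  ultimately show ?thesis unfolding color_reporting_structure_def using is_disk_D by blast
qed

theorem theorem2:
  shows "\<exists>(c::real) (m::nat) (P :: nat \<Rightarrow> nat \<Rightarrow> nat \<Rightarrow> program).
    \<forall>w B M. w \<ge> 1 \<longrightarrow> B \<ge> 1 \<longrightarrow> M \<ge> m * B \<longrightarrow>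
      (\<forall>(S :: int set) (col :: int \<Rightarrow> int).
         S \<subseteq> words w \<longrightarrow> col ` S \<subseteq> words w \<longrightarrow>
         (\<exists>D. color_reporting_structure c w B M (P w B M) S col D))"
proof (rule exI[of _ "2 * 10 ^ 8"], rule exI[of _ 1972048], rule exI[of _ query_prog], intro allI impI)
  fix w B M :: nat and S :: "int set" and col :: "int \<Rightarrow> int"
  assume "w \<ge> 1" "B \<ge> 1" "1972048 * B \<le> M" "S \<subseteq> words w" "col ` S \<subseteq> words w"
  then show "\<exists>D. color_reporting_structure (2 * 10 ^ 8) w B M (query_prog w B M) S col D"
    using structure_empty structure_nonempty by (cases "S = {}") auto
qed

end
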